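(* Let $T>0$, $I=[0,T]$. Let $\Phi:\mathbb{R}\to\mathbb{R}$ be a strictly increasing homeomorphism; let $a\in C(I\times\mathbb{R},\mathbb{R})$ and suppose there exist $h\in C(I,\mathbb{R})$ with $h\ge0$ and $p>1$ with $1/h\in L^p(I)$ and $a(t,x)\ge h(t)$ for all $(t,x)\in I\times\mathbb{R}$; let $f:I\times\mathbb{R}^2\to\mathbb{R}$ be Carathéodory. Assume: (i) $\alpha,\beta\in W^{1,p}(I)$ are respectively a lower and an upper solution of $(\Phi(a(t,x(t))x'(t)))'=f(t,x(t),x'(t))$ with $\alpha\le\beta$ on $I$; (ii) for every $R>0$ and every non-negative $\gamma\in L^p(I)$ there is a non-negative $h_{R,\gamma}\in L^p(I)$ with $|f(t,x,y(t))|\le h_{R,\gamma}(t)$ for a.e. $t$, every $|x|\le R$ and every $y\in L^p(I)$ with $|y|\le\gamma$ a.e.; (iii) there exist $H>0$, $q\in(1,\infty]$, non-negative $\mu\in L^q(I)$, non-negative $l\in L^1(I)$, and measurable $\psi:(0,\infty)\to(0,\infty)$ with $1/\psi\in L^1_{\mathrm{loc}}(0,\infty)$, $\int_1^\infty ds/\psi(s)=\infty$, such that $|f(t,x,y)|\le\psi(|\Phi(a(t,x)y)|)(l(t)+\mu(t)|y|^{\frac{q-1}{q}})$ for a.e. $t$, all $x\in[\alpha(t),\beta(t)]$, all $|y|\ge H$; (iv) $P,Q\in C(\mathbb{R}^2,\mathbb{R})$, for every $s\in\mathbb{R}$ the map $P(s,\cdot)$ is increasing and $Q(s,\cdot)$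 is decreasing on $\mathbb{R}$; (v) $P(\alpha(0),\mathcal{A}_\alpha(0))\ge0$, $Q(\alpha(T),\mathcal{A}_\alpha(T))\ge0$, $P(\beta(0),\mathcal{A}_\beta(0))\le0$, $Q(\beta(T),\mathcal{A}_\beta(T))\le0$; (vi) $a(0,x)\ne0$ and $a(T,x)\ne0$ for every $x\in\mathbb{R}$. Then the problem $(\Phi(a(t,x(t))x'(t)))'=f(t,x(t),x'(t))$ a.e. on $I$, $P(x(0),\mathcal{A}_x(0))=0$, $Q(x(T),\mathcal{A}_x(T))=0$ has a solution $x\in W^{1,p}(I)$ with $\alpha(t)\le x(t)\le\beta(t)$ for every $t\in I$. Furthermore, let $M>0$ with $\sup_I|\alpha|,\sup_I|\beta|\le M$, $a_0:=\max\{a(t,x):(t,x)\in I\times[-M,M]\}$, $N>0$ with $N>\max\{H,2M/T\}a_0$, $\Phi(N)>0$, $\Phi(-N)<0$, and $L_M>0$ with $\min\{\int_{\Phi(N)}^{\Phi(L_M)}\frac{ds}{\psi(s)},\int_{-\Phi(-N)}^{-\Phi(-L_M)}\frac{ds}{\psi(s)}\}>\|l\|_{L^1}+\|\mu\|_{L^q}(2M)^{\frac{q-1}{q}}$. Then $\max_{t\in I}|x(t)|\le M$ and $\max_{t\in I}|\mathcal{A}_x(t)|\le L_M$.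
   Context: A continuous $x:I\to\mathbb{R}$ is a solution of the equation $(\Phi(a(t,x(t))x'(t)))'=f(t,x(t),x'(t))$ if $x\in W^{1,1}(I)$, $t\mapsto\Phi(a(t,x(t))x'(t))\in W^{1,1}(I)$, and its derivative equals $f(t,x(t),x'(t))$ a.e.; solutions of boundary value problems additionally satisfy the boundary conditions. Lower [upper] solutions satisfy the same regularity and the inequality $\ge$ [$\le$] a.e. $\mathcal{A}_x$ is the unique continuous function on $I$ equal to $a(t,x(t))x'(t)$ a.e. Carathéodory: measurable in $t$, continuous in $(x,y)$ for a.e. $t$. For $q=\infty$, $\frac{q-1}{q}:=1$. (The boundary functions, denoted $p,q$ in the paper, are renamed $P,Q$ here.) *)

theory Defs
  imports "HOL-Analysis.Analysis" "HOL-Probability.Essential_Supremum"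
begin

definition weak_deriv :: "real \<Rightarrow> (real \<Rightarrow> real) \<Rightarrow> (real \<Rightarrow> real) \<Rightarrow> bool" where
  "weak_deriv T x g \<longleftrightarrow> g absolutely_integrable_on {0..T} \<and>
      (\<forall>t\<in>{0..T}. x t = x 0 + integral {0..t} g)"

definition W11 :: "real \<Rightarrow> (real \<Rightarrow> real) \<Rightarrow> bool" where
  "W11 T x \<longleftrightarrow> (\<exists>g. weak_deriv T x g)"

definition Lp :: "real \<Rightarrow> real \<Rightarrow> (real \<Rightarrow> real) \<Rightarrow> bool" where
  "Lp p T g \<longleftrightarrow> g \<in> borel_measurable (lebesgue_on {0..T}) \<and>
      integrable (lebesgue_on {0..T}) (\<lambda>t. \<bar>g t\<bar> powr p)"

definition Lq_ext :: "ereal \<Rightarrow> real \<Rightarrow> (real \<Rightarrow> real) \<Rightarrow> bool" where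
  "Lq_ext q T g \<longleftrightarrow> g \<in> borel_measurable (lebesgue_on {0..T}) \<and>
      (if q = \<infinity> then (\<exists>C. AE t in lebesgue_on {0..T}. \<bar>g t\<bar> \<le> C)
       else integrable (lebesgue_on {0..T}) (\<lambda>t. \<bar>g t\<bar> powr real_of_ereal q))"

definition Lq_norm :: "ereal \<Rightarrow> real \<Rightarrow> (real \<Rightarrow> real) \<Rightarrow> real" where
  "Lq_norm q T g = (if q = \<infinity> then real_of_ereal (esssup (lebesgue_on {0..T}) (\<lambda>t. ereal \<bar>g t\<bar>))
      else (integral\<^sup>L (lebesgue_on {0..T}) (\<lambda>t. \<bar>g t\<bar> powr real_of_ereal q))
             powr (1 / real_of_ereal q))"

definition L1_norm :: "real \<Rightarrow> (real \<Rightarrow> real) \<Rightarrow> real" where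
  "L1_norm T g = integral\<^sup>L (lebesgue_on {0..T}) (\<lambda>t. \<bar>g t\<bar>)"

definition qexp :: "ereal \<Rightarrow> real" where
  "qexp q = (if q = \<infinity> then 1 else (real_of_ereal q - 1) / real_of_ereal q)"

definition W1p :: "real \<Rightarrow> real \<Rightarrow> (real \<Rightarrow> real) \<Rightarrow> bool" where
  "W1p p T x \<longleftrightarrow> (\<exists>g. weak_deriv T x g \<and> Lp p T g)"

definition sol_rel :: "(real \<Rightarrow> real) \<Rightarrow> (real \<Rightarrow> real \<Rightarrow> real) \<Rightarrow> (real \<Rightarrow> real \<Rightarrow> real \<Rightarrow> real)
    \<Rightarrow> real \<Rightarrow> (real \<Rightarrow> real \<Rightarrow> bool) \<Rightarrow> (real \<Rightarrow> real) \<Rightarrow> bool" where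
  "sol_rel \<Phi> a f T R x \<longleftrightarrow> (\<exists>x' u w. weak_deriv T x x' \<and> weak_deriv T u w \<and>
      (AE t in lebesgue_on {0..T}. u t = \<Phi> (a t (x t) * x' t)) \<and>
      (AE t in lebesgue_on {0..T}. R (w t) (f t (x t) (x' t))))"

definition is_solution where "is_solution \<Phi> a f T x \<longleftrightarrow> sol_rel \<Phi> a f T (=) x"
definition lower_solution where "lower_solution \<Phi> a f T x \<longleftrightarrow> sol_rel \<Phi> a f T (\<ge>) x"
definition upper_solution where "upper_solution \<Phi> a f T x \<longleftrightarrow> sol_rel \<Phi> a f T (\<le>) x"

text \<open>A_x(t): value at t of the unique continuous function on I that equals a(s,x(s)) x'(s) a.e.\<close>
definition flux :: "(real \<Rightarrow> real \<Rightarrow> real) \<Rightarrow> real \<Rightarrow> (real \<Rightarrow> real) \<Rightarrow> real \<Rightarrow> real" where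
  "flux a T x t = (THE v. \<exists>A x'. continuous_on {0..T} A \<and> weak_deriv T x x' \<and>
      (AE s in lebesgue_on {0..T}. A s = a s (x s) * x' s) \<and> A t = v)"

definition caratheodory :: "real \<Rightarrow> (real \<Rightarrow> real \<Rightarrow> real \<Rightarrow> real) \<Rightarrow> bool" where
  "caratheodory T f \<longleftrightarrow> (\<forall>x y. (\<lambda>t. f t x y) \<in> borel_measurable (lebesgue_on {0..T})) \<and>
      (AE t in lebesgue_on {0..T}. continuous_on UNIV (\<lambda>(x, y). f t x y))"

end

theory Submission
  imports Defs "HOL-Complex_Analysis.Great_Picard"
begin

text \<open>
  In the variables \<open>x\<close> and \<open>u = \<Phi> (a t x * x')\<close> the equation is a planar Caratheodory system. It is
  truncated: \<open>x\<close> is clamped between \<open>\<alpha>\<close> and \<open>\<beta>\<close>, the flux is clamped to \<open>[- c, c]\<close>, and outside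
  \<open>[\<alpha>, \<beta>]\<close> the flux entering \<open>f\<close> is moved towards that of the violated barrier by the amount of the
  violation. The right-hand side is then continuous in \<open>(x, u)\<close> and dominated in \<open>L\<^sup>1\<close>, and the boundary
  conditions, also truncated, become a fixed point condition \<open>R (z 0) (z T) = z 0\<close> in the plane. This
  problem is solved for Euler polygons by Brouwer's theorem and then in the limit by Arzela-Ascoli, so
  no fixed point theorem in function spaces is needed.

  A comparison argument at the last minimum of \<open>x - \<alpha>\<close> (and of \<open>\<beta> - x\<close>) gives \<open>\<alpha> \<le> x \<le> \<beta>\<close>; a Nagumo
  argument bounds the flux below \<open>c\<close>, so the truncations are inactive; and where \<open>x\<close> touches a barrier at
  an endpoint, the fluxes are ordered there, which turns the truncated boundary conditions into the
  original ones. The Nagumo argument applies to every solution between \<open>\<alpha>\<close> and \<open>\<beta>\<close>, so the same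
  solution satisfies the flux bound for all admissible \<open>M, N, L\<close>.
\<close>

subsection \<open>Weak derivatives and the flux\<close>

text \<open>The coefficient \<open>a\<close> may vanish on a null set, since only
  \<open>1 / h\<close> in \<open>L^p\<close> controls it. A bounded flux therefore still allows an
  unbounded slope, which is why the flux is truncated instead of \<open>x'\<close> and why slopes
  are majorised by multiples of \<open>1 / h\<close>. Caratheodory solutions need not be unique, so
  there is no map from initial to terminal values to which a shooting argument could be applied. The
  constants are chosen without circularity: \<open>M\<close> bounds the barriers; \<open>N\<close>
  is so large that a flux staying above it would carry \<open>x\<close> further than
  \<open>2 * M\<close>; \<open>L\<close> comes from the divergence of the integral of
  \<open>1 / \<psi>\<close>; \<open>c\<close> exceeds \<open>L\<close> and both barrier fluxes;
  \<open>k\<close> majorises \<open>f\<close> for all slopes up to \<open>5 * c / h\<close>;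
  \<open>U\<close> is computed from \<open>c\<close> and the integral of \<open>k\<close>. Flux
  differences are not known to have weak derivatives, but the differences of their images under
  \<open>\<Phi>\<close> do and have the same sign. Inside the interval null sets are harmless; the
  boundary conditions, however, compare fluxes at single points, and there the positivity of
  \<open>a\<close> at 0 and \<open>T\<close> is indispensable.\<close>

lemma AE_lebesgue_on_iff:
  assumes "S \<in> sets lebesgue"
  shows "(AE t in lebesgue_on S. P t) \<longleftrightarrow> (\<exists>Z. negligible Z \<and> (\<forall>t\<in>S - Z. P t))"
proof -
  have "(AE t in lebesgue_on S. P t) \<longleftrightarrow> (AE t in lebesgue. t \<in> S \<longrightarrow> P t)"
    using assms by (subst AE_restrict_space_iff) auto
  also have "\<dots> \<longleftrightarrow> (\<exists>Z. negligible Z \<and> (\<forall>t\<in>S - Z. P t))"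
  proof
    assume "AE t in lebesgue. t \<in> S \<longrightarrow> P t"
    then obtain Z where "Z \<in> null_sets lebesgue" "{t \<in> space lebesgue. \<not> (t \<in> S \<longrightarrow> P t)} \<subseteq> Z"
      by (auto simp: eventually_ae_filter)
    then show "\<exists>Z. negligible Z \<and> (\<forall>t\<in>S - Z. P t)"
      by (auto simp: negligible_iff_null_sets intro!: exI[of _ Z])
  next
    assume "\<exists>Z. negligible Z \<and> (\<forall>t\<in>S - Z. P t)"
    then show "AE t in lebesgue. t \<in> S \<longrightarrow> P t"
      by (auto simp: negligible_iff_null_sets eventually_ae_filter)
  qed
  finally show ?thesis .
qed

text \<open>
  By Henstock's lemma, Riemann sums of \<open>\<bar>g\<bar>\<close> are close to sums of \<open>\<bar>integral k g\<bar>\<close>, all of which are zero.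
\<close>

lemma integral_zero_imp_AE_zero:
  fixes g :: "real \<Rightarrow> real"
  assumes g: "g absolutely_integrable_on {a..b}"
    and zero: "\<And>t. t \<in> {a..b} \<Longrightarrow> integral {a..t} g = 0"
  shows "AE t in lebesgue_on {a..b}. g t = 0"
proof -
  have gi: "g integrable_on {a..b}" and ni: "(\<lambda>t. \<bar>g t\<bar>) integrable_on {a..b}"
    using g by (auto simp: absolutely_integrable_on_def)
  have sub: "integral {u..v} g = 0" if "a \<le> u" "u \<le> v" "v \<le> b" for u v
  proof -
    have "g integrable_on {a..v}"
      by (rule integrable_on_subinterval[OF gi]) (use that in auto)
    from Henstock_Kurzweil_Integration.integral_combine[OF \<open>a \<le> u\<close> \<open>u \<le> v\<close> this]
    show ?thesis
      using zero[of u] zero[of v] that by simp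
  qed
  have small: "integral {a..b} (\<lambda>t. \<bar>g t\<bar>) \<le> 0 + 2 * e" if "e > 0" for e
  proof -
    have "g integrable_on cbox a b"
      using gi by simp
    from Henstock_lemma[OF this \<open>e > 0\<close>]
    obtain \<gamma>1 where \<gamma>1: "gauge \<gamma>1" "\<And>p. p tagged_partial_division_of cbox a b \<Longrightarrow> \<gamma>1 fine p \<Longrightarrow>
        (\<Sum>(x, k)\<in>p. norm (measure lborel k *\<^sub>R g x - integral k g)) < e"
      by blast
    have "((\<lambda>t. \<bar>g t\<bar>) has_integral integral {a..b} (\<lambda>t. \<bar>g t\<bar>)) (cbox a b)"
      using ni by (simp add: integrable_integral)
    from iffD1[OF has_integral this] \<open>e > 0\<close>
    have "\<exists>\<gamma>. gauge \<gamma> \<and> (\<forall>p. p tagged_division_of cbox a b \<and> \<gamma> fine p \<longrightarrow>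
        norm ((\<Sum>(x, k)\<in>p. measure lborel k *\<^sub>R \<bar>g x\<bar>) - integral {a..b} (\<lambda>t. \<bar>g t\<bar>)) < e)"
      by simp
    then obtain \<gamma>2 where \<gamma>2: "gauge \<gamma>2" "\<forall>p. p tagged_division_of cbox a b \<and> \<gamma>2 fine p \<longrightarrow>
        norm ((\<Sum>(x, k)\<in>p. measure lborel k *\<^sub>R \<bar>g x\<bar>) - integral {a..b} (\<lambda>t. \<bar>g t\<bar>)) < e"
      by (elim exE conjE)
    obtain p where p: "p tagged_division_of cbox a b" "(\<lambda>x. \<gamma>1 x \<inter> \<gamma>2 x) fine p"
      using fine_division_exists[OF gauge_Int[OF \<gamma>1(1) \<gamma>2(1)], of a b] by blast
    then have fine: "\<gamma>1 fine p" "\<gamma>2 fine p"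
      by (auto simp: fine_Int)
    have "(\<Sum>(x, k)\<in>p. norm (measure lborel k *\<^sub>R g x - integral k g)) = (\<Sum>(x, k)\<in>p. measure lborel k *\<^sub>R \<bar>g x\<bar>)"
    proof (intro sum.cong refl, clarify)
      fix x k assume xk: "(x, k) \<in> p"
      obtain u v where k: "k = {u..v}"
        using tagged_division_ofD(4)[OF p(1) xk] by auto
      have "x \<in> k" "k \<subseteq> {a..b}"
        using tagged_division_ofD(2,3)[OF p(1) xk] by auto
      then have "integral k g = 0"
        using k sub[of u v] by auto
      then show "norm (measure lborel k *\<^sub>R g x - integral k g) = measure lborel k *\<^sub>R \<bar>g x\<bar>"
        by (simp add: abs_mult)
    qed
    then have "(\<Sum>(x, k)\<in>p. measure lborel k *\<^sub>R \<bar>g x\<bar>) < e"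
      using \<gamma>1(2)[OF tagged_division_of_def[THEN iffD1, OF p(1), THEN conjunct1] fine(1)] by simp
    then show ?thesis
      using \<gamma>2(2)[rule_format, OF conjI[OF p(1) fine(2)]] unfolding real_norm_def by linarith
  qed
  have "integral {a..b} (\<lambda>t. \<bar>g t\<bar>) \<le> 0"
  proof (rule field_le_epsilon)
    fix e :: real assume "0 < e"
    with small[of "e / 2"] show "integral {a..b} (\<lambda>t. \<bar>g t\<bar>) \<le> 0 + e" by simp
  qed
  moreover have "integral {a..b} (\<lambda>t. \<bar>g t\<bar>) \<ge> 0"
    by (intro Henstock_Kurzweil_Integration.integral_nonneg ni) auto
  moreover have L: "integrable (lebesgue_on {a..b}) (\<lambda>t. \<bar>g t\<bar>)"
    by (intro integrable_abs absolutely_integrable_imp_integrable[OF g]) simp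
  ultimately have "integral\<^sup>L (lebesgue_on {a..b}) (\<lambda>t. \<bar>g t\<bar>) = 0"
    by (subst lebesgue_integral_eq_integral[OF L]) auto
  from iffD1[OF integral_nonneg_eq_0_iff_AE[OF L] this]
  have "AE t in lebesgue_on {a..b}. \<bar>g t\<bar> = 0"
    by (metis (no_types, lifting) AE_I2 abs_ge_zero)
  then show ?thesis
    by (rule eventually_mono) simp
qed

lemma weak_derivD:
  assumes "weak_deriv T x g"
  shows "g absolutely_integrable_on {0..T}"
    and "t \<in> {0..T} \<Longrightarrow> x t = x 0 + integral {0..t} g"
    and "t \<in> {0..T} \<Longrightarrow> (g has_integral (x t - x 0)) {0..t}"
    and "continuous_on {0..T} x"
proof -
  show g: "g absolutely_integrable_on {0..T}"
    using assms unfolding weak_deriv_def by blast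
  show x: "x t = x 0 + integral {0..t} g" if "t \<in> {0..T}" for t
    using assms that unfolding weak_deriv_def by blast
  have gi: "g integrable_on {0..T}"
    using g unfolding absolutely_integrable_on_def by blast
  show "(g has_integral (x t - x 0)) {0..t}" if "t \<in> {0..T}"
  proof -
    have "{0..t} \<subseteq> {0..T}"
      using that by auto
    from integrable_integral[OF integrable_on_subinterval[OF gi this]] show ?thesis
      unfolding x[OF that] by simp
  qed
  have "continuous_on {0..T} (\<lambda>t. x 0 + integral {0..t} g)"
    by (intro continuous_intros indefinite_integral_continuous_1 gi)
  then show "continuous_on {0..T} x"
    by (rule continuous_on_eq) (rule x[symmetric])
qed

lemma weak_deriv_unique:
  assumes "weak_deriv T x g" "weak_deriv T x k"
  shows "AE t in lebesgue_on {0..T}. g t = k t"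
proof -
  have "integral {0..t} (\<lambda>t. g t - k t) = 0" if "t \<in> {0..T}" for t
    using has_integral_diff[OF weak_derivD(3)[OF assms(1) that] weak_derivD(3)[OF assms(2) that]]
    by (simp add: integral_unique)
  with integral_zero_imp_AE_zero[OF set_integral_diff(1)[OF weak_derivD(1)[OF assms(1)] weak_derivD(1)[OF assms(2)]]]
  have "AE t in lebesgue_on {0..T}. g t - k t = 0"
    by blast
  then show ?thesis
    by (rule eventually_mono) simp
qed

lemma continuous_AE_eq:
  fixes A B :: "real \<Rightarrow> real"
  assumes "continuous_on {0..T} A" "continuous_on {0..T} B" "0 < T"
    and "AE t in lebesgue_on {0..T}. A t = B t" and t: "t \<in> {0..T}"
  shows "A t = B t"
proof -
  obtain Z where Z: "negligible Z" "\<And>t. t \<in> {0..T} - Z \<Longrightarrow> A t = B t"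
    using assms(4) by (auto simp: AE_lebesgue_on_iff)
  have int: "(\<lambda>t. \<bar>A t - B t\<bar>) integrable_on {0..T}"
    by (intro integrable_continuous_real continuous_intros assms)
  have "((\<lambda>t. \<bar>A t - B t\<bar>) has_integral 0) (cbox 0 T)"
    using has_integral_spike[OF Z(1), of "{0..T}" "\<lambda>t. \<bar>A t - B t\<bar>" "\<lambda>t. 0" 0] Z(2) by auto
  with assms have "\<bar>A t - B t\<bar> = 0"
    by (intro has_integral_0_cbox_imp_0[of 0 T "\<lambda>t. \<bar>A t - B t\<bar>"])
       (auto intro!: continuous_intros)
  then show ?thesis by simp
qed

text \<open>\<open>flux\<close> is a definite description, so uniqueness has to be settled first:
  two weak derivatives of \<open>x\<close> agree almost everywhere, hence so do two continuous
  representatives, and these then coincide on the nondegenerate interval. Afterwards exhibiting one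
  continuous \<open>A\<close> evaluates the flux.\<close>

lemma flux_eq:
  assumes "0 < T" "weak_deriv T x x'" "continuous_on {0..T} A"
    and A: "AE s in lebesgue_on {0..T}. A s = a s (x s) * x' s" and t: "t \<in> {0..T}"
  shows "flux a T x t = A t"
  unfolding flux_def
proof (rule the_equality)
  show "\<exists>B y. continuous_on {0..T} B \<and> weak_deriv T x y \<and>
      (AE s in lebesgue_on {0..T}. B s = a s (x s) * y s) \<and> B t = A t"
    using assms by blast
next
  fix v assume "\<exists>B y. continuous_on {0..T} B \<and> weak_deriv T x y \<and>
      (AE s in lebesgue_on {0..T}. B s = a s (x s) * y s) \<and> B t = v"
  then obtain B y where B: "continuous_on {0..T} B" "weak_deriv T x y"
      "AE s in lebesgue_on {0..T}. B s = a s (x s) * y s" "B t = v"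
    by blast
  have "AE s in lebesgue_on {0..T}. B s = A s"
    using B(3) A weak_deriv_unique[OF B(2) assms(2)] by eventually_elim auto
  from continuous_AE_eq[OF B(1) assms(3) assms(1) this t] B(4) show "v = A t"
    by simp
qed

subsection \<open>Measurability and integral inequalities\<close>

text \<open>No joint measurability of \<open>f\<close> is given. Rounding \<open>x\<close> and
  \<open>y\<close> down to multiples of \<open>1 / (n + 1)\<close> leaves countably many values, so
  the composition is measurable piece by piece; continuity in the last two arguments carries this to
  the limit.\<close>

lemma measurable_superposition:
  fixes f :: "real \<Rightarrow> real \<Rightarrow> real \<Rightarrow> real"
  assumes f: "\<And>x y. (\<lambda>t. f t x y) \<in> borel_measurable (lebesgue_on S)"
    and cont: "\<And>t. t \<in> S \<Longrightarrow> continuous_on UNIV (\<lambda>(x, y). f t x y)"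
    and x: "x \<in> borel_measurable (lebesgue_on S)" and y: "y \<in> borel_measurable (lebesgue_on S)"
  shows "(\<lambda>t. f t (x t) (y t)) \<in> borel_measurable (lebesgue_on S)"
proof (rule borel_measurable_LIMSEQ_real)
  let ?r = "\<lambda>n u. real_of_int \<lfloor>u * real (Suc n)\<rfloor> / real (Suc n)"
  show "(\<lambda>t. f t (?r n (x t)) (?r n (y t))) \<in> borel_measurable (lebesgue_on S)" for n
  proof -
    have "(\<lambda>t. \<lfloor>x t * real (Suc n)\<rfloor>) \<in> measurable (lebesgue_on S) (count_space UNIV)"
      "(\<lambda>t. \<lfloor>y t * real (Suc n)\<rfloor>) \<in> measurable (lebesgue_on S) (count_space UNIV)"
      using x y by (measurable; simp)+
    note m = this
    have "(\<lambda>t. f t (real_of_int i / real (Suc n)) (?r n (y t))) \<in> borel_measurable (lebesgue_on S)" for i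
      by (rule measurable_compose_countable[OF _ m(2), of "\<lambda>j t. f t (real_of_int i / real (Suc n)) (real_of_int j / real (Suc n))"]) (rule f)
    then show ?thesis
      by (rule measurable_compose_countable[OF _ m(1), of "\<lambda>i t. f t (real_of_int i / real (Suc n)) (?r n (y t))"])
  qed
  have r: "(\<lambda>n. ?r n u) \<longlonglongrightarrow> u" for u :: real
  proof (rule tendsto_sandwich)
    show "(\<lambda>n. u - 1 / real (Suc n)) \<longlonglongrightarrow> u"
      using tendsto_diff[OF tendsto_const LIMSEQ_inverse_real_of_nat, of u] by (simp add: inverse_eq_divide)
    have "u - 1 / m \<le> real_of_int \<lfloor>u * m\<rfloor> / m" "real_of_int \<lfloor>u * m\<rfloor> / m \<le> u" if "0 < m" for m :: real
    proof -
      have "u * m - 1 \<le> real_of_int \<lfloor>u * m\<rfloor>" "real_of_int \<lfloor>u * m\<rfloor> \<le> u * m" by linarith+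
      then show "u - 1 / m \<le> real_of_int \<lfloor>u * m\<rfloor> / m" "real_of_int \<lfloor>u * m\<rfloor> / m \<le> u"
        using divide_right_mono[of "u * m - 1" _ m] divide_right_mono[of _ "u * m" m] that
        by (auto simp: diff_divide_distrib)
    qed
    then show "\<forall>\<^sub>F n in sequentially. u - 1 / real (Suc n) \<le> ?r n u"
      "\<forall>\<^sub>F n in sequentially. ?r n u \<le> u"
      by (intro always_eventually allI; simp del: of_nat_Suc)+
  qed simp
  fix t assume "t \<in> space (lebesgue_on S)"
  then have "t \<in> S" by (simp add: space_restrict_space)
  from continuous_on_tendsto_compose[OF cont[OF this] tendsto_Pair[OF r[of "x t"] r[of "y t"]]]
  show "(\<lambda>n. f t (?r n (x t)) (?r n (y t))) \<longlonglongrightarrow> f t (x t) (y t)"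
    by simp
qed

text \<open>Young's inequality after normalisation. The second factor has the form
  \<open>g powr ((q - 1) / q)\<close>, whose conjugate power is \<open>g\<close> itself, so
  integrability of \<open>g\<close> is enough.\<close>

lemma Holder_weighted:
  fixes f g :: "'b \<Rightarrow> real"
  assumes q: "1 < q" and [measurable]: "f \<in> borel_measurable M"
    and fi: "integrable M (\<lambda>t. f t powr q)" and gi: "integrable M g"
    and f0: "AE t in M. 0 \<le> f t" and g0: "AE t in M. 0 \<le> g t"
  shows "integrable M (\<lambda>t. f t * g t powr ((q - 1) / q))" (is ?int)
    and "(\<integral>t. f t * g t powr ((q - 1) / q) \<partial>M)
      \<le> (\<integral>t. f t powr q \<partial>M) powr (1 / q) * (\<integral>t. g t \<partial>M) powr ((q - 1) / q)" (is ?le)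
proof -
  define e where "e = (q - 1) / q"
  have e: "0 < e" "1 / q + e = 1" "0 < 1 / q"
    using q by (auto simp: e_def field_simps)
  have [measurable]: "g \<in> borel_measurable M"
    using gi by auto
  have young: "u * v powr e \<le> u powr q / q + e * v" if "0 \<le> u" "0 \<le> v" for u v
  proof (cases "u = 0 \<or> v = 0")
    case False
    then show ?thesis
      using Youngs_inequality_0[of "1 / q" e "u powr q" v] that e q by (simp add: powr_powr)
  qed (use that e q in auto)
  have int: "integrable M (\<lambda>t. f t * g t powr e)"
  proof (rule Bochner_Integration.integrable_bound)
    show "integrable M (\<lambda>t. f t powr q / q + e * g t)"
      using fi gi by auto
    show "AE t in M. norm (f t * g t powr e) \<le> norm (f t powr q / q + e * g t)"
      using f0 g0
    proof eventually_elim
      case (elim t)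
      moreover have "0 \<le> f t * g t powr e"
        using elim by simp
      ultimately show ?case
        using young[OF elim] by simp
    qed
  qed measurable
  then show ?int by (simp add: e_def)
  let ?F = "\<integral>t. f t powr q \<partial>M" and ?G = "\<integral>t. g t \<partial>M"
  have F0: "0 \<le> ?F" and G0: "0 \<le> ?G"
    by (rule integral_nonneg_AE; simp add: g0)+
  have "(\<integral>t. f t * g t powr e \<partial>M) \<le> ?F powr (1 / q) * ?G powr e"
  proof (cases "?F = 0 \<or> ?G = 0")
    \<comment> \<open>Normalising would divide by zero here, but one factor vanishes almost
      everywhere and so does the product.\<close>
    case True
    have "AE t in M. f t * g t powr e = 0"
      using True
    proof
      assume "?F = 0"
      then have "AE t in M. f t powr q = 0"
        using integral_nonneg_eq_0_iff_AE[OF fi] by simp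
      then show ?thesis by (rule eventually_mono) simp
    next
      assume "?G = 0"
      then have "AE t in M. g t = 0"
        using integral_nonneg_eq_0_iff_AE[OF gi g0] by simp
      then show ?thesis by (rule eventually_mono) simp
    qed
    then have "(\<integral>t. f t * g t powr e \<partial>M) = 0"
      by (rule integral_eq_zero_AE)
    then show ?thesis by simp
  next
    case False
    have F: "0 < ?F"
      using F0 False by linarith
    have G: "0 < ?G"
      using G0 False by linarith
    \<comment> \<open>Dividing by \<open>c\<close> splits into dividing \<open>f powr q\<close> by
      \<open>?F\<close> and \<open>g\<close> by \<open>?G\<close>; both quotients have integral 1,
      and the Young weights \<open>1 / q\<close> and \<open>e\<close> add up to 1.\<close>
    define c where "c = ?F powr (1 / q) * ?G powr e"
    have c: "0 < c" using F G by (auto simp: c_def)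
    have "(\<integral>t. f t * g t powr e / c \<partial>M) \<le> (\<integral>t. f t powr q / (?F * q) + e * g t / ?G \<partial>M)"
    proof (rule integral_mono_AE)
      show "AE t in M. f t * g t powr e / c \<le> f t powr q / (?F * q) + e * g t / ?G"
        using f0 g0
      proof eventually_elim
        case (elim t)
        have "(f t / ?F powr (1 / q)) powr q = f t powr q / ?F"
          using elim F q by (simp add: powr_divide powr_powr)
        moreover have "f t / ?F powr (1 / q) * (g t / ?G) powr e = f t * g t powr e / c"
          using elim G by (simp add: powr_divide c_def)
        moreover have "f t / ?F powr (1 / q) * (g t / ?G) powr e
            \<le> (f t / ?F powr (1 / q)) powr q / q + e * (g t / ?G)"
          by (rule young) (use elim G in simp_all)
        ultimately show ?case
          by (simp add: field_simps)
      qed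
    qed (use int fi gi in auto)
    also have "\<dots> = ?F / (?F * q) + e * ?G / ?G"
      using fi gi by simp
    also have "\<dots> = 1"
      using F G e by simp
    finally show ?thesis
      using c by (simp add: c_def field_simps)
  qed
  then show ?le by (simp add: e_def)
qed

lemma Lq_Holder:
  assumes q: "1 < q" and mu: "Lq_ext q T \<mu>" and mu0: "AE t in lebesgue_on {0..T}. 0 \<le> \<mu> t"
    and "0 < T"
    and yi: "integrable (lebesgue_on {0..T}) y" and y0: "\<And>t. t \<in> {0..T} \<Longrightarrow> 0 \<le> y t"
  shows "integrable (lebesgue_on {0..T}) (\<lambda>t. \<mu> t * y t powr qexp q)"
    and "integral\<^sup>L (lebesgue_on {0..T}) (\<lambda>t. \<mu> t * y t powr qexp q)
      \<le> Lq_norm q T \<mu> * integral\<^sup>L (lebesgue_on {0..T}) y powr qexp q"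
    and "0 \<le> Lq_norm q T \<mu>"
proof -
  let ?M = "lebesgue_on {0..T}"
  have [measurable]: "\<mu> \<in> borel_measurable ?M" "y \<in> borel_measurable ?M"
    using mu yi by (auto simp: Lq_ext_def)
  have y0': "AE t in ?M. 0 \<le> y t"
    using y0 by (intro AE_I2) (auto simp: space_restrict_space)
  have "integrable ?M (\<lambda>t. \<mu> t * y t powr qexp q) \<and>
    integral\<^sup>L ?M (\<lambda>t. \<mu> t * y t powr qexp q) \<le> Lq_norm q T \<mu> * integral\<^sup>L ?M y powr qexp q \<and>
    0 \<le> Lq_norm q T \<mu>"
  proof (cases "q = \<infinity>")
    case False
    define r where "r = real_of_ereal q"
    have r: "q = ereal r" "1 < r"
      using False q by (cases q; auto simp: r_def)+
    have qe: "qexp q = (r - 1) / r"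
      using False by (simp add: qexp_def r_def)
    have fi: "integrable ?M (\<lambda>t. \<bar>\<mu> t\<bar> powr r)"
      using mu False by (simp add: Lq_ext_def r_def)
    have "AE t in ?M. \<bar>\<mu> t\<bar> powr r = \<mu> t powr r"
      using mu0 by eventually_elim auto
    note ae = this
    have fi': "integrable ?M (\<lambda>t. \<mu> t powr r)"
      by (rule integrable_cong_AE_imp[OF fi _ ae]) measurable
    have eq: "integral\<^sup>L ?M (\<lambda>t. \<bar>\<mu> t\<bar> powr r) = integral\<^sup>L ?M (\<lambda>t. \<mu> t powr r)"
      by (rule integral_cong_AE[OF _ _ ae]) measurable
    show ?thesis
      using Holder_weighted[OF r(2) _ fi' yi mu0 y0'] False
      by (simp add: qe Lq_norm_def eq flip: r_def)
  next
    case True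
    define K where "K = esssup ?M (\<lambda>t. ereal \<bar>\<mu> t\<bar>)"
    obtain C where C: "AE t in ?M. \<bar>\<mu> t\<bar> \<le> C"
      using mu True by (auto simp: Lq_ext_def)
    have "K \<le> ereal C"
      unfolding K_def by (rule esssup_I) (use C in auto)
    have bd: "AE t in ?M. ereal \<bar>\<mu> t\<bar> \<le> K"
      unfolding K_def by (rule esssup_AE)
    \<comment> \<open>An interval of positive length is not negligible, so the bound holds at some
      point. This puts the essential supremum above 0; with the bound \<open>C\<close> it is finite
      and \<open>real_of_ereal\<close> loses nothing.\<close>
    have "\<exists>t. ereal \<bar>\<mu> t\<bar> \<le> K"
    proof (rule ccontr)
      assume "\<not> ?thesis"
      with bd have "AE t in ?M. False" by auto
      then obtain Z where "negligible Z" "{0..T} \<subseteq> Z"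
        by (auto simp: AE_lebesgue_on_iff subset_iff)
      then have "negligible (cbox 0 T)"
        using negligible_subset by auto
      then show False
        using \<open>0 < T\<close> unfolding negligible_interval by simp
    qed
    then have "0 \<le> K"
      using order_trans[of 0 "ereal \<bar>\<mu> t\<bar>" K for t] by auto
    with \<open>K \<le> ereal C\<close> obtain k where k: "K = ereal k" "0 \<le> k"
      by (cases K) auto
    have N: "Lq_norm q T \<mu> = k" "qexp q = 1"
      using True k by (simp_all add: Lq_norm_def qexp_def K_def)
    have le: "AE t in ?M. \<mu> t * y t powr 1 \<le> k * y t" "AE t in ?M. norm (\<mu> t * y t powr 1) \<le> norm (k * y t)"
      using bd mu0 y0' by (eventually_elim; auto simp: k abs_mult intro!: mult_right_mono)+
    have i: "integrable ?M (\<lambda>t. \<mu> t * y t powr 1)"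
      by (rule Bochner_Integration.integrable_bound[OF _ _ le(2)]) (use yi in auto)
    have "integral\<^sup>L ?M (\<lambda>t. \<mu> t * y t powr 1) \<le> integral\<^sup>L ?M (\<lambda>t. k * y t)"
      by (rule integral_mono_AE[OF i _ le(1)]) (use yi in auto)
    moreover have "0 \<le> integral\<^sup>L ?M y"
      using y0' by (rule integral_nonneg_AE)
    ultimately show ?thesis
      using N i k by simp
  qed
  then show "integrable ?M (\<lambda>t. \<mu> t * y t powr qexp q)"
    "integral\<^sup>L ?M (\<lambda>t. \<mu> t * y t powr qexp q) \<le> Lq_norm q T \<mu> * integral\<^sup>L ?M y powr qexp q"
    "0 \<le> Lq_norm q T \<mu>"
    by auto
qed

text \<open>Take \<open>q\<close> as the first time with value \<open>b\<close> and \<open>p\<close>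
  as the last time before \<open>q\<close> with value \<open>a\<close>. Leaving the strip in between
  would force, by the intermediate value theorem, an earlier visit to \<open>b\<close> or a later
  visit to \<open>a\<close>.\<close>

lemma crossing_up:
  fixes u :: "real \<Rightarrow> real"
  assumes u: "continuous_on {s..t} u" and st: "s \<le> t" "u s \<le> a" "a \<le> b" "b \<le> u t"
  obtains p q where "s \<le> p" "p \<le> q" "q \<le> t" "u p = a" "u q = b" "\<And>r. r \<in> {p..q} \<Longrightarrow> u r \<in> {a..b}"
proof -
  have cpt: "compact {r \<in> {x..y}. u r = z}" if "{x..y} \<subseteq> {s..t}" for x y z
  proof -
    have "closed {r \<in> {x..y}. u r = z}"
      by (intro continuous_closed_preimage_constant continuous_on_subset[OF u that]) auto
    then have "compact ({x..y} \<inter> {r \<in> {x..y}. u r = z})"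
      by (intro compact_Int_closed) auto
    moreover have "{x..y} \<inter> {r \<in> {x..y}. u r = z} = {r \<in> {x..y}. u r = z}" by auto
    ultimately show ?thesis by simp
  qed
  have "\<exists>r. s \<le> r \<and> r \<le> t \<and> u r = b"
    by (rule IVT') (use st u in auto)
  then have "{r \<in> {s..t}. u r = b} \<noteq> {}" by auto
  from compact_attains_inf[OF cpt this]
  obtain q where q: "q \<in> {s..t}" "u q = b" "\<And>r. r \<in> {s..t} \<Longrightarrow> u r = b \<Longrightarrow> q \<le> r"
    by auto
  have below: "u r \<le> b" if "r \<in> {s..q}" for r
  proof (rule ccontr)
    assume "\<not> u r \<le> b"
    moreover have "\<exists>r'. s \<le> r' \<and> r' \<le> r \<and> u r' = b"
      by (rule IVT') (use calculation st that q(1) in \<open>auto intro: continuous_on_subset[OF u]\<close>)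
    then obtain r' where "s \<le> r'" "r' \<le> r" "u r' = b" by auto
    with q(3)[of r'] that q(1) have "r = q" by auto
    ultimately show False using q(2) by simp
  qed
  have "\<exists>r. s \<le> r \<and> r \<le> q \<and> u r = a"
    by (rule IVT') (use st q in \<open>auto intro: continuous_on_subset[OF u]\<close>)
  then have "{r \<in> {s..q}. u r = a} \<noteq> {}" by auto
  moreover have "{s..q} \<subseteq> {s..t}" using q(1) by auto
  ultimately obtain p where p: "p \<in> {s..q}" "u p = a" "\<And>r. r \<in> {s..q} \<Longrightarrow> u r = a \<Longrightarrow> r \<le> p"
    using compact_attains_sup[OF cpt[of s q a]] by auto
  have above: "a \<le> u r" if "r \<in> {p..q}" for r
  proof (rule ccontr)
    assume "\<not> a \<le> u r"
    moreover have "\<exists>r'. r \<le> r' \<and> r' \<le> q \<and> u r' = a"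
      by (rule IVT') (use calculation st that q(1,2) p(1) in \<open>auto intro: continuous_on_subset[OF u]\<close>)
    then obtain r' where "r \<le> r'" "r' \<le> q" "u r' = a" by auto
    with p(3)[of r'] that p(1) have "r = p" by auto
    ultimately show False using p(2) by simp
  qed
  show thesis
    using that[of p q] p(1,2) q(1,2) above below by auto
qed

text \<open>A downward passage is an upward one for the reversed time. The direction is then
  forgotten, because the estimates only involve absolute increments.\<close>

lemma crossing:
  fixes u :: "real \<Rightarrow> real"
  assumes u: "continuous_on {s..t} u" and t: "t0 \<in> {s..t}" "t1 \<in> {s..t}" "u t0 \<le> a" "a \<le> b" "b \<le> u t1"
  obtains p q where "s \<le> p" "p \<le> q" "q \<le> t" "\<bar>u q - u p\<bar> = b - a" "\<And>r. r \<in> {p..q} \<Longrightarrow> u r \<in> {a..b}"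
proof (cases "t0 \<le> t1")
  case True
  have "continuous_on {t0..t1} u"
    by (rule continuous_on_subset[OF u]) (use t in auto)
  from crossing_up[OF this True t(3-5)]
  obtain p q where "t0 \<le> p" "p \<le> q" "q \<le> t1" "u p = a" "u q = b" "\<And>r. r \<in> {p..q} \<Longrightarrow> u r \<in> {a..b}"
    by metis
  with t show thesis
    by (intro that[of p q]) auto
next
  case False
  have "continuous_on {-t0..-t1} (\<lambda>r. u (- r))"
    by (intro continuous_on_compose2[OF u] continuous_intros) (use t in auto)
  from crossing_up[OF this, of a b] obtain p q
    where pq: "- t0 \<le> p" "p \<le> q" "q \<le> - t1" "u (- p) = a" "u (- q) = b"
      "\<And>r. r \<in> {p..q} \<Longrightarrow> u (- r) \<in> {a..b}"
    using t False by auto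
  show thesis
  proof (rule that[of "- q" "- p"])
    show "u r \<in> {a..b}" if "r \<in> {- q..- p}" for r
      using pq(6)[of "- r"] that by auto
  qed (use pq t in auto)
qed

text \<open>Domination spreads from intervals to connected open sets by inner regularity, to all
  open sets because these have countably many disjoint components, and to Borel sets by outer
  regularity of the finite measure \<open>N\<close>.\<close>

lemma lborel_Icc_le_measure:
  fixes N :: "real measure"
  assumes N: "sets N = sets borel" "finite_measure N"
    and Icc: "\<And>a b. c \<le> a \<Longrightarrow> a \<le> b \<Longrightarrow> b \<le> d \<Longrightarrow> ennreal (b - a) \<le> emeasure N {a..b}"
  shows "density lborel (indicator {c..d}) \<le> N"
proof -
  let ?L = "density lborel (indicator {c..d} :: real \<Rightarrow> ennreal)"
  have L: "emeasure ?L B = emeasure lborel ({c..d} \<inter> B)" if "B \<in> sets borel" for B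
  proof -
    have "(\<lambda>x. indicator {c..d} x * indicator B x :: ennreal) = indicator ({c..d} \<inter> B)"
      by (auto simp: indicator_def)
    then show ?thesis
      using that by (simp add: emeasure_density)
  qed
  have Lfin: "emeasure ?L (space ?L) \<noteq> \<infinity>"
    by (simp add: L emeasure_lborel_Icc_eq)
  \<comment> \<open>\<open>C\<close> may protrude from \<open>[c, d]\<close> and need not be closed,
    so the hypothesis on intervals does not apply to it directly. For compact \<open>K\<close> in
    \<open>C\<close>, the hull \<open>{p..q}\<close> of \<open>{c..d} \<inter> K\<close> lies in
    both \<open>C\<close> and \<open>[c, d]\<close>.\<close>
  have conn: "emeasure ?L C \<le> emeasure N C" if C: "open C" "connected C" for C
  proof -
    have "emeasure ?L K \<le> emeasure N C" if K: "K \<subseteq> C" "compact K" for K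
    proof (cases "{c..d} \<inter> K = {}")
      case True
      then show ?thesis
        using K by (subst L) (auto intro: borel_compact)
    next
      case False
      have cpt: "compact ({c..d} \<inter> K)"
        using K by (intro compact_Int) auto
      obtain p q where p: "p \<in> {c..d} \<inter> K" "\<And>r. r \<in> {c..d} \<inter> K \<Longrightarrow> p \<le> r"
        and q: "q \<in> {c..d} \<inter> K" "\<And>r. r \<in> {c..d} \<inter> K \<Longrightarrow> r \<le> q"
        using compact_attains_inf[OF cpt False] compact_attains_sup[OF cpt False] by metis
      then have pq: "p \<le> q" by auto
      have "{p..q} \<subseteq> C"
        using connected_contains_Icc[OF C(2)] p(1) q(1) K by auto
      have "emeasure ?L K = emeasure lborel ({c..d} \<inter> K)"
        using K by (subst L) (auto intro: borel_compact)
      also have "\<dots> \<le> emeasure lborel {p..q}"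
        using p(2) q(2) by (intro emeasure_mono) auto
      also have "\<dots> = ennreal (q - p)"
        using pq by simp
      also have "\<dots> \<le> emeasure N {p..q}"
        using Icc[of p q] p(1) q(1) pq by auto
      also have "\<dots> \<le> emeasure N C"
        using \<open>{p..q} \<subseteq> C\<close> C(1) N(1) by (intro emeasure_mono) auto
      finally show ?thesis .
    qed
    then show ?thesis
      using C(1) Lfin by (subst inner_regular) (auto intro!: SUP_least)
  qed
  have opens: "emeasure ?L U \<le> emeasure N U" if U: "open U" for U
  proof -
    have comp: "open C" "connected C" if "C \<in> components U" for C
      using that U open_components in_components_connected by blast+
    have disj: "disjoint_family_on (\<lambda>C. C) (components U)"
      unfolding disjoint_family_on_def using components_nonoverlap by blast
    have cnt: "countable (components U)"
      by (rule countable_disjoint_open_subsets[OF comp(1)])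
         (auto simp: pairwise_def disjnt_def components_nonoverlap)
    have U_eq: "U = (\<Union>C\<in>components U. C)"
      using Union_components[of U] by simp
    have eq: "emeasure K U = (\<integral>\<^sup>+C. emeasure K C \<partial>count_space (components U))"
      if "sets K = sets borel" for K :: "real measure"
      by (subst U_eq, subst emeasure_UN_countable) (use that comp disj cnt in auto)
    show ?thesis
      unfolding eq[of ?L, simplified] eq[OF N(1)]
      by (intro nn_integral_mono) (auto intro: conn comp)
  qed
  have "emeasure N (space N) \<noteq> \<infinity>"
    using N(2) by (simp add: finite_measure.emeasure_finite)
  then have "emeasure ?L B \<le> emeasure N B" if B: "B \<in> sets borel" for B
  proof (subst outer_regular[OF N(1) _ B], simp, intro INF_greatest)
    fix U assume "U \<in> {U. B \<subseteq> U \<and> open U}" 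
    then have U: "B \<subseteq> U" "open U" by auto
    have "emeasure ?L B \<le> emeasure ?L U"
      using U by (intro emeasure_mono) auto
    also have "\<dots> \<le> emeasure N U"
      by (rule opens[OF U(2)])
    finally show "emeasure ?L B \<le> emeasure N U" .
  qed
  then show ?thesis
    using N(1) by (subst le_measure) auto
qed

text \<open>
  For an arbitrary integrable \<open>g\<close> the primitive of \<open>g\<close> composed with \<open>u\<close> need not be absolutely
  continuous, so no chain rule is available. Instead, the image under \<open>u\<close> of the measure with density
  \<open>\<bar>w\<bar>\<close> dominates Lebesgue measure on \<open>[c, d]\<close>, because this holds for intervals.
\<close>

lemma integral_le_of_velocity_bound:
  fixes u w g m :: "real \<Rightarrow> real"
  assumes w: "w absolutely_integrable_on {s..t}"
    and uw: "\<And>r. r \<in> {s..t} \<Longrightarrow> (w has_integral (u r - u s)) {s..r}"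
    and t: "t0 \<in> {s..t}" "t1 \<in> {s..t}" "u t0 \<le> c" "c \<le> d" "d \<le> u t1"
    and g: "g integrable_on {c..d}" "\<And>x. x \<in> {c..d} \<Longrightarrow> 0 \<le> g x"
    and m: "m integrable_on {s..t}" "\<And>r. r \<in> {s..t} \<Longrightarrow> 0 \<le> m r"
    and le: "AE r in lebesgue_on {s..t}. u r \<in> {c..d} \<longrightarrow> g (u r) * \<bar>w r\<bar> \<le> m r"
  shows "integral {c..d} g \<le> integral {s..t} m"
proof -
  let ?T = "lebesgue_on {s..t}"
  have wi: "w integrable_on {s..t}" "(\<lambda>r. \<bar>w r\<bar>) integrable_on {s..t}"
    using w unfolding absolutely_integrable_on_def by auto
  have [measurable]: "w \<in> borel_measurable ?T"
    by (rule absolutely_integrable_imp_borel_measurable[OF w]) simp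
  have u_eq: "u r = u s + integral {s..r} w" if "r \<in> {s..t}" for r
    using integral_unique[OF uw[OF that]] by simp
  have "continuous_on {s..t} (\<lambda>r. u s + integral {s..r} w)"
    by (intro continuous_intros indefinite_integral_continuous_1 wi)
  then have u: "continuous_on {s..t} u"
    by (rule continuous_on_eq) (rule u_eq[symmetric])
  then have [measurable]: "u \<in> borel_measurable ?T"
    by (intro continuous_imp_measurable_on_sets_lebesgue) auto
  \<comment> \<open>\<open>M\<close> measures the variation of \<open>u\<close> spent during a set
    of times; its image \<open>N\<close> distributes this variation over the levels of
    \<open>u\<close>.\<close>
  define M where "M = density ?T (\<lambda>r. ennreal \<bar>w r\<bar>)"
  define N where "N = distr M borel u"
  have [measurable]: "u \<in> borel_measurable M"
    unfolding M_def by simp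
  have sp: "space M = {s..t}"
    by (simp add: M_def space_restrict_space)
  have nn: "(\<integral>\<^sup>+r\<in>{p..q}. ennreal (k r) \<partial>?T) = ennreal (integral {p..q} k)"
    if "{p..q} \<subseteq> {s..t}" "k integrable_on {p..q}" "\<And>r. r \<in> {p..q} \<Longrightarrow> 0 \<le> k r" for p q and k :: "real \<Rightarrow> real"
  proof -
    have "(\<integral>\<^sup>+r\<in>{p..q}. ennreal (k r) \<partial>?T) = (\<integral>\<^sup>+r. ennreal (k r) * indicator {p..q} r * indicator {s..t} r \<partial>lebesgue)"
      by (subst nn_integral_restrict_space) auto
    also have "\<dots> = (\<integral>\<^sup>+r. ennreal (k r) * indicator {p..q} r \<partial>lborel)"
      unfolding nn_integral_completion using that(1)
      by (intro nn_integral_cong) (auto simp: indicator_def)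
    also have "\<dots> = ennreal (integral {p..q} k)"
      by (rule nn_integral_has_integral_lebesgue'[OF that(3) integrable_integral[OF that(2)]])
    finally show ?thesis .
  qed
  have M_Icc: "emeasure M {p..q} = ennreal (integral {p..q} (\<lambda>r. \<bar>w r\<bar>))" if "{p..q} \<subseteq> {s..t}" for p q
  proof -
    have "{p..q} \<in> sets ?T"
      using that by (auto simp: sets_restrict_space_iff)
    then have "emeasure M {p..q} = (\<integral>\<^sup>+r\<in>{p..q}. ennreal \<bar>w r\<bar> \<partial>?T)"
      unfolding M_def by (subst emeasure_density) auto
    then show ?thesis
      using nn[OF that integrable_on_subinterval[OF wi(2) that]] by simp
  qed
  have "finite_measure M"
    by (rule finite_measureI) (use M_Icc[of s t] sp in simp)
  then have Nfin: "finite_measure N"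
    unfolding N_def by (rule finite_measure.finite_measure_distr) measurable
  have "density lborel (indicator {c..d}) \<le> N"
  proof (rule lborel_Icc_le_measure)
    \<comment> \<open>Passing over \<open>[a, b]\<close> costs at least \<open>b - a\<close> of
      variation, all spent while \<open>u\<close> is in \<open>[a, b]\<close>.\<close>
    fix a b assume ab: "c \<le> a" "a \<le> b" "b \<le> d"
    have "u t0 \<le> a" "b \<le> u t1"
      using t ab by auto
    from crossing[OF u t(1,2) this(1) ab(2) this(2)]
    obtain p q where pq: "s \<le> p" "p \<le> q" "q \<le> t" "\<bar>u q - u p\<bar> = b - a" "\<And>r. r \<in> {p..q} \<Longrightarrow> u r \<in> {a..b}"
      by metis
    have sub: "{p..q} \<subseteq> {s..t}" "{s..q} \<subseteq> {s..t}" using pq by auto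
    have "u q - u p = integral {p..q} w"
      using Henstock_Kurzweil_Integration.integral_combine[OF pq(1,2) integrable_on_subinterval[OF wi(1) sub(2)]] pq
      using u_eq[of p] u_eq[of q] by auto
    moreover have "\<bar>integral {p..q} w\<bar> \<le> integral {p..q} (\<lambda>r. \<bar>w r\<bar>)"
      using integral_norm_bound_integral[OF integrable_on_subinterval[OF wi(1) sub(1)]
          integrable_on_subinterval[OF wi(2) sub(1)]] by simp
    ultimately have "ennreal (b - a) \<le> emeasure M {p..q}"
      using pq(4) M_Icc[OF sub(1)] by (simp add: ennreal_leI)
    also have "\<dots> \<le> emeasure M (u -` {a..b} \<inter> space M)"
    proof (rule emeasure_mono)
      show "{p..q} \<subseteq> u -` {a..b} \<inter> space M"
        using pq(5) sub(1) sp by auto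
      show "u -` {a..b} \<inter> space M \<in> sets M"
        by measurable
    qed
    also have "\<dots> = emeasure N {a..b}"
      unfolding N_def by (subst emeasure_distr) auto
    finally show "ennreal (b - a) \<le> emeasure N {a..b}" .
  qed (use Nfin in \<open>auto simp: N_def\<close>)
  note LN = this
  define h where "h x = indicator {c..d} x * g x" for x :: real
  have hm: "h \<in> borel_measurable lebesgue"
    using has_integral_implies_lebesgue_measurable[OF integrable_integral[OF g(1)]]
    by (simp add: h_def[abs_def])
  obtain g0 where [measurable]: "g0 \<in> borel_measurable borel" and g0: "AE x in lborel. h x = g0 x"
    using completion_ex_borel_measurable_real[OF hm] by auto
  obtain Z where Z: "Z \<in> null_sets lborel" "{x \<in> space lborel. h x \<noteq> g0 x} \<subseteq> Z"
    using g0 by (auto simp: eventually_ae_filter)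
  have [measurable]: "Z \<in> sets borel"
    using Z(1) by (auto simp: null_sets_def)
  \<comment> \<open>\<open>g\<close> is only Lebesgue measurable, and an arbitrary Borel version
    could differ from it along \<open>u\<close> on a set of times of positive measure. Setting the
    version to 0 on \<open>Z\<close> makes \<open>g'\<close> equal to \<open>h\<close> or 0 at every
    point, so the bound on \<open>g (u r) * \<bar>w r\<bar>\<close> survives pointwise, while the
    Lebesgue integral is unchanged.\<close>
  define g' where "g' x = indicator (- Z) x * g0 x" for x
  have [measurable]: "g' \<in> borel_measurable borel"
    unfolding g'_def[abs_def] by measurable
  have g': "g' x = indicator (- Z) x * h x" for x
    using Z(2) by (auto simp: g'_def indicator_def)
  have "ennreal (integral {c..d} g) = (\<integral>\<^sup>+x. ennreal (h x) \<partial>lborel)"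
    using nn_integral_has_integral_lebesgue[OF g(2) integrable_integral[OF g(1)]] by (simp add: h_def)
  also have "\<dots> = (\<integral>\<^sup>+x. ennreal (g' x) \<partial>lborel)"
    by (intro nn_integral_cong_AE eventually_mono[OF AE_not_in[OF Z(1)]]) (simp add: g')
  also have "\<dots> = (\<integral>\<^sup>+x. ennreal (g' x) \<partial>density lborel (indicator {c..d}))"
  proof -
    have "ennreal (g' x) = indicator {c..d} x * ennreal (g' x)" for x
      by (auto simp: g' h_def indicator_def)
    then show ?thesis
      by (subst nn_integral_density) auto
  qed
  also have "\<dots> \<le> (\<integral>\<^sup>+x. ennreal (g' x) \<partial>N)"
    by (intro nn_integral_mono_measure LN) (simp add: N_def)
  also have "\<dots> = (\<integral>\<^sup>+r. ennreal \<bar>w r\<bar> * ennreal (g' (u r)) \<partial>?T)"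
    unfolding N_def M_def by (subst nn_integral_distr, simp, simp, subst nn_integral_density) auto
  also have "\<dots> \<le> (\<integral>\<^sup>+r. ennreal (m r) * indicator {s..t} r \<partial>?T)"
  proof (rule nn_integral_mono_AE)
    have "AE r in ?T. r \<in> {s..t}"
      by (intro AE_I2) (simp add: space_restrict_space)
    with le show "AE r in ?T. ennreal \<bar>w r\<bar> * ennreal (g' (u r)) \<le> ennreal (m r) * indicator {s..t} r"
    proof eventually_elim
      case (elim r)
      have "0 \<le> g' (u r)" "g' (u r) * \<bar>w r\<bar> \<le> m r"
        using elim m(2)[of r] g(2)[of "u r"] by (auto simp: g' h_def indicator_def)
      then have "ennreal (\<bar>w r\<bar> * g' (u r)) \<le> ennreal (m r)"
        by (intro ennreal_leI) (simp add: mult.commute)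
      then show ?case
        using elim \<open>0 \<le> g' (u r)\<close> by (simp add: ennreal_mult)
    qed
  qed
  also have "\<dots> = ennreal (integral {s..t} m)"
    by (rule nn[OF subset_refl m])
  finally show ?thesis
    using Henstock_Kurzweil_Integration.integral_nonneg[OF m] by (simp add: ennreal_le_iff)
qed

subsection \<open>Increments and comparison\<close>

lemma has_integral_increment:
  fixes y r :: "real \<Rightarrow> real"
  assumes y: "\<And>t. t \<in> {0..T} \<Longrightarrow> (r has_integral (y t - y 0)) {0..t}" and st: "0 \<le> s" "s \<le> t" "t \<le> T"
  shows "(r has_integral (y t - y s)) {s..t}"
proof -
  have t: "t \<in> {0..T}" "s \<in> {0..T}" using st by auto
  have "r integrable_on {0..t}"
    using y[OF t(1)] by blast
  then have "r integrable_on {s..t}"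
    by (rule integrable_on_subinterval) (use st in auto)
  then obtain i where i: "(r has_integral i) {s..t}" by blast
  have "(r has_integral (y s - y 0 + i)) {0..t}"
    by (rule has_integral_combine[OF st(1,2) y[OF t(2)] i])
  then have "y s - y 0 + i = y t - y 0"
    using y[OF t(1)] by (rule has_integral_unique)
  then have "i = y t - y s" by simp
  with i show ?thesis by simp
qed

lemma increment_le_AE:
  fixes y r :: "real \<Rightarrow> real"
  assumes y: "\<And>t. t \<in> {0..T} \<Longrightarrow> (r has_integral (y t - y 0)) {0..t}" and st: "0 \<le> s" "s \<le> t" "t \<le> T"
    and Z: "negligible Z" and r: "\<And>\<xi>. \<xi> \<in> {s..t} - Z \<Longrightarrow> r \<xi> \<le> C"
  shows "y t - y s \<le> C * (t - s)"
proof -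
  let ?r = "\<lambda>\<xi>. if \<xi> \<in> Z then C else r \<xi>"
  have "(?r has_integral (y t - y s)) {s..t}"
    by (rule has_integral_spike[OF Z _ has_integral_increment[OF y st]]) auto
  moreover have "((\<lambda>\<xi>. C) has_integral C * (t - s)) {s..t}"
    using has_integral_const_real[of C s t] st by (simp add: mult.commute)
  ultimately show ?thesis
    by (rule has_integral_le) (use r in auto)
qed

lemma increment_ge_AE:
  fixes y r :: "real \<Rightarrow> real"
  assumes y: "\<And>t. t \<in> {0..T} \<Longrightarrow> (r has_integral (y t - y 0)) {0..t}" and st: "0 \<le> s" "s \<le> t" "t \<le> T"
    and Z: "negligible Z" and r: "\<And>\<xi>. \<xi> \<in> {s..t} - Z \<Longrightarrow> C \<le> r \<xi>"
  shows "C * (t - s) \<le> y t - y s"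
proof -
  have "- y t - - y s \<le> (- C) * (t - s)"
  proof (rule increment_le_AE[where r="\<lambda>t. - r t", OF _ st Z])
    show "((\<lambda>t. - r t) has_integral (- y t - - y 0)) {0..t}" if "t \<in> {0..T}" for t
      using has_integral_neg[OF y[OF that]] by simp
  qed (use r in simp)
  then show ?thesis by simp
qed

text \<open>Strictness is lost when a positive bound is merely integrated. If
  \<open>y t \<le> y s\<close>, the monotone \<open>y\<close> is constant on \<open>[s, t]\<close>;
  then every primitive of \<open>r\<close> vanishes and \<open>r\<close> is zero almost everywhere,
  against its positivity.\<close>

lemma increment_pos_AE:
  fixes y r :: "real \<Rightarrow> real"
  assumes y: "\<And>t. t \<in> {0..T} \<Longrightarrow> (r has_integral (y t - y 0)) {0..t}" and st: "0 \<le> s" "s < t" "t \<le> T"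
    and Z: "negligible Z" and r: "\<And>\<xi>. \<xi> \<in> {s..t} - Z \<Longrightarrow> 0 < r \<xi>"
  shows "y s < y t"
proof (rule ccontr)
  assume neg: "\<not> y s < y t"
  have inc: "y p \<le> y q" if pq: "s \<le> p" "p \<le> q" "q \<le> t" for p q
  proof -
    have "0 * (q - p) \<le> y q - y p"
    proof (rule increment_ge_AE[OF y _ pq(2) _ Z])
      show "0 \<le> r \<xi>" if "\<xi> \<in> {p..q} - Z" for \<xi>
        using r[of \<xi>] that pq by (intro less_imp_le) auto
    qed (use pq st in auto)
    then show ?thesis by simp
  qed
  have inc_s: "(r has_integral (y q - y s)) {s..q}" if "q \<in> {s..t}" for q
    using that st by (intro has_integral_increment[OF y]) auto
  have const: "integral {s..q} r = 0" if q: "q \<in> {s..t}" for q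
  proof -
    have "y q = y s"
      using inc[of s q] inc[of q t] q neg by simp
    then show ?thesis
      using integral_unique[OF inc_s[OF q]] by simp
  qed
  have ri: "r integrable_on {s..t}"
    using inc_s[of t] st(2) by (intro has_integral_integrable) simp
  define r' where "r' \<xi> = (if \<xi> \<in> Z then 0 else r \<xi>)" for \<xi>
  have "r' integrable_on {s..t}"
    by (rule integrable_spike[OF ri Z]) (simp add: r'_def)
  then have "r' absolutely_integrable_on {s..t}"
    by (rule nonnegative_absolutely_integrable_1) (use r in \<open>simp add: r'_def less_imp_le\<close>)
  then have "r absolutely_integrable_on {s..t}"
    by (rule absolutely_integrable_spike[OF _ Z]) (simp add: r'_def)
  from integral_zero_imp_AE_zero[OF this const]
  obtain Z' where Z': "negligible Z'" "\<And>\<xi>. \<xi> \<in> {s..t} - Z' \<Longrightarrow> r \<xi> = 0"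
    by (auto simp: AE_lebesgue_on_iff)
  have "\<xi> \<in> Z \<union> Z'" if "\<xi> \<in> {s..t}" for \<xi>
    using r[of \<xi>] Z'(2)[of \<xi>] that by force
  then have "negligible (cbox s t)"
    by (intro negligible_subset[OF negligible_Un[OF Z Z'(1)]]) (simp add: subset_iff)
  then show False
    using st unfolding negligible_interval by simp
qed

text \<open>Let \<open>\<xi>\<close> be the last minimum point of \<open>y\<close>, with negative
  value and hence interior. If \<open>z\<close> is positive there, \<open>y\<close> increases
  strictly up to \<open>\<xi>\<close>, so it was smaller before. Otherwise \<open>z \<le> 0\<close>
  just after \<open>\<xi>\<close>, \<open>y\<close> does not increase, and the minimum is attained
  again later. Continuity settles \<open>z \<xi> < 0\<close>; \<open>dec\<close> is needed only for
  \<open>z \<xi> = 0\<close>.\<close>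

lemma comparison_nonneg:
  fixes y z r :: "real \<Rightarrow> real"
  assumes y: "\<And>t. t \<in> {0..T} \<Longrightarrow> (r has_integral (y t - y 0)) {0..t}"
    and yc: "continuous_on {0..T} y" and zc: "continuous_on {0..T} z"
    and ends: "0 \<le> y 0" "0 \<le> y T"
    and Z: "negligible Z"
    and pos: "\<And>t. t \<in> {0..T} - Z \<Longrightarrow> y t < 0 \<Longrightarrow> 0 < z t \<Longrightarrow> 0 < r t"
    and nonpos: "\<And>t. t \<in> {0..T} - Z \<Longrightarrow> y t < 0 \<Longrightarrow> z t \<le> 0 \<Longrightarrow> r t \<le> 0"
    and dec: "\<And>t. t \<in> {0..<T} \<Longrightarrow> y t < 0 \<Longrightarrow> z t = 0 \<Longrightarrow> \<exists>e>0. \<forall>s\<in>{t..t + e} \<inter> {0..T}. z s \<le> 0"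
    and t: "t \<in> {0..T}"
  shows "0 \<le> y t"
proof (rule ccontr)
  assume yt: "\<not> 0 \<le> y t"
  have "{0..T} \<noteq> {}" using t by auto
  from continuous_attains_inf[OF compact_Icc this yc]
  obtain tm where tm: "tm \<in> {0..T}" "\<forall>s\<in>{0..T}. y tm \<le> y s"
    by blast
  have "closed {s \<in> {0..T}. y s = y tm}"
    by (rule continuous_closed_preimage_constant[OF yc]) simp
  then have "compact ({0..T} \<inter> {s \<in> {0..T}. y s = y tm})"
    by (intro compact_Int_closed) auto
  moreover have "{0..T} \<inter> {s \<in> {0..T}. y s = y tm} = {s \<in> {0..T}. y s = y tm}" by auto
  ultimately have cpt: "compact {s \<in> {0..T}. y s = y tm}" by simp
  have "{s \<in> {0..T}. y s = y tm} \<noteq> {}" using tm by auto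
  from compact_attains_sup[OF cpt this]
  obtain \<xi> where "\<xi> \<in> {s \<in> {0..T}. y s = y tm}" "\<forall>s\<in>{s \<in> {0..T}. y s = y tm}. s \<le> \<xi>"
    by blast
  then have \<xi>: "\<xi> \<in> {0..T}" "y \<xi> = y tm" "\<And>s. s \<in> {0..T} \<Longrightarrow> y s = y tm \<Longrightarrow> s \<le> \<xi>"
    by blast+
  have y\<xi>: "y \<xi> < 0" "0 < - y \<xi>"
    using tm(2)[rule_format, OF t] yt \<xi>(2) by linarith+
  have "\<xi> \<noteq> 0" "\<xi> \<noteq> T"
    using ends y\<xi> by auto
  with \<xi>(1) have \<xi>0: "0 < \<xi>" "\<xi> < T"
    by auto
  from yc[unfolded continuous_on_iff, rule_format, OF \<xi>(1) y\<xi>(2)]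
  obtain d1 where d1: "d1 > 0" "\<forall>s\<in>{0..T}. dist s \<xi> < d1 \<longrightarrow> dist (y s) (y \<xi>) < - y \<xi>"
    by blast
  have yneg: "y s < 0" if "s \<in> {0..T}" "\<bar>s - \<xi>\<bar> < d1" for s
    using d1(2)[rule_format, OF that(1)] that(2) unfolding dist_real_def by linarith
  show False
  proof (cases "0 < z \<xi>")
    case True
    from zc[unfolded continuous_on_iff, rule_format, OF \<xi>(1) True]
    obtain d2 where d2: "d2 > 0" "\<forall>s\<in>{0..T}. dist s \<xi> < d2 \<longrightarrow> dist (z s) (z \<xi>) < z \<xi>"
      by blast
    have zpos: "0 < z s" if "s \<in> {0..T}" "\<bar>s - \<xi>\<bar> < d2" for s
      using d2(2)[rule_format, OF that(1)] that(2) unfolding dist_real_def by linarith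
    define s where "s = \<xi> - min \<xi> (min d1 d2) / 2"
    have s: "0 \<le> s" "s < \<xi>" "\<xi> - s < d1" "\<xi> - s < d2"
      using d1(1) d2(1) \<xi>0 by (auto simp: s_def min_def)
    have "y s < y \<xi>"
    proof (rule increment_pos_AE[OF y s(1,2) _ Z])
      fix v assume v: "v \<in> {s..\<xi>} - Z"
      then have "v \<in> {0..T} - Z" "\<bar>v - \<xi>\<bar> < d1" "\<bar>v - \<xi>\<bar> < d2"
        using s \<xi>0 by auto
      then show "0 < r v"
        using pos[of v] yneg[of v] zpos[of v] by blast
    qed (use \<xi>0 in auto)
    then show False
      using tm(2)[rule_format, of s] \<xi>(1,2) s by simp
  next
    case False
    have "\<exists>e>0. \<forall>s\<in>{\<xi>..\<xi> + e} \<inter> {0..T}. z s \<le> 0"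
    proof (cases "z \<xi> = 0")
      case True
      then show ?thesis
        using dec[of \<xi>] \<xi>0 y\<xi> by auto
    next
      case neq: False
      with False have "0 < - z \<xi>" by simp
      from zc[unfolded continuous_on_iff, rule_format, OF \<xi>(1) this]
      obtain d2 where d2: "d2 > 0" "\<forall>s\<in>{0..T}. dist s \<xi> < d2 \<longrightarrow> dist (z s) (z \<xi>) < - z \<xi>"
        by blast
      have "z s \<le> 0" if "s \<in> {\<xi>..\<xi> + d2 / 2} \<inter> {0..T}" for s
        using d2(2)[rule_format, of s] that d2(1) by (auto simp: dist_real_def)
      then show ?thesis
        using d2(1) by (intro exI[of _ "d2 / 2"]) auto
    qed
    then obtain e where e: "e > 0" "\<And>s. s \<in> {\<xi>..\<xi> + e} \<inter> {0..T} \<Longrightarrow> z s \<le> 0"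
      by blast
    define s where "s = \<xi> + min (T - \<xi>) (min d1 e) / 2"
    have s: "s \<le> T" "\<xi> < s" "s - \<xi> < d1" "s - \<xi> < e"
      using d1(1) e(1) \<xi>0 by (auto simp: s_def min_def field_simps)
    have "y s - y \<xi> \<le> 0 * (s - \<xi>)"
    proof (rule increment_le_AE[OF y _ _ _ Z])
      fix v assume v: "v \<in> {\<xi>..s} - Z"
      then have "v \<in> {0..T} - Z" "\<bar>v - \<xi>\<bar> < d1" "v \<in> {\<xi>..\<xi> + e} \<inter> {0..T}"
        using s \<xi>0 by auto
      then show "r v \<le> 0"
        using nonpos[of v] yneg[of v] e(2)[of v] by blast
    qed (use \<xi>0 s in auto)
    then have "y s = y tm"
      using tm(2)[rule_format, of s] \<xi>(1,2) s \<xi>0 by simp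
    then show False
      using \<xi>(3)[of s] s \<xi>0 by auto
  qed
qed

text \<open>Supplies \<open>dec\<close> of \<open>comparison_nonneg\<close>. When
  \<open>z t = 0\<close> and \<open>y t < 0\<close>, also \<open>e t = 0\<close>, so
  \<open>\<bar>e\<bar> \<le> - y\<close> persists for a while by continuity; there
  \<open>\<rho> \<le> 0\<close> and \<open>z\<close> cannot become positive. In the application
  \<open>e\<close> is the clamped flux minus the barrier flux, and
  \<open>\<bar>e\<bar> \<le> - y\<close> is the region in which \<open>trunc_flux\<close> equals the
  barrier flux.\<close>

lemma barrier_nonneg:
  fixes y z r \<rho> e :: "real \<Rightarrow> real"
  assumes y: "\<And>t. t \<in> {0..T} \<Longrightarrow> (r has_integral (y t - y 0)) {0..t}"
    and z: "\<And>t. t \<in> {0..T} \<Longrightarrow> (\<rho> has_integral (z t - z 0)) {0..t}"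
    and yc: "continuous_on {0..T} y" and zc: "continuous_on {0..T} z" and ec: "continuous_on {0..T} e"
    and ends: "0 \<le> y 0" "0 \<le> y T"
    and Z: "negligible Z"
    and pos: "\<And>t. t \<in> {0..T} - Z \<Longrightarrow> y t < 0 \<Longrightarrow> 0 < z t \<Longrightarrow> 0 < r t"
    and nonpos: "\<And>t. t \<in> {0..T} - Z \<Longrightarrow> y t < 0 \<Longrightarrow> z t \<le> 0 \<Longrightarrow> r t \<le> 0"
    and e0: "\<And>t. t \<in> {0..T} \<Longrightarrow> z t = 0 \<Longrightarrow> e t = 0"
    and \<rho>: "\<And>t. t \<in> {0..T} - Z \<Longrightarrow> y t < 0 \<Longrightarrow> \<bar>e t\<bar> \<le> - y t \<Longrightarrow> \<rho> t \<le> 0"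
    and t: "t \<in> {0..T}"
  shows "0 \<le> y t"
proof (rule comparison_nonneg[OF y yc zc ends Z pos nonpos _ t])
  fix t assume t: "t \<in> {0..<T}" "y t < 0" "z t = 0"
  then have tT: "t \<in> {0..T}" by auto
  have "continuous_on {0..T} (\<lambda>s. \<bar>e s\<bar> + y s)"
    by (intro continuous_intros ec yc)
  moreover have "0 < - (\<bar>e t\<bar> + y t)"
    using e0[OF tT t(3)] t(2) by simp
  ultimately obtain d where d: "d > 0"
      "\<forall>s\<in>{0..T}. dist s t < d \<longrightarrow> dist (\<bar>e s\<bar> + y s) (\<bar>e t\<bar> + y t) < - (\<bar>e t\<bar> + y t)"
    using tT unfolding continuous_on_iff by blast
  have "z s \<le> 0" if s: "s \<in> {t..t + d / 2} \<inter> {0..T}" for s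
  proof -
    have "z s - z t \<le> 0 * (s - t)"
    proof (rule increment_le_AE[OF z _ _ _ Z])
      fix \<xi> assume \<xi>: "\<xi> \<in> {t..s} - Z"
      then have "\<xi> \<in> {0..T}" "dist \<xi> t < d"
        using s t(1) d(1) by (auto simp: dist_real_def)
      from d(2)[rule_format, OF this] have "\<bar>e \<xi>\<bar> + y \<xi> < 0"
        unfolding dist_real_def by linarith
      then show "\<rho> \<xi> \<le> 0"
        using \<rho>[of \<xi>] \<xi> \<open>\<xi> \<in> {0..T}\<close> by auto
    qed (use s t in auto)
    then show ?thesis using t(3) by simp
  qed
  then show "\<exists>e>0. \<forall>s\<in>{t..t + e} \<inter> {0..T}. z s \<le> 0"
    using d(1) by (intro exI[of _ "d / 2"]) auto
qed

text \<open>A minimum at an endpoint yields only a sign of the slope. Since \<open>r\<close> is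
  determined only almost everywhere, its value at 0 is replaced by that of a representative
  \<open>k\<close> continuous at this point: a negative \<open>k 0\<close> would make
  \<open>y\<close> fall strictly right after 0.\<close>

lemma initial_slope_nonneg:
  fixes y r k :: "real \<Rightarrow> real"
  assumes "0 < T" and y: "\<And>t. t \<in> {0..T} \<Longrightarrow> (r has_integral (y t - y 0)) {0..t}"
    and Z: "negligible Z" and k: "\<And>t. t \<in> {0..T} - Z \<Longrightarrow> r t = k t"
    and cont: "continuous (at 0 within {0..T}) k" and y0: "\<And>t. t \<in> {0..T} \<Longrightarrow> y 0 \<le> y t"
  shows "0 \<le> k 0"
proof (rule ccontr)
  assume "\<not> 0 \<le> k 0"
  then have "0 < - k 0" by simp
  with cont obtain d where d: "d > 0" "\<forall>s\<in>{0..T}. dist s 0 < d \<longrightarrow> dist (k s) (k 0) < - k 0"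
    unfolding continuous_within_eps_delta by blast
  define s where "s = min T (d / 2)"
  have s: "0 < s" "s \<le> T" "s < d"
    using d(1) \<open>0 < T\<close> by (auto simp: s_def)
  have "- y 0 < - y s"
  proof (rule increment_pos_AE[OF _ order_refl s(1,2) Z, where r = "\<lambda>t. - r t"])
    show "((\<lambda>t. - r t) has_integral (- y t - - y 0)) {0..t}" if "t \<in> {0..T}" for t
      using has_integral_neg[OF y[OF that]] by simp
    fix \<xi> assume \<xi>: "\<xi> \<in> {0..s} - Z"
    then have "\<xi> \<in> {0..T}" "dist \<xi> 0 < d" using s by (auto simp: dist_real_def)
    from d(2)[rule_format, OF this] have "k \<xi> < 0"
      unfolding dist_real_def by linarith
    then show "0 < - r \<xi>"
      using k[of \<xi>] \<xi> \<open>\<xi> \<in> {0..T}\<close> by auto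
  qed
  then show False
    using y0[of s] s by auto
qed

lemma terminal_slope_nonpos:
  fixes y r k :: "real \<Rightarrow> real"
  assumes "0 < T" and y: "\<And>t. t \<in> {0..T} \<Longrightarrow> (r has_integral (y t - y 0)) {0..t}"
    and Z: "negligible Z" and k: "\<And>t. t \<in> {0..T} - Z \<Longrightarrow> r t = k t"
    and cont: "continuous (at T within {0..T}) k" and yT: "\<And>t. t \<in> {0..T} \<Longrightarrow> y T \<le> y t"
  shows "k T \<le> 0"
proof (rule ccontr)
  assume "\<not> k T \<le> 0"
  then have "0 < k T" by simp
  with cont obtain d where d: "d > 0" "\<forall>s\<in>{0..T}. dist s T < d \<longrightarrow> dist (k s) (k T) < k T"
    unfolding continuous_within_eps_delta by blast
  define s where "s = max 0 (T - d / 2)"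
  have s: "0 \<le> s" "s < T" "T - s < d"
    using d(1) \<open>0 < T\<close> by (auto simp: s_def)
  have "y s < y T"
  proof (rule increment_pos_AE[OF y s(1,2) order_refl Z])
    fix \<xi> assume \<xi>: "\<xi> \<in> {s..T} - Z"
    then have "\<xi> \<in> {0..T}" "dist \<xi> T < d" using s by (auto simp: dist_real_def)
    from d(2)[rule_format, OF this] have "0 < k \<xi>"
      unfolding dist_real_def by linarith
    then show "0 < r \<xi>"
      using k[of \<xi>] \<xi> \<open>\<xi> \<in> {0..T}\<close> by auto
  qed
  then show False
    using yT[of s] s by auto
qed

subsection \<open>The Nagumo bound\<close>

definition clamp_to :: "real \<Rightarrow> real \<Rightarrow> real \<Rightarrow> real" where
  "clamp_to lo hi v = max lo (min hi v)"

lemma clamp_to_uminus: "lo \<le> hi \<Longrightarrow> clamp_to (- hi) (- lo) (- v) = - clamp_to lo hi v"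
  by (auto simp: clamp_to_def max_def min_def)

text \<open>A flux exceeding \<open>L\<close> must climb from \<open>N\<close> to \<open>L\<close>.
  On the climb the slope is at least \<open>N / a0 > H\<close>, so the growth condition applies and
  separates variables: the integral of \<open>1 / \<psi>\<close> is at most that of
  \<open>l + \<mu> * x' powr qexp q\<close>. Since \<open>x' > 0\<close> there, the integral of
  \<open>x'\<close> is an increment of \<open>x\<close>, at most \<open>2 * M\<close>, and Hoelder's
  inequality contradicts \<open>big\<close>. The slope carries a clamp so that truncated solutions
  are covered too; \<open>b\<close> stands for \<open>a t (x t)\<close>.\<close>

lemma nagumo_upper:
  fixes A u w x x' b \<psi> l \<mu> :: "real \<Rightarrow> real" and \<Phi> :: "real \<Rightarrow> real" and q :: ereal
  assumes "0 < T" and mono: "strict_mono \<Phi>"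
    and u_eq: "\<And>t. t \<in> {0..T} \<Longrightarrow> u t = \<Phi> (A t)"
    and u: "weak_deriv T u w" and x: "weak_deriv T x x'"
    and Z: "negligible Z"
    and x'_eq: "\<And>t. t \<in> {0..T} - Z \<Longrightarrow> x' t = clamp_to (- c) c (A t) / b t"
    and b: "\<And>t. t \<in> {0..T} - Z \<Longrightarrow> 0 < b t \<and> b t \<le> a0"
    and xM: "\<And>t. t \<in> {0..T} \<Longrightarrow> \<bar>x t\<bar> \<le> M"
    and N: "0 < N" "0 \<le> H" "N > max H (2 * M / T) * a0" "0 < \<Phi> N" and "L \<le> c"
    and growth: "\<And>t. t \<in> {0..T} - Z \<Longrightarrow> \<bar>A t\<bar> \<le> c \<Longrightarrow> H \<le> \<bar>x' t\<bar> \<Longrightarrow>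
        \<bar>w t\<bar> \<le> \<psi> \<bar>u t\<bar> * (l t + \<mu> t * \<bar>x' t\<bar> powr qexp q)"
    and \<psi>: "\<And>s. 0 < s \<Longrightarrow> 0 < \<psi> s" "(\<lambda>s. 1 / \<psi> s) integrable_on {\<Phi> N..\<Phi> L}"
    and q: "1 < q" "Lq_ext q T \<mu>" "AE t in lebesgue_on {0..T}. 0 \<le> \<mu> t"
    and l: "l absolutely_integrable_on {0..T}" "AE t in lebesgue_on {0..T}. 0 \<le> l t"
    and big: "integral {\<Phi> N..\<Phi> L} (\<lambda>s. 1 / \<psi> s) > L1_norm T l + Lq_norm q T \<mu> * (2 * M) powr qexp q"
    and t: "t \<in> {0..T}"
  shows "A t \<le> L"
proof (rule ccontr)
  assume "\<not> A t \<le> L"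
  obtain Z\<mu> where Z\<mu>: "negligible Z\<mu>" "\<And>t. t \<in> {0..T} - Z\<mu> \<Longrightarrow> 0 \<le> \<mu> t"
    using q(3) by (auto simp: AE_lebesgue_on_iff)
  obtain Zl where Zl: "negligible Zl" "\<And>t. t \<in> {0..T} - Zl \<Longrightarrow> 0 \<le> l t"
    using l(2) by (auto simp: AE_lebesgue_on_iff)
  have M0: "0 \<le> M"
    using xM[OF t] by linarith
  have qe: "0 \<le> qexp q"
    using q(1) by (cases q) (auto simp: qexp_def)
  have Lq0: "0 \<le> Lq_norm q T \<mu>"
    using Lq_Holder(3)[OF q \<open>0 < T\<close>, of "\<lambda>_. 0"] by simp
  have "0 \<le> L1_norm T l"
    by (simp add: L1_norm_def)
  with Lq0 have "0 < integral {\<Phi> N..\<Phi> L} (\<lambda>s. 1 / \<psi> s)"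
    using big by (smt (verit) mult_nonneg_nonneg powr_ge_zero)
  then have "{\<Phi> N..\<Phi> L} \<noteq> {}"
    by (intro notI) simp
  then have \<Phi>NL: "\<Phi> N \<le> \<Phi> L" by simp
  then have "N \<le> L"
    using mono by (simp add: strict_mono_less_eq)
  have a0: "0 < a0"
  proof -
    have "\<not> {0..T} \<subseteq> Z"
    proof
      assume "{0..T} \<subseteq> Z"
      then have "negligible (cbox 0 T)" using Z negligible_subset by auto
      then show False using \<open>0 < T\<close> unfolding negligible_interval by simp
    qed
    then show ?thesis using b by force
  qed
  have "max H (2 * M / T) < N / a0"
    using N(3) a0 by (simp only: pos_less_divide_eq)
  then have Na: "H < N / a0" "2 * M / T < N / a0"
    by simp_all
  have clamp: "N \<le> clamp_to (- c) c v" if "N \<le> v" for v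
    using that \<open>N \<le> L\<close> \<open>L \<le> c\<close> by (auto simp: clamp_to_def)
  have slope: "N / a0 \<le> x' r" if "r \<in> {0..T} - Z" "N \<le> A r" for r
  proof -
    have "N / a0 \<le> N / b r"
      using b[OF that(1)] N(1) by (intro divide_left_mono) auto
    also have "\<dots> \<le> x' r"
      unfolding x'_eq[OF that(1)] using b[OF that(1)] clamp[OF that(2)] by (intro divide_right_mono) auto
    finally show ?thesis .
  qed
  \<comment> \<open>If the flux stayed above \<open>N\<close>, the slope would be at least
    \<open>N / a0 > 2 * M / T\<close> throughout and \<open>x\<close> would travel further than
    \<open>2 * M\<close>.\<close>
  have "\<exists>t0\<in>{0..T}. A t0 \<le> N"
  proof (rule ccontr)
    assume "\<not> ?thesis"
    then have "N / a0 * (T - 0) \<le> x T - x 0"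
      using \<open>0 < T\<close> by (intro increment_ge_AE[OF weak_derivD(3)[OF x] _ _ _ Z] slope) (auto simp: not_le intro: less_imp_le)
    moreover have "\<bar>x T\<bar> \<le> M" "\<bar>x 0\<bar> \<le> M"
      using xM \<open>0 < T\<close> by auto
    moreover have "2 * M < N / a0 * T"
      using Na(2) \<open>0 < T\<close> by (simp add: field_simps)
    ultimately show False by (simp add: abs_le_iff)
  qed
  then obtain t0 where t0: "t0 \<in> {0..T}" "u t0 \<le> \<Phi> N"
    using u_eq mono by (auto simp: strict_mono_less_eq)
  have t1: "\<Phi> L \<le> u t"
    using \<open>\<not> A t \<le> L\<close> u_eq[OF t] mono by (simp add: strict_mono_less_eq)
  obtain s1 s2 where s: "0 \<le> s1" "s1 \<le> s2" "s2 \<le> T" "\<bar>u s2 - u s1\<bar> = \<Phi> L - \<Phi> N"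
      "\<And>r. r \<in> {s1..s2} \<Longrightarrow> u r \<in> {\<Phi> N..\<Phi> L}"
    using crossing[OF weak_derivD(4)[OF u] t0(1) t t0(2) \<Phi>NL t1] by metis
  have sub: "{s1..s2} \<subseteq> {0..T}" using s by auto
  have A_ge: "N \<le> A r" if "r \<in> {s1..s2}" for r
    using s(5)[OF that] u_eq[of r] that sub mono by (auto simp: strict_mono_less_eq)
  have A_le: "\<bar>A r\<bar> \<le> c" if "r \<in> {s1..s2}" for r
  proof -
    have "A r \<le> L"
      using s(5)[OF that] u_eq[of r] that sub mono by (auto simp: strict_mono_less_eq)
    then show ?thesis
      using A_ge[OF that] N(1) \<open>L \<le> c\<close> by simp
  qed
  have w_abs: "w absolutely_integrable_on {s1..s2}"
    by (rule absolutely_integrable_on_subinterval[OF weak_derivD(1)[OF u] sub])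
  \<comment> \<open>Extension by zero allows Hoelder's inequality on all of \<open>[0, T]\<close>,
    where the norm of \<open>\<mu>\<close> is taken, while the integral of \<open>y\<close> remains
    the increment of \<open>x\<close> over the climb.\<close>
  define y where "y r = (if r \<in> {s1..s2} then \<bar>x' r\<bar> else 0)" for r
  have x'i: "x' integrable_on {0..T}" "(\<lambda>r. \<bar>x' r\<bar>) integrable_on {0..T}"
    using weak_derivD(1)[OF x] unfolding absolutely_integrable_on_def by auto
  have y_int: "(y has_integral (x s2 - x s1)) {0..T}"
  proof -
    have "((\<lambda>r. \<bar>x' r\<bar>) has_integral (x s2 - x s1)) {s1..s2}"
    proof (rule has_integral_spike[OF Z _ has_integral_increment[OF weak_derivD(3)[OF x] s(1-3)]])
      fix r assume "r \<in> {s1..s2} - Z"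
      then have "N / a0 \<le> x' r"
        using slope A_ge sub by blast
      moreover have "0 < N / a0" using N(1) a0 by simp
      ultimately show "\<bar>x' r\<bar> = x' r" by linarith
    qed
    then show ?thesis
      unfolding y_def[abs_def] using sub by (subst has_integral_restrict) auto
  qed
  have y0: "0 \<le> y r" for r
    by (simp add: y_def)
  have yi: "integrable (lebesgue_on {0..T}) y"
    using y_int y0 by (intro absolutely_integrable_imp_integrable nonnegative_absolutely_integrable_1) auto
  note H = Lq_Holder[OF q \<open>0 < T\<close> yi y0]
  have y_val: "integral\<^sup>L (lebesgue_on {0..T}) y = x s2 - x s1"
    using lebesgue_integral_eq_integral[OF yi] integral_unique[OF y_int] by simp
  have li: "integrable (lebesgue_on {0..T}) (\<lambda>r. \<bar>l r\<bar>)"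
    using absolutely_integrable_imp_integrable[OF l(1)] by (intro integrable_abs) simp
  \<comment> \<open>\<open>l\<close> and \<open>\<mu>\<close> are nonnegative only almost
    everywhere; the absolute values give a majorant that is nonnegative at every point.\<close>
  define m where "m r = \<bar>l r\<bar> + \<bar>\<mu> r * y r powr qexp q\<bar>" for r
  have mi: "integrable (lebesgue_on {0..T}) m"
    unfolding m_def[abs_def] by (intro Bochner_Integration.integrable_add li integrable_abs H(1))
  have mT: "m integrable_on {0..T}"
    by (rule integrable_on_lebesgue_on[OF mi]) simp
  have m0: "0 \<le> m r" for r
    by (simp add: m_def)
  have "integral {\<Phi> N..\<Phi> L} (\<lambda>s. 1 / \<psi> s) \<le> integral {s1..s2} m"
  proof -
    have uw: "(w has_integral (u r - u s1)) {s1..r}" if "r \<in> {s1..s2}" for r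
      using that s by (intro has_integral_increment[OF weak_derivD(3)[OF u]]) auto
    \<comment> \<open>\<open>crossing\<close> yields an absolute increment only. As \<open>u\<close>
      stays in the strip and its increment is the full height, one end of the window lies on each
      level.\<close>
    have ends: "\<exists>ta tb. ta \<in> {s1..s2} \<and> tb \<in> {s1..s2} \<and> u ta \<le> \<Phi> N \<and> \<Phi> L \<le> u tb"
    proof (cases "u s1 \<le> u s2")
      case True
      then show ?thesis
        using s(2,4) s(5)[of s1] s(5)[of s2] by (intro exI[of _ s1] exI[of _ s2]) auto
    next
      case False
      then show ?thesis
        using s(2,4) s(5)[of s1] s(5)[of s2] by (intro exI[of _ s2] exI[of _ s1]) auto
    qed
    have mono': "AE r in lebesgue_on {s1..s2}. u r \<in> {\<Phi> N..\<Phi> L} \<longrightarrow> 1 / \<psi> (u r) * \<bar>w r\<bar> \<le> m r"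
      unfolding AE_lebesgue_on_iff[OF lmeasurable_interval(1)[THEN fmeasurableD]]
    proof (intro exI[of _ "Z \<union> Z\<mu> \<union> Zl"] conjI ballI impI)
      show "negligible (Z \<union> Z\<mu> \<union> Zl)" by (intro negligible_Un Z Z\<mu> Zl)
    next
      fix r assume r: "r \<in> {s1..s2} - (Z \<union> Z\<mu> \<union> Zl)" "u r \<in> {\<Phi> N..\<Phi> L}"
      have rT: "r \<in> {0..T}" "r \<in> {s1..s2}" using r sub by auto
      have "H \<le> \<bar>x' r\<bar>"
        using slope[of r] A_ge[of r] Na(1) r rT by auto
      then have "\<bar>w r\<bar> \<le> \<psi> \<bar>u r\<bar> * (l r + \<mu> r * \<bar>x' r\<bar> powr qexp q)"
        using growth[of r] A_le[of r] r rT by auto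
      moreover have "0 < u r" using r(2) N(4) by auto
      moreover have "l r + \<mu> r * \<bar>x' r\<bar> powr qexp q = m r"
        using Z\<mu>(2)[of r] Zl(2)[of r] r rT by (simp add: m_def y_def)
      ultimately show "1 / \<psi> (u r) * \<bar>w r\<bar> \<le> m r"
        using \<psi>(1)[of "u r"] by (simp add: field_simps)
    qed
    from ends obtain ta tb where "ta \<in> {s1..s2}" "tb \<in> {s1..s2}" "u ta \<le> \<Phi> N" "\<Phi> L \<le> u tb"
      by blast
    then show ?thesis
      using \<psi>(1) N(4) m0 mono'
      by (intro integral_le_of_velocity_bound[OF w_abs uw _ _ _ \<Phi>NL _ \<psi>(2) _ integrable_on_subinterval[OF mT sub]])
         (auto intro!: less_imp_le)
  qed
  also have "\<dots> \<le> integral {0..T} m"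
    using sub m0 by (intro integral_subset_le integrable_on_subinterval[OF mT sub] mT) auto
  also have "\<dots> = integral\<^sup>L (lebesgue_on {0..T}) m"
    using lebesgue_integral_eq_integral[OF mi] by simp
  also have "\<dots> = L1_norm T l + integral\<^sup>L (lebesgue_on {0..T}) (\<lambda>r. \<bar>\<mu> r * y r powr qexp q\<bar>)"
    unfolding m_def[abs_def] L1_norm_def
    by (intro Bochner_Integration.integral_add li integrable_abs H(1))
  also have "integral\<^sup>L (lebesgue_on {0..T}) (\<lambda>r. \<bar>\<mu> r * y r powr qexp q\<bar>)
      = integral\<^sup>L (lebesgue_on {0..T}) (\<lambda>r. \<mu> r * y r powr qexp q)"
    by (intro integral_cong_AE borel_measurable_integrable integrable_abs H(1) eventually_mono[OF q(3)]) simp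
  also have "\<dots> \<le> Lq_norm q T \<mu> * (x s2 - x s1) powr qexp q"
    using H(2) y_val by simp
  also have "\<dots> \<le> Lq_norm q T \<mu> * (2 * M) powr qexp q"
  proof (intro mult_left_mono Lq0 powr_mono2 qe)
    have "s1 \<in> {0..T}" "s2 \<in> {0..T}" using s by auto
    then show "x s2 - x s1 \<le> 2 * M"
      using xM[of s1] xM[of s2] by (simp add: abs_le_iff)
    show "0 \<le> x s2 - x s1"
      using has_integral_nonneg[OF y_int] y0 by blast
  qed
  finally show False
    using big by linarith
qed

lemma weak_deriv_uminus:
  assumes "weak_deriv T x g"
  shows "weak_deriv T (\<lambda>t. - x t) (\<lambda>t. - g t)"
  unfolding weak_deriv_def
proof (intro conjI ballI)
  show "(\<lambda>t. - g t) absolutely_integrable_on {0..T}"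
    using weak_derivD(1)[OF assms] unfolding set_integrable_def by simp
  show "- x t = - x 0 + integral {0..t} (\<lambda>t. - g t)" if "t \<in> {0..T}" for t
    using integral_unique[OF has_integral_neg[OF weak_derivD(3)[OF assms that]]] by simp
qed

text \<open>The lower bound is the upper one for \<open>- x\<close>, \<open>- u\<close>,
  \<open>- A\<close> and the increasing function \<open>- \<Phi> (- s)\<close>; the growth condition
  involves absolute values only and is invariant. This reflection produces the second integral in
  the minimum.\<close>

lemma nagumo_bound:
  fixes A u w x x' b \<psi> l \<mu> :: "real \<Rightarrow> real" and \<Phi> :: "real \<Rightarrow> real" and q :: ereal
  assumes T: "0 < T" and mono: "strict_mono \<Phi>"
    and u_eq: "\<And>t. t \<in> {0..T} \<Longrightarrow> u t = \<Phi> (A t)"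
    and u: "weak_deriv T u w" and x: "weak_deriv T x x'"
    and Z: "negligible Z"
    and x'_eq: "\<And>t. t \<in> {0..T} - Z \<Longrightarrow> x' t = clamp_to (- c) c (A t) / b t"
    and b: "\<And>t. t \<in> {0..T} - Z \<Longrightarrow> 0 < b t \<and> b t \<le> a0"
    and xM: "\<And>t. t \<in> {0..T} \<Longrightarrow> \<bar>x t\<bar> \<le> M"
    and N: "0 < N" "0 \<le> H" "N > max H (2 * M / T) * a0" "0 < \<Phi> N" "\<Phi> (- N) < 0" and L: "0 < L" "L \<le> c"
    and growth: "\<And>t. t \<in> {0..T} - Z \<Longrightarrow> \<bar>A t\<bar> \<le> c \<Longrightarrow> H \<le> \<bar>x' t\<bar> \<Longrightarrow>
        \<bar>w t\<bar> \<le> \<psi> \<bar>u t\<bar> * (l t + \<mu> t * \<bar>x' t\<bar> powr qexp q)"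
    and \<psi>: "\<And>s. 0 < s \<Longrightarrow> 0 < \<psi> s" "\<And>c d. 0 < c \<Longrightarrow> (\<lambda>s. 1 / \<psi> s) integrable_on {c..d}"
    and q: "1 < q" "Lq_ext q T \<mu>" "AE t in lebesgue_on {0..T}. 0 \<le> \<mu> t"
    and l: "l absolutely_integrable_on {0..T}" "AE t in lebesgue_on {0..T}. 0 \<le> l t"
    and big: "min (integral {\<Phi> N..\<Phi> L} (\<lambda>s. 1 / \<psi> s)) (integral {- \<Phi> (- N)..- \<Phi> (- L)} (\<lambda>s. 1 / \<psi> s))
        > L1_norm T l + Lq_norm q T \<mu> * (2 * M) powr qexp q"
    and t: "t \<in> {0..T}"
  shows "\<bar>A t\<bar> \<le> L"
proof -
  have "A t \<le> L"
    by (rule nagumo_upper[OF T mono u_eq u x Z x'_eq b xM N(1-4) L(2) growth \<psi>(1) \<psi>(2)[OF N(4)] q l _ t])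
       (use big in auto)
  moreover have "- A t \<le> L"
  proof (rule nagumo_upper[OF T _ _ weak_deriv_uminus[OF u] weak_deriv_uminus[OF x] Z _ b _ N(1-3) _ L(2) _ \<psi>(1) \<psi>(2) q l _ t,
        where \<Phi> = "\<lambda>s. - \<Phi> (- s)"])
    show "strict_mono (\<lambda>s. - \<Phi> (- s))"
      using mono by (simp add: strict_mono_def)
    show "- x' t = clamp_to (- c) c (- A t) / b t" if "t \<in> {0..T} - Z" for t
      using x'_eq[OF that] clamp_to_uminus[of "- c" c "A t"] L by simp
    show "\<bar>- w t\<bar> \<le> \<psi> \<bar>- u t\<bar> * (l t + \<mu> t * \<bar>- x' t\<bar> powr qexp q)"
      if "t \<in> {0..T} - Z" "\<bar>- A t\<bar> \<le> c" "H \<le> \<bar>- x' t\<bar>" for t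
      using growth[OF that(1)] that(2,3) by simp
  qed (use u_eq xM N big in auto)
  ultimately show ?thesis by auto
qed

text \<open>Bounded integrals from \<open>c\<close> would, by monotone convergence, make the
  integral over \<open>[1, \<infinity>)\<close> finite. The lower limit \<open>c\<close> is
  arbitrary because \<open>g\<close> is integrable on compact subintervals of the positive
  half-line.\<close>

lemma integral_exceeds:
  fixes g :: "real \<Rightarrow> real"
  assumes g0: "\<And>s. 0 < s \<Longrightarrow> 0 \<le> g s" and loc: "\<And>c d. 0 < c \<Longrightarrow> g integrable_on {c..d}"
    and div: "(\<integral>\<^sup>+ s \<in> {1..}. ennreal (g s) \<partial>lborel) = \<infinity>" and "0 < c"
  obtains D where "c \<le> D" "\<And>d. D \<le> d \<Longrightarrow> C < integral {c..d} g"
proof -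
  have mono: "integral {c..d} g \<le> integral {c..d'} g" if "d \<le> d'" for d d'
    using that g0 \<open>0 < c\<close> by (intro integral_subset_le loc) auto
  have "\<exists>D\<ge>c. C < integral {c..D} g"
  proof (rule ccontr)
    assume "\<not> ?thesis"
    then have le: "integral {c..D} g \<le> C" if "c \<le> D" for D
      using that by (auto simp: not_less)
    \<comment> \<open>Starting at the smaller of \<open>c\<close> and 1, the intervals
      \<open>[c', n]\<close> exhaust \<open>[1, \<infinity>)\<close> and add to
      \<open>[c, n]\<close> only the fixed amount over \<open>[c', c]\<close>.\<close>
    define c' where "c' = min c 1"
    have c': "0 < c'" "c' \<le> c" "c' \<le> 1"
      using \<open>0 < c\<close> by (auto simp: c'_def)
    define K where "K = integral {c'..c} g + C"
    have K: "integral {c'..d} g \<le> K" for d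
    proof -
      have "integral {c'..d} g \<le> integral {c'..max c d} g"
        using g0 c' by (intro integral_subset_le loc) auto
      also have "\<dots> = integral {c'..c} g + integral {c..max c d} g"
        using Henstock_Kurzweil_Integration.integral_combine[of c' c "max c d" g] c' loc[OF c'(1)] by simp
      also have "\<dots> \<le> K"
        unfolding K_def using le[of "max c d"] by simp
      finally show ?thesis .
    qed
    have sub: "ennreal (g s) * indicator {c'..real n} s = ennreal (indicator {c'..real n} s * g s)" for n s
      by (auto simp: indicator_def)
    have meas: "(\<lambda>s. ennreal (g s) * indicator {c'..real n} s) \<in> borel_measurable lebesgue" for n
      unfolding sub using has_integral_implies_lebesgue_measurable[OF integrable_integral[OF loc[OF c'(1), of "real n"]]]
      by simp
    have "(\<integral>\<^sup>+ s \<in> {1..}. ennreal (g s) \<partial>lborel) \<le> (\<integral>\<^sup>+ s. (SUP n. ennreal (g s) * indicator {c'..real n} s) \<partial>lborel)"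
    proof (rule nn_integral_mono)
      fix s :: real
      obtain n where "s \<le> real n" using real_arch_simple by blast
      then have "ennreal (g s) * indicator {1..} s \<le> ennreal (g s) * indicator {c'..real n} s"
        using c' by (auto simp: indicator_def)
      also have "\<dots> \<le> (SUP n. ennreal (g s) * indicator {c'..real n} s)"
        by (rule SUP_upper) simp
      finally show "ennreal (g s) * indicator {1..} s \<le> (SUP n. ennreal (g s) * indicator {c'..real n} s)" .
    qed
    \<comment> \<open>Monotone convergence needs measurability, and \<open>g\<close> is measurable
      only for the completed measure; the nonnegative integral is the same for both.\<close>
    also have "\<dots> = (\<integral>\<^sup>+ s. (SUP n. ennreal (g s) * indicator {c'..real n} s) \<partial>lebesgue)"
      by (simp add: nn_integral_completion)
    also have "\<dots> = (SUP n. \<integral>\<^sup>+ s. ennreal (g s) * indicator {c'..real n} s \<partial>lebesgue)"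
      by (rule nn_integral_monotone_convergence_SUP)
         (use meas in \<open>auto simp: incseq_def le_fun_def indicator_def\<close>)
    also have "\<dots> \<le> ennreal K"
    proof (rule SUP_least)
      fix n
      have "(\<integral>\<^sup>+ s. ennreal (g s) * indicator {c'..real n} s \<partial>lebesgue) = ennreal (integral {c'..real n} g)"
        unfolding nn_integral_completion
        by (rule nn_integral_has_integral_lebesgue'[OF _ integrable_integral[OF loc[OF c'(1)]]])
           (use g0 c' in auto)
      then show "(\<integral>\<^sup>+ s. ennreal (g s) * indicator {c'..real n} s \<partial>lebesgue) \<le> ennreal K"
        using K[of "real n"] by (simp add: ennreal_leI)
    qed
    finally show False
      using div by (simp add: top_unique)
  qed
  then obtain D where "c \<le> D" "C < integral {c..D} g" by blast
  then show thesis
    using that[of D] mono less_le_trans by blast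
qed

subsection \<open>Boundary value problems for dominated Caratheodory systems\<close>

text \<open>\<open>G\<close> is only measurable in time, so sampling it at grid points would be
  meaningless. The state is frozen on each step and \<open>G\<close> is integrated over the step
  instead.\<close>

primrec euler :: "(real \<Rightarrow> 'a::euclidean_space \<Rightarrow> 'a) \<Rightarrow> real \<Rightarrow> 'a \<Rightarrow> nat \<Rightarrow> 'a" where
  "euler G \<tau> z 0 = z"
| "euler G \<tau> z (Suc k) =
     euler G \<tau> z k + integral {real k * \<tau>..real (Suc k) * \<tau>} (\<lambda>s. G s (euler G \<tau> z k))"

lemma integral_norm_le_increment:
  fixes g :: "real \<Rightarrow> 'a::euclidean_space"
  assumes "g integrable_on {0..T}" "m integrable_on {0..T}"
    and "\<And>t. t \<in> {0..T} \<Longrightarrow> norm (g t) \<le> m t" and "0 \<le> s" "s \<le> t" "t \<le> T"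
  shows "norm (integral {0..t} g - integral {0..s} g) \<le> integral {0..t} m - integral {0..s} m"
proof -
  have g: "g integrable_on {0..t}" "g integrable_on {s..t}"
    by (rule integrable_on_subinterval[OF assms(1)]; use assms in auto)+
  have m: "m integrable_on {0..t}" "m integrable_on {s..t}"
    by (rule integrable_on_subinterval[OF assms(2)]; use assms in auto)+
  have "integral {0..t} g - integral {0..s} g = integral {s..t} g"
    using Henstock_Kurzweil_Integration.integral_combine[of 0 s t g] assms g by (auto simp: algebra_simps)
  moreover have "integral {0..t} m - integral {0..s} m = integral {s..t} m"
    using Henstock_Kurzweil_Integration.integral_combine[of 0 s t m] assms m by (auto simp: algebra_simps)
  moreover have "norm (integral {s..t} g) \<le> integral {s..t} m"
    by (rule integral_norm_bound_integral) (use assms g m in auto)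
  ultimately show ?thesis by simp
qed

lemma continuous_euler:
  fixes G :: "real \<Rightarrow> 'a::euclidean_space \<Rightarrow> 'a"
  assumes m: "m integrable_on {0..T}"
    and bound: "\<And>t z. t \<in> {0..T} \<Longrightarrow> norm (G t z) \<le> m t"
    and int: "\<And>z. (\<lambda>t. G t z) integrable_on {0..T}"
    and cont: "\<And>t. t \<in> {0..T} \<Longrightarrow> continuous_on UNIV (G t)"
    and "0 \<le> \<tau>" "real n * \<tau> \<le> T" "k \<le> n"
  shows "continuous_on UNIV (\<lambda>z. euler G \<tau> z k)"
  using \<open>k \<le> n\<close>
proof (induction k)
  case 0
  then show ?case by simp
next
  case (Suc k)
  let ?I = "{real k * \<tau>..real (Suc k) * \<tau>}"
  have "real (Suc k) * \<tau> \<le> real n * \<tau>"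
    using Suc.prems assms by (intro mult_right_mono) auto
  then have sub: "?I \<subseteq> {0..T}"
    using assms by auto
  have "continuous_on UNIV (\<lambda>z. integral ?I (\<lambda>s. G s z))"
    unfolding continuous_on_sequentially
  proof (intro allI ballI impI, elim conjE)
    fix x :: "nat \<Rightarrow> 'a" and a assume x: "x \<longlonglongrightarrow> a"
    show "((\<lambda>z. integral ?I (\<lambda>s. G s z)) \<circ> x) \<longlonglongrightarrow> integral ?I (\<lambda>s. G s a)"
      unfolding comp_def
    proof (rule dominated_convergence)
      show "(\<lambda>s. G s (x k)) integrable_on ?I" for k
        using integrable_on_subinterval[OF int sub] .
      show "m integrable_on ?I"
        using integrable_on_subinterval[OF m sub] .
      show "norm (G s (x k)) \<le> m s" if "s \<in> ?I" for k s
        using bound that sub by blast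
      show "(\<lambda>k. G s (x k)) \<longlonglongrightarrow> G s a" if "s \<in> ?I" for s
        using cont[of s] x that sub
        by (metis UNIV_I continuous_on_tendsto_compose eventually_sequentially subsetD)
    qed
  qed
  from continuous_on_compose2[OF this Suc.IH] Suc.prems Suc.IH show ?case
    by (auto intro!: continuous_intros)
qed

lemma euler_has_integral:
  fixes G :: "real \<Rightarrow> 'a::euclidean_space \<Rightarrow> 'a"
  assumes int: "\<And>z. (\<lambda>t. G t z) integrable_on {0..T}"
    and "0 < \<tau>" "real n * \<tau> \<le> T" "k \<le> n"
  shows "((\<lambda>s. G s (euler G \<tau> z (nat \<lfloor>s / \<tau>\<rfloor>))) has_integral (euler G \<tau> z k - z)) {0..real k * \<tau>}"
  using \<open>k \<le> n\<close>
proof (induction k)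
  case 0
  then show ?case by (simp add: has_integral_refl)
next
  case (Suc k)
  let ?I = "{real k * \<tau>..real (Suc k) * \<tau>}"
  have "real (Suc k) * \<tau> \<le> real n * \<tau>"
    using Suc.prems assms by (intro mult_right_mono) auto
  then have "real (Suc k) * \<tau> \<le> T"
    using assms by linarith
  then have sub: "?I \<subseteq> {0..T}"
    using \<open>0 < \<tau>\<close> by (auto simp del: of_nat_Suc)
  have 1: "((\<lambda>s. G s (euler G \<tau> z k)) has_integral
         integral ?I (\<lambda>s. G s (euler G \<tau> z k))) ?I"
    by (intro integrable_integral integrable_on_subinterval[OF int sub])
  have 2: "((\<lambda>s. G s (euler G \<tau> z (nat \<lfloor>s / \<tau>\<rfloor>))) has_integral
         integral ?I (\<lambda>s. G s (euler G \<tau> z k))) ?I"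
  \<comment> \<open>At the right end of the step the floor already selects the next state; this
    single point is discarded.\<close>
  proof (rule has_integral_spike[OF negligible_sing _ 1])
    fix s assume s: "s \<in> ?I - {real (Suc k) * \<tau>}"
    then have "real k \<le> s / \<tau>" "s / \<tau> < real k + 1"
      using \<open>0 < \<tau>\<close> by (auto simp: field_simps)
    then have "\<lfloor>s / \<tau>\<rfloor> = int k"
      by (intro floor_unique) auto
    then show "G s (euler G \<tau> z (nat \<lfloor>s / \<tau>\<rfloor>)) = G s (euler G \<tau> z k)"
      by simp
  qed
  have "((\<lambda>s. G s (euler G \<tau> z (nat \<lfloor>s / \<tau>\<rfloor>))) has_integral
       (euler G \<tau> z k - z) + integral ?I (\<lambda>s. G s (euler G \<tau> z k))) {0..real (Suc k) * \<tau>}"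
    using assms Suc
    by (intro has_integral_combine[OF _ _ _ 2]) auto
  then show ?case by (simp add: algebra_simps)
qed

text \<open>The boundary condition is imposed before the limit is taken: the Euler scheme is
  single-valued and continuous in its initial value even where solutions are not unique.
  \<open>R\<close> maps into \<open>S\<close>, which keeps the initial values compact, and the
  primitive of \<open>m\<close> is a modulus of continuity for all step sizes at once.\<close>

theorem caratheodory_bvp:
  fixes G :: "real \<Rightarrow> 'a::euclidean_space \<Rightarrow> 'a"
  assumes "0 < T" and m: "m integrable_on {0..T}"
    and bound: "\<And>t z. t \<in> {0..T} \<Longrightarrow> norm (G t z) \<le> m t"
    and int: "\<And>z. (\<lambda>t. G t z) integrable_on {0..T}"
    and cont: "\<And>t. t \<in> {0..T} \<Longrightarrow> continuous_on UNIV (G t)"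
    and S: "compact S" "convex S" "S \<noteq> {}"
    and R: "continuous_on (S \<times> UNIV) (\<lambda>(z, w). R z w)" "\<And>z w. z \<in> S \<Longrightarrow> R z w \<in> S"
  obtains z where "continuous_on {0..T} z" "z 0 \<in> S" "R (z 0) (z T) = z 0"
    "\<And>t. t \<in> {0..T} \<Longrightarrow> ((\<lambda>s. G s (z s)) has_integral (z t - z 0)) {0..t}"
proof -
  define \<tau> where "\<tau> n = T / real (Suc n)" for n
  have \<tau>: "0 < \<tau> n" "real (Suc n) * \<tau> n = T" for n
    using \<open>0 < T\<close> by (auto simp: \<tau>_def)
  have \<tau>_lim: "\<tau> \<longlonglongrightarrow> 0"
    unfolding \<tau>_def by real_asymp
  have "\<exists>z\<in>S. R z (euler G (\<tau> n) z (Suc n)) = z" for n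
  proof -
    have E: "continuous_on S (\<lambda>z. euler G (\<tau> n) z (Suc n))"
      using continuous_euler[OF m bound int cont, of "\<tau> n" "Suc n" "Suc n"] \<tau>[of n]
      by (auto intro: continuous_on_subset)
    have "continuous_on S (\<lambda>z. (z, euler G (\<tau> n) z (Suc n)))"
      by (intro continuous_intros E)
    from continuous_on_compose2[OF R(1) this]
    have "continuous_on S (\<lambda>z. R z (euler G (\<tau> n) z (Suc n)))"
      by auto
    with S R(2) show ?thesis
      by (metis (no_types, lifting) brouwer Pi_I)
  qed
  then obtain z0 where z0: "\<And>n. z0 n \<in> S"
      "\<And>n. R (z0 n) (euler G (\<tau> n) (z0 n) (Suc n)) = z0 n"
    by metis
  \<comment> \<open>\<open>\<zeta>\<close> is the step function fed into \<open>G\<close>,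
    \<open>Z\<close> its continuous integral. Compactness applies to \<open>Z\<close> only; both
    agree at grid points.\<close>
  define \<zeta> where "\<zeta> n s = euler G (\<tau> n) (z0 n) (nat \<lfloor>s / \<tau> n\<rfloor>)" for n s
  define Z where "Z n t = z0 n + integral {0..t} (\<lambda>s. G s (\<zeta> n s))" for n t
  have I: "((\<lambda>s. G s (\<zeta> n s)) has_integral (euler G (\<tau> n) (z0 n) k - z0 n)) {0..real k * \<tau> n}"
    if "k \<le> Suc n" for n k
    unfolding \<zeta>_def using \<tau>[of n] that by (intro euler_has_integral[OF int]) auto
  have Z_euler: "Z n (real k * \<tau> n) = euler G (\<tau> n) (z0 n) k" if "k \<le> Suc n" for n k
    using integral_unique[OF I[OF that]] by (simp add: Z_def)
  have intT: "(\<lambda>s. G s (\<zeta> n s)) integrable_on {0..T}" for n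
    using has_integral_integrable[OF I[of "Suc n" n]] \<tau>(2) by simp
  have Z_diff: "norm (Z n t - Z n s) \<le> integral {0..t} m - integral {0..s} m"
    if "0 \<le> s" "s \<le> t" "t \<le> T" for n s t
    using integral_norm_le_increment[OF intT m bound that] by (simp add: Z_def)
  have m_cont: "continuous_on {0..T} (\<lambda>t. integral {0..t} m)"
    by (rule indefinite_integral_continuous_1[OF m])
  have Z0: "Z n 0 = z0 n" for n
    by (simp add: Z_def)
  obtain B where B: "\<And>z. z \<in> S \<Longrightarrow> norm z \<le> B"
    using compact_imp_bounded[OF S(1)] by (auto simp: bounded_iff)
  have Z_bound: "norm (Z n t) \<le> B + integral {0..T} m" if "t \<in> {0..T}" for n t
  proof -
    have "norm (Z n t - Z n 0) \<le> integral {0..t} m" "norm (Z n T - Z n t) \<le> integral {0..T} m - integral {0..t} m"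
      using Z_diff[of 0 t n] Z_diff[of t T n] that by auto
    moreover have "norm (Z n t) \<le> norm (Z n 0) + norm (Z n t - Z n 0)"
      by (metis add.commute diff_add_cancel norm_triangle_ineq)
    moreover have "norm (Z n 0) \<le> B"
      using B z0 Z0 by simp
    ultimately show ?thesis
      using norm_ge_zero[of "Z n T - Z n t"] by linarith
  qed
  have Z_diff': "norm (Z n t - Z n s) \<le> \<bar>integral {0..t} m - integral {0..s} m\<bar>"
    if "s \<in> {0..T}" "t \<in> {0..T}" for n s t
    using Z_diff[of s t n] Z_diff[of t s n] that
    by (cases "s \<le> t") (auto simp: norm_minus_commute)
  have equi: "\<exists>d>0. \<forall>n y. y \<in> {0..T} \<and> norm (x - y) < d \<longrightarrow> norm (Z n x - Z n y) < e"
    if "x \<in> {0..T}" "0 < e" for x e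
  proof -
    from m_cont[unfolded continuous_on_iff, rule_format, OF that] obtain d where "d > 0"
      and d: "\<forall>y\<in>{0..T}. dist y x < d \<longrightarrow> dist (integral {0..y} m) (integral {0..x} m) < e"
      by blast
    have "norm (Z n x - Z n y) < e" if "y \<in> {0..T}" "norm (x - y) < d" for n y
    proof -
      have "dist (integral {0..y} m) (integral {0..x} m) < e"
        using d that by (simp add: dist_norm norm_minus_commute)
      then show ?thesis
        using Z_diff'[OF that(1) \<open>x \<in> {0..T}\<close>, of n] by (simp add: dist_real_def abs_minus_commute)
    qed
    with \<open>d > 0\<close> show ?thesis by blast
  qed
  obtain z k where z: "continuous_on {0..T} z" and k: "strict_mono (k :: nat \<Rightarrow> nat)"
    and lim: "\<And>e. 0 < e \<Longrightarrow> \<exists>N. \<forall>n x. n \<ge> N \<and> x \<in> {0..T} \<longrightarrow> norm (Z (k n) x - z x) < e"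
    using Arzela_Ascoli[of "{0..T}" Z, OF compact_Icc Z_bound equi] by blast
  have lim': "(\<lambda>n. Z (k n) t) \<longlonglongrightarrow> z t" if "t \<in> {0..T}" for t
    using lim that unfolding LIMSEQ_iff by meson
  have \<zeta>_lim: "(\<lambda>n. \<zeta> (k n) s) \<longlonglongrightarrow> z s" if s: "s \<in> {0..T}" for s
  proof -
    \<comment> \<open>\<open>\<sigma> n\<close> is the last grid point up to \<open>s\<close>, where
      \<open>\<zeta> n s = Z n (\<sigma> n)\<close>. Replacing it by \<open>s\<close> costs at most
      the integral of \<open>m\<close> over an interval shrinking to a point.\<close>
    define \<sigma> where "\<sigma> n = real (nat \<lfloor>s / \<tau> n\<rfloor>) * \<tau> n" for n
    have \<sigma>: "\<sigma> n \<le> s" "s - \<tau> n \<le> \<sigma> n" "0 \<le> \<sigma> n" "nat \<lfloor>s / \<tau> n\<rfloor> \<le> Suc n" for n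
    proof -
      have *: "real (nat \<lfloor>s / \<tau> n\<rfloor>) \<le> s / \<tau> n" "s / \<tau> n \<le> real (nat \<lfloor>s / \<tau> n\<rfloor>) + 1"
        using s \<tau>(1)[of n] by (auto simp: of_nat_nat) 
      then show "\<sigma> n \<le> s" "s - \<tau> n \<le> \<sigma> n" "0 \<le> \<sigma> n"
        using \<tau>(1)[of n] unfolding \<sigma>_def by (auto simp: field_simps)
      have "s / \<tau> n \<le> real (Suc n)"
        using s \<tau>[of n] by (simp add: field_simps)
      with * show "nat \<lfloor>s / \<tau> n\<rfloor> \<le> Suc n"
        by linarith
    qed
    have \<sigma>_lim: "\<sigma> \<longlonglongrightarrow> s"
    proof (rule tendsto_sandwich)
      show "(\<lambda>n. s - \<tau> n) \<longlonglongrightarrow> s"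
        using tendsto_diff[OF tendsto_const \<tau>_lim, of s] by simp
    qed (use \<sigma> in auto)
    have \<sigma>_T: "\<sigma> n \<in> {0..T}" for n
      using \<sigma>(1,3)[of n] s by simp
    have "(\<lambda>n. integral {0..\<sigma> n} m) \<longlonglongrightarrow> integral {0..s} m"
      by (rule continuous_on_tendsto_compose[OF m_cont \<sigma>_lim s])
         (intro always_eventually allI \<sigma>_T)
    from tendsto_diff[OF tendsto_const this, of "integral {0..s} m"]
    have "(\<lambda>n. integral {0..s} m - integral {0..\<sigma> n} m) \<longlonglongrightarrow> 0"
      by simp
    from LIMSEQ_subseq_LIMSEQ[OF this k]
    have "(\<lambda>n. Z (k n) s - Z (k n) (\<sigma> (k n))) \<longlonglongrightarrow> 0"
      by (rule Lim_null_comparison[rotated])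
         (use Z_diff[OF \<sigma>(3) \<sigma>(1)] s in \<open>simp add: comp_def\<close>)
    from tendsto_diff[OF lim'[OF s] this] have "(\<lambda>n. Z (k n) (\<sigma> (k n))) \<longlonglongrightarrow> z s"
      by simp
    then show ?thesis
      using Z_euler[OF \<sigma>(4)] by (simp add: \<sigma>_def \<zeta>_def)
  qed
  have sol: "((\<lambda>s. G s (z s)) has_integral (z t - z 0)) {0..t}" if t: "t \<in> {0..T}" for t
  proof (rule has_integral_dominated_convergence)
    show "((\<lambda>s. G s (\<zeta> (k n) s)) has_integral (Z (k n) t - Z (k n) 0)) {0..t}" for n
      using integrable_integral[OF integrable_on_subinterval[OF intT[of "k n"], of 0 t]] t
      by (simp add: Z_def)
    show "m integrable_on {0..t}"
      by (rule integrable_on_subinterval[OF m]) (use t in auto)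
    show "\<forall>s\<in>{0..t}. norm (G s (\<zeta> (k n) s)) \<le> m s" for n
      using bound t by auto
    show "\<forall>s\<in>{0..t}. (\<lambda>n. G s (\<zeta> (k n) s)) \<longlonglongrightarrow> G s (z s)"
    proof
      fix s assume "s \<in> {0..t}"
      with t have "s \<in> {0..T}" by auto
      then show "(\<lambda>n. G s (\<zeta> (k n) s)) \<longlonglongrightarrow> G s (z s)"
        by (intro continuous_on_tendsto_compose[OF cont \<zeta>_lim]) auto
    qed
    show "(\<lambda>n. Z (k n) t - Z (k n) 0) \<longlonglongrightarrow> z t - z 0"
      using lim' t by (intro tendsto_diff) auto
  qed
  have z_S: "z 0 \<in> S"
    using closed_sequentially[OF compact_imp_closed[OF S(1)] _ lim'[of 0]] z0(1) \<open>0 < T\<close>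
    by (simp add: Z0)
  have "(\<lambda>n. R (Z (k n) 0) (Z (k n) T)) \<longlonglongrightarrow> R (z 0) (z T)"
    using continuous_on_tendsto_compose[OF R(1) tendsto_Pair[OF lim'[of 0] lim'[of T]]] z_S z0(1) \<open>0 < T\<close>
    by (auto simp: Z0)
  moreover have "R (Z (k n) 0) (Z (k n) T) = Z (k n) 0" for n
    using Z_euler[of "Suc (k n)" "k n"] z0(2)[of "k n"] \<tau>(2)[of "k n"] by (simp add: Z0)
  ultimately have "R (z 0) (z T) = z 0"
    using LIMSEQ_unique lim'[of 0] \<open>0 < T\<close> by fastforce
  with z z_S sol show thesis by (intro that)
qed

subsection \<open>The truncated problem\<close>

lemma Lp_integrable:
  assumes "1 < p" and g: "Lp p T g"
  shows "integrable (lebesgue_on {0..T}) g"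
proof (rule Bochner_Integration.integrable_bound)
  have "integrable (lebesgue_on {0..T}) (\<lambda>t. 1 :: real)"
    using continuous_imp_integrable_real[of 0 T "\<lambda>t. 1 :: real"] by simp
  then show "integrable (lebesgue_on {0..T}) (\<lambda>t. 1 + \<bar>g t\<bar> powr p)"
    using g by (intro Bochner_Integration.integrable_add) (auto simp: Lp_def)
  have "\<bar>v\<bar> \<le> 1 + \<bar>v\<bar> powr p" for v :: real
  proof (cases "\<bar>v\<bar> \<le> 1")
    case False
    then have "\<bar>v\<bar> powr 1 \<le> \<bar>v\<bar> powr p"
      using \<open>1 < p\<close> by (intro powr_mono) auto
    then show ?thesis using False by simp
  qed (use powr_ge_zero[of "\<bar>v\<bar>" p] in linarith)
  then show "AE t in lebesgue_on {0..T}. norm (g t) \<le> norm (1 + \<bar>g t\<bar> powr p)"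
    by (intro AE_I2) (simp add: order_trans[OF _ abs_ge_self])
qed (use g in \<open>simp add: Lp_def\<close>)

lemma Lp_dominated:
  assumes "0 \<le> p" and g: "Lp p T g" and k: "k \<in> borel_measurable (lebesgue_on {0..T})"
    and le: "AE t in lebesgue_on {0..T}. \<bar>k t\<bar> \<le> C * \<bar>g t\<bar>" and "0 \<le> C"
  shows "Lp p T k"
proof -
  have gi: "integrable (lebesgue_on {0..T}) (\<lambda>t. C powr p * \<bar>g t\<bar> powr p)"
    using g by (simp add: Lp_def)
  have "integrable (lebesgue_on {0..T}) (\<lambda>t. \<bar>k t\<bar> powr p)"
  proof (rule Bochner_Integration.integrable_bound[OF gi])
    note [measurable] = k
    show "(\<lambda>t. \<bar>k t\<bar> powr p) \<in> borel_measurable (lebesgue_on {0..T})"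
      by measurable
    show "AE t in lebesgue_on {0..T}. norm (\<bar>k t\<bar> powr p) \<le> norm (C powr p * \<bar>g t\<bar> powr p)"
      using le
    proof (rule eventually_mono)
      fix t assume "\<bar>k t\<bar> \<le> C * \<bar>g t\<bar>"
      then have "\<bar>k t\<bar> powr p \<le> (C * \<bar>g t\<bar>) powr p"
        using \<open>0 \<le> p\<close> by (intro powr_mono2) auto
      also have "\<dots> = C powr p * \<bar>g t\<bar> powr p"
        by (rule powr_mult)
      finally show "norm (\<bar>k t\<bar> powr p) \<le> norm (C powr p * \<bar>g t\<bar> powr p)"
        by simp
    qed
  qed
  with k show ?thesis
    by (simp add: Lp_def)
qed

text \<open>
  The hypothesis allows a different exceptional null set for every \<open>y\<close>. Using it for the countably many
  rational multiples of \<open>\<gamma>\<close>, and continuity of \<open>f t x\<close>, gives a common null set.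
\<close>

lemma uniform_L1_bound:
  fixes f :: "real \<Rightarrow> real \<Rightarrow> real \<Rightarrow> real"
  assumes p: "1 < p" and f: "caratheodory T f"
    and \<gamma>: "Lp p T \<gamma>" "AE t in lebesgue_on {0..T}. 0 \<le> \<gamma> t"
    and hR: "Lp p T hR" "\<And>y. Lp p T y \<Longrightarrow> (AE t in lebesgue_on {0..T}. \<bar>y t\<bar> \<le> \<gamma> t) \<Longrightarrow>
        (AE t in lebesgue_on {0..T}. \<forall>x. \<bar>x\<bar> \<le> R \<longrightarrow> \<bar>f t x (y t)\<bar> \<le> hR t)"
  shows "AE t in lebesgue_on {0..T}. \<forall>x y. \<bar>x\<bar> \<le> R \<longrightarrow> \<bar>y\<bar> \<le> \<gamma> t \<longrightarrow> \<bar>f t x y\<bar> \<le> hR t"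
proof -
  let ?D = "\<rat> \<inter> {- 1..1} :: real set"
  have "AE t in lebesgue_on {0..T}. \<forall>x. \<bar>x\<bar> \<le> R \<longrightarrow> \<bar>f t x (c * \<gamma> t)\<bar> \<le> hR t" if "c \<in> ?D" for c
  proof (rule hR(2))
    have "\<gamma> \<in> borel_measurable (lebesgue_on {0..T})"
      using \<gamma>(1) by (simp add: Lp_def)
    then show "Lp p T (\<lambda>t. c * \<gamma> t)"
      using p by (intro Lp_dominated[OF _ \<gamma>(1), where C = "\<bar>c\<bar>"]) (auto simp: abs_mult)
    show "AE t in lebesgue_on {0..T}. \<bar>c * \<gamma> t\<bar> \<le> \<gamma> t"
      using \<gamma>(2)
    proof (rule eventually_mono)
      fix t assume "0 \<le> \<gamma> t"
      then show "\<bar>c * \<gamma> t\<bar> \<le> \<gamma> t"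
        using that mult_right_mono[of "\<bar>c\<bar>" 1 "\<gamma> t"] by (auto simp: abs_mult)
    qed
  qed
  moreover have "countable ?D"
    using countable_rat by (rule countable_subset[rotated]) auto
  ultimately have "AE t in lebesgue_on {0..T}. \<forall>c\<in>?D. \<forall>x. \<bar>x\<bar> \<le> R \<longrightarrow> \<bar>f t x (c * \<gamma> t)\<bar> \<le> hR t"
    by (subst AE_ball_countable) auto
  moreover have "AE t in lebesgue_on {0..T}. continuous_on UNIV (\<lambda>(x, y). f t x y)"
    using f by (simp add: caratheodory_def)
  ultimately show ?thesis
    using \<gamma>(2)
  proof eventually_elim
    case (elim t)
    show ?case
    proof (intro allI impI)
      fix x y assume xy: "\<bar>x\<bar> \<le> R" "\<bar>y\<bar> \<le> \<gamma> t"
      define c where "c = (if \<gamma> t = 0 then 0 else y / \<gamma> t)"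
      have c: "c \<in> {- 1..1}" "y = c * \<gamma> t"
        using xy(2) elim(3) by (auto simp: c_def field_simps)
      have "c \<in> closure ?D"
        unfolding closure_approachable
      proof (intro allI impI)
        fix e :: real assume "0 < e"
        \<comment> \<open>The approximating rationals must stay in \<open>[-1, 1]\<close>, otherwise
          the multiples of \<open>\<gamma>\<close> would not be bounded by \<open>\<gamma>\<close>;
          this window is nonempty even for \<open>c\<close> equal to 1 or -1.\<close>
        then have "max (- 1) (c - e) < min 1 (c + e)" using c(1) by auto
        from Rats_dense_in_real[OF this] obtain r where "r \<in> \<rat>" "max (- 1) (c - e) < r" "r < min 1 (c + e)"
          by blast
        then show "\<exists>r\<in>?D. dist r c < e"
          by (intro bexI[of _ r]) (auto simp: dist_real_def)
      qed
      then obtain cn where cn: "\<And>n. cn n \<in> ?D" "cn \<longlonglongrightarrow> c"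
        unfolding closure_sequential by blast
      have "(\<lambda>n. f t x (cn n * \<gamma> t)) \<longlonglongrightarrow> f t x (c * \<gamma> t)"
        using continuous_on_tendsto_compose[OF elim(2) tendsto_Pair[OF tendsto_const tendsto_mult[OF cn(2) tendsto_const]]]
        by simp
      then have "(\<lambda>n. \<bar>f t x (cn n * \<gamma> t)\<bar>) \<longlonglongrightarrow> \<bar>f t x y\<bar>"
        unfolding c(2) by (rule tendsto_rabs)
      then show "\<bar>f t x y\<bar> \<le> hR t"
        by (rule LIMSEQ_le_const2) (use elim(1) cn(1) xy(1) in blast)
    qed
  qed
qed

lemma clamp_to_bounds: "lo \<le> hi \<Longrightarrow> lo \<le> clamp_to lo hi v \<and> clamp_to lo hi v \<le> hi"
  by (auto simp: clamp_to_def)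

lemma clamp_to_id: "lo \<le> v \<Longrightarrow> v \<le> hi \<Longrightarrow> clamp_to lo hi v = v"
  by (auto simp: clamp_to_def)

lemma abs_clamp_to_le: "0 \<le> d \<Longrightarrow> \<bar>clamp_to (- d) d v\<bar> \<le> \<bar>v\<bar>"
  by (auto simp: clamp_to_def)

lemma abs_clamp_to_le': "0 \<le> d \<Longrightarrow> \<bar>clamp_to (- d) d v\<bar> \<le> d"
  by (auto simp: clamp_to_def)

lemma continuous_on_clamp_to [continuous_intros]:
  fixes lo hi g :: "'b::topological_space \<Rightarrow> real"
  assumes "continuous_on S lo" "continuous_on S hi" "continuous_on S g"
  shows "continuous_on S (\<lambda>x. clamp_to (lo x) (hi x) (g x))"
  unfolding clamp_to_def by (intro continuous_intros assms)

text \<open>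
  The two subtracted terms vanish for \<open>al \<le> x \<le> be\<close>. Below \<open>al\<close>, the first one shrinks \<open>v - Al\<close> by
  \<open>al - x\<close>, so that fluxes within \<open>al - x\<close> of \<open>Al\<close> are replaced by \<open>Al\<close> itself. Simply switching to
  \<open>Al\<close> below \<open>al\<close> would be discontinuous in \<open>x\<close>.
\<close>

definition trunc_flux :: "real \<Rightarrow> real \<Rightarrow> real \<Rightarrow> real \<Rightarrow> real \<Rightarrow> real \<Rightarrow> real" where
  "trunc_flux al be Al Be x v = v
    - clamp_to (- max 0 (al - x)) (max 0 (al - x)) (v - Al)
    - clamp_to (- max 0 (x - be)) (max 0 (x - be)) (v - Be)"

text \<open>The flux contributes \<open>c\<close> and each correction at most the distance
  \<open>2 * c\<close> to a barrier flux, however far \<open>x\<close> is outside. Hence the factor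
  5.\<close>

lemma abs_trunc_flux_le:
  assumes "\<bar>v\<bar> \<le> c" "\<bar>Al\<bar> \<le> c" "\<bar>Be\<bar> \<le> c"
  shows "\<bar>trunc_flux al be Al Be x v\<bar> \<le> 5 * c"
proof -
  define p where "p = clamp_to (- max 0 (al - x)) (max 0 (al - x)) (v - Al)"
  define r where "r = clamp_to (- max 0 (x - be)) (max 0 (x - be)) (v - Be)"
  have "\<bar>p\<bar> \<le> \<bar>v - Al\<bar>" "\<bar>r\<bar> \<le> \<bar>v - Be\<bar>"
    unfolding p_def r_def by (rule abs_clamp_to_le; simp)+
  moreover have "trunc_flux al be Al Be x v = v - p - r"
    by (simp add: trunc_flux_def p_def r_def)
  ultimately show ?thesis
    using assms by linarith
qed

lemma trunc_flux_inside: "al \<le> x \<Longrightarrow> x \<le> be \<Longrightarrow> trunc_flux al be Al Be x v = v"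
  by (simp add: trunc_flux_def clamp_to_def)

lemma trunc_flux_below:
  assumes "x \<le> be" "\<bar>v - Al\<bar> \<le> al - x"
  shows "trunc_flux al be Al Be x v = Al"
proof -
  have "max 0 (x - be) = 0" "max 0 (al - x) = al - x"
    using assms by auto
  moreover have "clamp_to (- (al - x)) (al - x) (v - Al) = v - Al"
    using assms by (intro clamp_to_id) auto
  ultimately show ?thesis
    by (simp add: trunc_flux_def clamp_to_def)
qed

lemma trunc_flux_above:
  assumes "al \<le> x" "\<bar>v - Be\<bar> \<le> x - be"
  shows "trunc_flux al be Al Be x v = Be"
proof -
  have "max 0 (al - x) = 0" "max 0 (x - be) = x - be"
    using assms by auto
  moreover have "clamp_to (- (x - be)) (x - be) (v - Be) = v - Be"
    using assms by (intro clamp_to_id) auto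
  ultimately show ?thesis
    by (simp add: trunc_flux_def clamp_to_def)
qed

lemma continuous_on_trunc_flux [continuous_intros]:
  fixes al be Al Be x v :: "'b::topological_space \<Rightarrow> real"
  assumes "continuous_on S al" "continuous_on S be" "continuous_on S Al" "continuous_on S Be"
    "continuous_on S x" "continuous_on S v"
  shows "continuous_on S (\<lambda>t. trunc_flux (al t) (be t) (Al t) (Be t) (x t) (v t))"
  unfolding trunc_flux_def by (intro continuous_intros assms)

text \<open>With all clamps in place the right-hand side is majorised by \<open>c / h + k\<close>
  for every state, so existence needs no a priori estimate. In the application \<open>\<phi>\<close>
  is the inverse of \<open>\<Phi>\<close> and \<open>Aa\<close>, \<open>Ab\<close> are the barrier
  fluxes.\<close>

lemma truncated_bvp:
  fixes a P Q :: "real \<Rightarrow> real \<Rightarrow> real" and f :: "real \<Rightarrow> real \<Rightarrow> real \<Rightarrow> real"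
    and \<phi> h \<alpha> \<beta> Aa Ab k :: "real \<Rightarrow> real"
  assumes T: "0 < T" and a_cont: "continuous_on ({0..T} \<times> UNIV) (\<lambda>(t, x). a t x)"
    and Z: "negligible Z"
    and h: "\<And>t. t \<in> {0..T} - Z \<Longrightarrow> 0 < h t" "\<And>t x. t \<in> {0..T} - Z \<Longrightarrow> h t \<le> a t x"
    and h_int: "(\<lambda>t. 1 / h t) integrable_on {0..T}"
    and f_meas: "\<And>x y. (\<lambda>t. f t x y) \<in> borel_measurable (lebesgue_on {0..T})"
    and f_cont: "\<And>t. t \<in> {0..T} - Z \<Longrightarrow> continuous_on UNIV (\<lambda>(x, y). f t x y)"
    and \<phi>: "continuous_on UNIV \<phi>"
    and \<alpha>\<beta>: "continuous_on {0..T} \<alpha>" "continuous_on {0..T} \<beta>" "\<And>t. t \<in> {0..T} \<Longrightarrow> \<alpha> t \<le> \<beta> t"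
      "\<And>t. t \<in> {0..T} \<Longrightarrow> \<bar>\<alpha> t\<bar> \<le> M" "\<And>t. t \<in> {0..T} \<Longrightarrow> \<bar>\<beta> t\<bar> \<le> M"
    and A: "continuous_on {0..T} Aa" "continuous_on {0..T} Ab"
      "\<And>t. t \<in> {0..T} \<Longrightarrow> \<bar>Aa t\<bar> \<le> c" "\<And>t. t \<in> {0..T} \<Longrightarrow> \<bar>Ab t\<bar> \<le> c"
    and k: "k integrable_on {0..T}"
      "\<And>t x y. t \<in> {0..T} - Z \<Longrightarrow> \<bar>x\<bar> \<le> M \<Longrightarrow> \<bar>y\<bar> \<le> 5 * c / h t \<Longrightarrow> \<bar>f t x y\<bar> \<le> k t"
    and P: "continuous_on UNIV (\<lambda>(s, v). P s v)" and Q: "continuous_on UNIV (\<lambda>(s, v). Q s v)"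
    and U: "0 \<le> U"
  obtains x u where "continuous_on {0..T} x" "continuous_on {0..T} u"
    "\<And>t. t \<in> {0..T} \<Longrightarrow> ((\<lambda>s. clamp_to (- c) c (\<phi> (u s)) / a s (clamp_to (\<alpha> s) (\<beta> s) (x s)))
        has_integral (x t - x 0)) {0..t}"
    "\<And>t. t \<in> {0..T} \<Longrightarrow> ((\<lambda>s. f s (clamp_to (\<alpha> s) (\<beta> s) (x s))
          (trunc_flux (\<alpha> s) (\<beta> s) (Aa s) (Ab s) (x s) (clamp_to (- c) c (\<phi> (u s))) / a s (clamp_to (\<alpha> s) (\<beta> s) (x s))))
        has_integral (u t - u 0)) {0..t}"
    "\<bar>u 0\<bar> \<le> U"
    "x 0 = clamp_to (\<alpha> 0) (\<beta> 0) (x 0 + P (x 0) (\<phi> (u 0)))"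
    "u 0 = clamp_to (- U) U (u 0 - (x T - clamp_to (\<alpha> T) (\<beta> T) (x T + Q (x T) (\<phi> (u T)))))"
proof -
  let ?I = "{0..T}"
  define d where "d t x = clamp_to (\<alpha> t) (\<beta> t) x" for t x
  define v where "v s = clamp_to (- c) c (\<phi> s)" for s
  define y where "y t x s = trunc_flux (\<alpha> t) (\<beta> t) (Aa t) (Ab t) x (v s) / a t (d t x)" for t x s
  \<comment> \<open>Being zero on \<open>Z\<close>, \<open>G\<close> satisfies the bound and the
    continuity in the state at every time, and no integral changes.\<close>
  define G :: "real \<Rightarrow> real \<times> real \<Rightarrow> real \<times> real" where
    "G t z = (if t \<in> Z then 0 else (v (snd z) / a t (d t (fst z)), f t (d t (fst z)) (y t (fst z) (snd z))))" for t z
  define m where "m t = (if t \<in> Z then 0 else c * (1 / h t) + k t)" for t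
  have c0: "0 \<le> c"
    using A(3)[of 0] T by auto
  have dM: "\<bar>d t x\<bar> \<le> M" if "t \<in> ?I" for t x
    using clamp_to_bounds[OF \<alpha>\<beta>(3)[OF that], of x] \<alpha>\<beta>(4,5)[OF that] unfolding d_def by linarith
  have a_pos: "0 < a t x" if "t \<in> ?I - Z" for t x
    using h(1)[OF that] h(2)[OF that, of x] by linarith
  have quot: "\<bar>w / a t x\<bar> \<le> w' / h t" if "t \<in> ?I - Z" "\<bar>w\<bar> \<le> w'" for t x w w'
  proof -
    have "\<bar>w / a t x\<bar> = \<bar>w\<bar> / a t x"
      using a_pos[OF that(1), of x] by simp
    also have "\<dots> \<le> w' / h t"
      using that(2) h(1)[OF that(1)] h(2)[OF that(1), of x] by (intro frac_le) auto
    finally show ?thesis .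
  qed
  have v_le: "\<bar>v s\<bar> \<le> c" for s
    unfolding v_def by (rule abs_clamp_to_le'[OF c0])
  have G_bound: "norm (G t z) \<le> m t" if t: "t \<in> ?I" for t z
  proof (cases "t \<in> Z")
    case False
    with t have tZ: "t \<in> ?I - Z" by simp
    have "\<bar>y t (fst z) (snd z)\<bar> \<le> 5 * c / h t"
      unfolding y_def by (intro quot[OF tZ] abs_trunc_flux_le v_le A t)
    then have "\<bar>f t (d t (fst z)) (y t (fst z) (snd z))\<bar> \<le> k t"
      by (rule k(2)[OF tZ dM[OF t]])
    moreover have "\<bar>v (snd z) / a t (d t (fst z))\<bar> \<le> c / h t"
      by (rule quot[OF tZ v_le])
    moreover have "G t z = (v (snd z) / a t (d t (fst z)), f t (d t (fst z)) (y t (fst z) (snd z)))"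
      using False by (simp add: G_def)
    then have "norm (G t z) \<le> \<bar>v (snd z) / a t (d t (fst z))\<bar> + \<bar>f t (d t (fst z)) (y t (fst z) (snd z))\<bar>"
      using norm_Pair_le[of "v (snd z) / a t (d t (fst z))" "f t (d t (fst z)) (y t (fst z) (snd z))"]
      by (simp only: real_norm_def)
    ultimately show ?thesis
      using False by (simp add: m_def)
  qed (simp add: G_def m_def)
  have "(\<lambda>t. c * (1 / h t) + k t) integrable_on ?I"
    by (intro integrable_add integrable_on_mult_right h_int k(1))
  then have m: "m integrable_on ?I"
    by (rule integrable_spike[OF _ Z]) (simp add: m_def)
  have Zs: "Z \<in> sets lebesgue"
    by (rule negligible_imp_sets[OF Z])
  have Zs': "Z \<inter> space (lebesgue_on ?I) \<in> sets (lebesgue_on ?I)"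
    using Zs by (subst sets_restrict_space_iff) (auto simp: space_restrict_space)
  have cm: "g \<in> borel_measurable (lebesgue_on ?I)" if "continuous_on ?I g" for g :: "real \<Rightarrow> real"
    using that by (intro continuous_imp_measurable_on_sets_lebesgue) auto
  have ac: "continuous_on ?I (\<lambda>t. a t (d t x))" for x
  proof -
    have "continuous_on ?I (\<lambda>t. (t, d t x))"
      unfolding d_def by (intro continuous_intros \<alpha>\<beta>)
    from continuous_on_compose2[OF a_cont this] show ?thesis by auto
  qed
  have G_int: "(\<lambda>t. G t z) integrable_on ?I" for z
  proof -
    obtain x s where z: "z = (x, s)" by (cases z)
    have "(\<lambda>t. if t \<in> Z then 0 else f t (d t x) (y t x s)) \<in> borel_measurable (lebesgue_on ?I)"
    proof (rule measurable_superposition[where f = "\<lambda>t x y. if t \<in> Z then 0 else f t x y"])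
      show "(\<lambda>t. if t \<in> Z then 0 else f t x y) \<in> borel_measurable (lebesgue_on ?I)" for x y
        by (intro measurable_If_set f_meas Zs') simp
      show "continuous_on UNIV (\<lambda>(x, y). if t \<in> Z then 0 else f t x y)" if "t \<in> ?I" for t
        using f_cont[of t] that by (cases "t \<in> Z") auto
      show "(\<lambda>t. d t x) \<in> borel_measurable (lebesgue_on ?I)"
        unfolding d_def by (intro cm continuous_intros \<alpha>\<beta>)
      show "(\<lambda>t. y t x s) \<in> borel_measurable (lebesgue_on ?I)"
        unfolding y_def by (intro borel_measurable_divide cm continuous_intros \<alpha>\<beta> A ac)
    qed
    moreover have "(\<lambda>t. if t \<in> Z then 0 else v s / a t (d t x)) \<in> borel_measurable (lebesgue_on ?I)"
      by (intro measurable_If_set borel_measurable_divide cm ac Zs') simp_all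
    ultimately have "(\<lambda>t. (if t \<in> Z then 0 else v s / a t (d t x), if t \<in> Z then 0 else f t (d t x) (y t x s)))
        \<in> borel_measurable (lebesgue_on ?I)"
      by (intro borel_measurable_Pair)
    moreover have "(\<lambda>t. (if t \<in> Z then 0 else v s / a t (d t x), if t \<in> Z then 0 else f t (d t x) (y t x s))) = (\<lambda>t. G t z)"
      by (auto simp: G_def z zero_prod_def)
    ultimately have "(\<lambda>t. G t z) \<in> borel_measurable (lebesgue_on ?I)" by simp
    then show ?thesis
      by (rule measurable_bounded_by_integrable_imp_integrable[OF _ m G_bound]) auto
  qed
  have G_cont: "continuous_on UNIV (G t)" if t: "t \<in> ?I" for t
  proof (cases "t \<in> Z")
    case True
    then have "G t = (\<lambda>z. 0)" by (auto simp: G_def)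
    then show ?thesis by simp
  next
    case False
    with t have tZ: "t \<in> ?I - Z" by simp
    have vc: "continuous_on UNIV (\<lambda>z :: real \<times> real. v (snd z))"
      unfolding v_def by (intro continuous_intros continuous_on_compose2[OF \<phi>]) auto
    have dc: "continuous_on UNIV (\<lambda>z :: real \<times> real. d t (fst z))"
      unfolding d_def by (intro continuous_intros)
    have "continuous_on UNIV (\<lambda>z :: real \<times> real. (t, d t (fst z)))"
      by (intro continuous_intros dc)
    from continuous_on_compose2[OF a_cont this] t
    have ac': "continuous_on UNIV (\<lambda>z :: real \<times> real. a t (d t (fst z)))"
      by (simp add: image_subset_iff)
    have a_ne: "a t (d t (fst z)) \<noteq> 0" for z :: "real \<times> real"
      using a_pos[OF tZ, of "d t (fst z)"] by simp
    have "continuous_on UNIV (\<lambda>z. y t (fst z) (snd z))"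
      unfolding y_def by (intro continuous_intros vc ac' ballI a_ne)
    then have "continuous_on UNIV (\<lambda>z. (d t (fst z), y t (fst z) (snd z)))"
      by (intro continuous_intros dc)
    from continuous_on_compose2[OF f_cont[OF tZ] this]
    have fc: "continuous_on UNIV (\<lambda>z. f t (d t (fst z)) (y t (fst z) (snd z)))"
      by auto
    have "G t = (\<lambda>z. (v (snd z) / a t (d t (fst z)), f t (d t (fst z)) (y t (fst z) (snd z))))"
      using False by (auto simp: G_def)
    moreover have "continuous_on UNIV (\<lambda>z. (v (snd z) / a t (d t (fst z)), f t (d t (fst z)) (y t (fst z) (snd z))))"
      by (intro continuous_intros vc ac' fc ballI a_ne)
    ultimately show ?thesis by simp
  qed
  define S where "S = {\<alpha> 0..\<beta> 0} \<times> {- U..U}"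
  have S: "compact S" "convex S" "S \<noteq> {}"
    using \<alpha>\<beta>(3)[of 0] T U by (auto simp: S_def intro!: compact_Times convex_Times)
  \<comment> \<open>A fixed point has \<open>P = 0\<close> at time 0 unless \<open>x 0\<close> lies
    on a barrier. The second component shifts \<open>u 0\<close> by the defect of the truncated
    terminal condition, so a fixed point with \<open>\<bar>u 0\<bar> < U\<close> has defect
    zero.\<close>
  define R :: "real \<times> real \<Rightarrow> real \<times> real \<Rightarrow> real \<times> real" where
    "R z w = (clamp_to (\<alpha> 0) (\<beta> 0) (fst z + P (fst z) (\<phi> (snd z))),
      clamp_to (- U) U (snd z - (fst w - clamp_to (\<alpha> T) (\<beta> T) (fst w + Q (fst w) (\<phi> (snd w))))))" for z w
  have R_cont: "continuous_on (S \<times> UNIV) (\<lambda>(z, w). R z w)"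
  proof -
    have 1: "continuous_on UNIV (\<lambda>p :: (real \<times> real) \<times> (real \<times> real). (fst (fst p), \<phi> (snd (fst p))))"
      "continuous_on UNIV (\<lambda>p :: (real \<times> real) \<times> (real \<times> real). (fst (snd p), \<phi> (snd (snd p))))"
      by (intro continuous_intros continuous_on_compose2[OF \<phi>]; simp)+
    have "continuous_on UNIV (\<lambda>p :: (real \<times> real) \<times> (real \<times> real). P (fst (fst p)) (\<phi> (snd (fst p))))"
      "continuous_on UNIV (\<lambda>p :: (real \<times> real) \<times> (real \<times> real). Q (fst (snd p)) (\<phi> (snd (snd p))))"
      using continuous_on_compose2[OF P 1(1)] continuous_on_compose2[OF Q 1(2)] by auto
    then have "continuous_on UNIV (\<lambda>p. R (fst p) (snd p))"
      unfolding R_def by (intro continuous_intros)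
    then show ?thesis
      by (auto simp: case_prod_beta intro: continuous_on_subset)
  qed
  have R_S: "R z w \<in> S" if "z \<in> S" for z w
    using clamp_to_bounds[of "\<alpha> 0" "\<beta> 0"] clamp_to_bounds[of "- U" U] \<alpha>\<beta>(3)[of 0] T U
    by (auto simp: R_def S_def)
  obtain z where z: "continuous_on ?I z" "z 0 \<in> S" "R (z 0) (z T) = z 0"
    "\<And>t. t \<in> ?I \<Longrightarrow> ((\<lambda>s. G s (z s)) has_integral (z t - z 0)) {0..t}"
    using caratheodory_bvp[OF T m G_bound G_int G_cont S R_cont R_S] by metis
  define x where "x t = fst (z t)" for t
  define u where "u t = snd (z t)" for t
  show thesis
  proof (rule that[of x u])
    show "continuous_on ?I x" "continuous_on ?I u"
      unfolding x_def u_def by (intro continuous_intros z(1))+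
    show "\<bar>u 0\<bar> \<le> U"
      using z(2) by (auto simp: S_def u_def mem_Times_iff)
    show "x 0 = clamp_to (\<alpha> 0) (\<beta> 0) (x 0 + P (x 0) (\<phi> (u 0)))"
      using arg_cong[OF z(3), of fst] by (simp add: R_def x_def u_def)
    show "u 0 = clamp_to (- U) U (u 0 - (x T - clamp_to (\<alpha> T) (\<beta> T) (x T + Q (x T) (\<phi> (u T)))))"
      using arg_cong[OF z(3), of snd] by (simp add: R_def x_def u_def)
    fix t assume t: "t \<in> ?I"
    have "((\<lambda>s. fst (G s (z s))) has_integral (x t - x 0)) {0..t}"
      using has_integral_linear[OF z(4)[OF t] bounded_linear_fst] by (simp add: comp_def x_def)
    then show "((\<lambda>s. clamp_to (- c) c (\<phi> (u s)) / a s (clamp_to (\<alpha> s) (\<beta> s) (x s))) has_integral (x t - x 0)) {0..t}"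
      by (rule has_integral_spike[OF Z, rotated]) (simp add: G_def d_def v_def x_def u_def)
    have "((\<lambda>s. snd (G s (z s))) has_integral (u t - u 0)) {0..t}"
      using has_integral_linear[OF z(4)[OF t] bounded_linear_snd] by (simp add: comp_def u_def)
    then show "((\<lambda>s. f s (clamp_to (\<alpha> s) (\<beta> s) (x s))
          (trunc_flux (\<alpha> s) (\<beta> s) (Aa s) (Ab s) (x s) (clamp_to (- c) c (\<phi> (u s))) / a s (clamp_to (\<alpha> s) (\<beta> s) (x s))))
        has_integral (u t - u 0)) {0..t}"
      by (rule has_integral_spike[OF Z, rotated]) (simp add: G_def d_def v_def y_def x_def u_def)
  qed
qed

subsection \<open>Existence between lower and upper solutions\<close>

text \<open>The composite \<open>\<phi> (u t)\<close> is continuous and equals the product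
  \<open>a t (x t) * x' t\<close> almost everywhere, so it is the flux, and
  \<open>u = \<Phi> A\<close> then holds at every point.\<close>

lemma sol_rel_flux:
  assumes "sol_rel \<Phi> a f T R x" and T: "0 < T"
    and \<phi>: "continuous_on UNIV \<phi>" "\<And>s. \<phi> (\<Phi> s) = s" "\<And>s. \<Phi> (\<phi> s) = s"
  obtains x' u w A Z where "weak_deriv T x x'" "weak_deriv T u w" "continuous_on {0..T} A" "negligible Z"
    "\<And>t. u t = \<Phi> (A t)"
    "\<And>t. t \<in> {0..T} - Z \<Longrightarrow> A t = a t (x t) * x' t"
    "\<And>t. t \<in> {0..T} - Z \<Longrightarrow> R (w t) (f t (x t) (x' t))"
    "\<And>t. t \<in> {0..T} \<Longrightarrow> flux a T x t = A t"
proof -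
  obtain x' u w where x': "weak_deriv T x x'" and u: "weak_deriv T u w"
    and u_eq: "AE t in lebesgue_on {0..T}. u t = \<Phi> (a t (x t) * x' t)"
    and w: "AE t in lebesgue_on {0..T}. R (w t) (f t (x t) (x' t))"
    using assms(1) unfolding sol_rel_def by blast
  define A where "A t = \<phi> (u t)" for t
  have A_cont: "continuous_on {0..T} A"
    unfolding A_def by (intro continuous_on_compose2[OF \<phi>(1) weak_derivD(4)[OF u]]) auto
  obtain Z1 where Z1: "negligible Z1" "\<And>t. t \<in> {0..T} - Z1 \<Longrightarrow> u t = \<Phi> (a t (x t) * x' t)"
    using u_eq by (auto simp: AE_lebesgue_on_iff)
  obtain Z2 where Z2: "negligible Z2" "\<And>t. t \<in> {0..T} - Z2 \<Longrightarrow> R (w t) (f t (x t) (x' t))"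
    using w by (auto simp: AE_lebesgue_on_iff)
  have A_eq: "A t = a t (x t) * x' t" if "t \<in> {0..T} - Z1" for t
    using Z1(2)[OF that] \<phi>(2) by (simp add: A_def)
  have A_AE: "AE t in lebesgue_on {0..T}. A t = a t (x t) * x' t"
    using Z1(1) A_eq by (auto simp: AE_lebesgue_on_iff)
  show thesis
    by (rule that[OF x' u A_cont negligible_Un[OF Z1(1) Z2(1)]])
       (use A_eq Z2(2) flux_eq[where a = a, OF T x' A_cont A_AE] \<phi>(3) in \<open>auto simp: A_def\<close>)
qed

lemma continuous_on_Icc_abs_bounded:
  fixes g :: "real \<Rightarrow> real"
  assumes "continuous_on {0..T} g"
  obtains m where "0 \<le> m" "\<And>t. t \<in> {0..T} \<Longrightarrow> \<bar>g t\<bar> \<le> m"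
proof -
  obtain B where B: "\<forall>y\<in>g ` {0..T}. norm y \<le> B"
    using compact_imp_bounded[OF compact_continuous_image[OF assms compact_Icc]]
    unfolding bounded_iff by blast
  show thesis
  proof (rule that[of "max 0 B"])
    show "\<bar>g t\<bar> \<le> max 0 B" if "t \<in> {0..T}" for t
      using B that by (simp add: le_max_iff_disj)
  qed simp
qed

lemma le_Sup_image_Times:
  fixes a :: "real \<Rightarrow> real \<Rightarrow> real"
  assumes "continuous_on ({0..T} \<times> UNIV) (\<lambda>(t, x). a t x)" and "t \<in> {0..T}" "\<bar>y\<bar> \<le> M"
  shows "a t y \<le> Sup ((\<lambda>(t, y). a t y) ` ({0..T} \<times> {- M..M}))"
proof (rule cSup_upper)
  have "continuous_on ({0..T} \<times> {- M..M}) (\<lambda>(t, x). a t x)"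
    by (rule continuous_on_subset[OF assms(1)]) auto
  then have "compact ((\<lambda>(t, y). a t y) ` ({0..T} \<times> {- M..M}))"
    by (intro compact_continuous_image compact_Times compact_Icc)
  then show "bdd_above ((\<lambda>(t, y). a t y) ` ({0..T} \<times> {- M..M}))"
    by (intro bounded_imp_bdd_above compact_imp_bounded)
  show "a t y \<in> (\<lambda>(t, y). a t y) ` ({0..T} \<times> {- M..M})"
    using assms(2,3) by (intro image_eqI[of _ _ "(t, y)"]) (auto simp: abs_le_iff)
qed

text \<open>The growth condition concerns the true slope, whereas \<open>x'\<close> is clamped; they
  agree where \<open>\<bar>A t\<bar> \<le> c\<close>, the only region the Nagumo argument inspects.
  The level \<open>c\<close> is free apart from \<open>L \<le> c\<close>, so the result serves
  before and after the truncation is removed.\<close>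

lemma solution_flux_bound:
  fixes a :: "real \<Rightarrow> real \<Rightarrow> real" and f :: "real \<Rightarrow> real \<Rightarrow> real \<Rightarrow> real" and q :: ereal
    and A u w x x' \<alpha> \<beta> \<psi> l \<mu> :: "real \<Rightarrow> real"
  assumes T: "0 < T" and mono: "strict_mono \<Phi>"
    and a_cont: "continuous_on ({0..T} \<times> UNIV) (\<lambda>(t, x). a t x)"
    and Z: "negligible Z" and a_pos: "\<And>t y. t \<in> {0..T} - Z \<Longrightarrow> 0 < a t y"
    and "0 < H"
    and growth: "\<And>t x y. t \<in> {0..T} - Z \<Longrightarrow> \<alpha> t \<le> x \<Longrightarrow> x \<le> \<beta> t \<Longrightarrow> H \<le> \<bar>y\<bar> \<Longrightarrow>
        \<bar>f t x y\<bar> \<le> \<psi> \<bar>\<Phi> (a t x * y)\<bar> * (l t + \<mu> t * \<bar>y\<bar> powr qexp q)"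
    and \<psi>: "\<And>s. 0 < s \<Longrightarrow> 0 < \<psi> s" "\<And>c d. 0 < c \<Longrightarrow> (\<lambda>s. 1 / \<psi> s) integrable_on {c..d}"
    and q: "1 < q" "Lq_ext q T \<mu>" "AE t in lebesgue_on {0..T}. 0 \<le> \<mu> t"
    and l: "l absolutely_integrable_on {0..T}" "AE t in lebesgue_on {0..T}. 0 \<le> l t"
    and x: "weak_deriv T x x'" and u: "weak_deriv T u w"
    and u_eq: "\<And>t. u t = \<Phi> (A t)"
    and x'_eq: "\<And>t. t \<in> {0..T} - Z \<Longrightarrow> x' t = clamp_to (- c) c (A t) / a t (x t)"
    and w_eq: "\<And>t. t \<in> {0..T} - Z \<Longrightarrow> w t = f t (x t) (x' t)"
    and btw: "\<And>t. t \<in> {0..T} \<Longrightarrow> \<alpha> t \<le> x t \<and> x t \<le> \<beta> t"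
    and M: "\<And>t. t \<in> {0..T} \<Longrightarrow> \<bar>\<alpha> t\<bar> \<le> M \<and> \<bar>\<beta> t\<bar> \<le> M"
    and N: "0 < N" "N > max H (2 * M / T) * Sup ((\<lambda>(t, y). a t y) ` ({0..T} \<times> {- M .. M}))"
      "0 < \<Phi> N" "\<Phi> (- N) < 0" and L: "0 < L" "L \<le> c"
    and big: "min (integral {\<Phi> N..\<Phi> L} (\<lambda>s. 1 / \<psi> s)) (integral {- \<Phi> (- N)..- \<Phi> (- L)} (\<lambda>s. 1 / \<psi> s))
        > L1_norm T l + Lq_norm q T \<mu> * (2 * M) powr qexp q"
    and t: "t \<in> {0..T}"
  shows "\<bar>A t\<bar> \<le> L"
proof -
  have xM: "\<bar>x t\<bar> \<le> M" if "t \<in> {0..T}" for t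
    using btw[OF that] M[OF that] by auto
  have H: "0 \<le> H" using \<open>0 < H\<close> by simp
  have b: "0 < a t (x t) \<and> a t (x t) \<le> Sup ((\<lambda>(t, y). a t y) ` ({0..T} \<times> {- M .. M}))"
    if "t \<in> {0..T} - Z" for t
    using a_pos[OF that] le_Sup_image_Times[OF a_cont _ xM] that by auto
  have gr: "\<bar>w t\<bar> \<le> \<psi> \<bar>u t\<bar> * (l t + \<mu> t * \<bar>x' t\<bar> powr qexp q)"
    if "t \<in> {0..T} - Z" "\<bar>A t\<bar> \<le> c" "H \<le> \<bar>x' t\<bar>" for t
  proof -
    have "clamp_to (- c) c (A t) = A t"
      using that(2) by (intro clamp_to_id) auto
    then have "a t (x t) * x' t = A t"
      using x'_eq[OF that(1)] a_pos[OF that(1), of "x t"] by simp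
    then show ?thesis
      using growth[OF that(1) _ _ that(3), of "x t"] btw[of t] that(1) w_eq[OF that(1)] u_eq[of t] by simp
  qed
  show ?thesis
    by (rule nagumo_bound[OF T mono u_eq u x Z x'_eq b xM N(1) H N(2-4) L gr \<psi> q l big t])
qed

theorem theorem4p5:
  fixes T p :: real and \<Phi> :: "real \<Rightarrow> real" and a :: "real \<Rightarrow> real \<Rightarrow> real"
    and h :: "real \<Rightarrow> real" and f :: "real \<Rightarrow> real \<Rightarrow> real \<Rightarrow> real"
    and \<alpha> \<beta> :: "real \<Rightarrow> real" and H :: real and q :: ereal
    and \<mu> l :: "real \<Rightarrow> real" and \<psi> :: "real \<Rightarrow> real" and P Q :: "real \<Rightarrow> real \<Rightarrow> real"
  assumes T_pos: "T > 0"
    and Phi_mono: "strict_mono \<Phi>"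
    and Phi_homeo: "\<exists>\<Psi>. homeomorphism UNIV UNIV \<Phi> \<Psi>"
    and a_cont: "continuous_on ({0..T} \<times> UNIV) (\<lambda>(t, x). a t x)"
    and h_cont: "continuous_on {0..T} h"
    and h_nonneg: "\<forall>t\<in>{0..T}. h t \<ge> 0"
    and p_gt1: "p > 1"
    and h_pos_ae: "AE t in lebesgue_on {0..T}. h t > 0"
    and inv_h_Lp: "Lp p T (\<lambda>t. 1 / h t)"
    and a_ge_h: "\<forall>t\<in>{0..T}. \<forall>x. a t x \<ge> h t"
    and f_carath: "caratheodory T f"
    \<comment> \<open>(i)\<close>
    and alpha_W1p: "W1p p T \<alpha>" and beta_W1p: "W1p p T \<beta>"
    and alpha_lower: "lower_solution \<Phi> a f T \<alpha>"
    and beta_upper: "upper_solution \<Phi> a f T \<beta>"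
    and alpha_le_beta: "\<forall>t\<in>{0..T}. \<alpha> t \<le> \<beta> t"
    \<comment> \<open>(ii)\<close>
    and cond_ii: "\<forall>R>0. \<forall>\<gamma>. Lp p T \<gamma> \<and> (AE t in lebesgue_on {0..T}. \<gamma> t \<ge> 0) \<longrightarrow>
        (\<exists>hR. Lp p T hR \<and> (AE t in lebesgue_on {0..T}. hR t \<ge> 0) \<and>
          (\<forall>y. Lp p T y \<and> (AE t in lebesgue_on {0..T}. \<bar>y t\<bar> \<le> \<gamma> t) \<longrightarrow>
             (AE t in lebesgue_on {0..T}. \<forall>x. \<bar>x\<bar> \<le> R \<longrightarrow> \<bar>f t x (y t)\<bar> \<le> hR t)))"
    \<comment> \<open>(iii)\<close>
    and H_pos: "H > 0"
    and q_gt1: "q > 1"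
    and mu_Lq: "Lq_ext q T \<mu>" and mu_nonneg: "AE t in lebesgue_on {0..T}. \<mu> t \<ge> 0"
    and l_L1: "Lp 1 T l" and l_nonneg: "AE t in lebesgue_on {0..T}. l t \<ge> 0"
    and psi_meas: "\<psi> \<in> borel_measurable (lebesgue_on {0<..})"
    and psi_pos: "\<forall>s>0. \<psi> s > 0"
    and inv_psi_loc: "\<forall>c d. 0 < c \<longrightarrow> (\<lambda>s. 1 / \<psi> s) integrable_on {c..d}"
    and inv_psi_div: "(\<integral>\<^sup>+ s \<in> {1..}. ennreal (1 / \<psi> s) \<partial>lborel) = \<infinity>"
    and f_growth: "AE t in lebesgue_on {0..T}. \<forall>x y. \<alpha> t \<le> x \<and> x \<le> \<beta> t \<and> \<bar>y\<bar> \<ge> H \<longrightarrow>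
        \<bar>f t x y\<bar> \<le> \<psi> \<bar>\<Phi> (a t x * y)\<bar> * (l t + \<mu> t * \<bar>y\<bar> powr qexp q)"
    \<comment> \<open>(iv)\<close>
    and P_cont: "continuous_on UNIV (\<lambda>(s, v). P s v)"
    and Q_cont: "continuous_on UNIV (\<lambda>(s, v). Q s v)"
    and P_mono: "\<forall>s. mono (P s)" and Q_antimono: "\<forall>s. antimono (Q s)"
    \<comment> \<open>(v)\<close>
    and bc_alpha: "P (\<alpha> 0) (flux a T \<alpha> 0) \<ge> 0" "Q (\<alpha> T) (flux a T \<alpha> T) \<ge> 0"
    and bc_beta: "P (\<beta> 0) (flux a T \<beta> 0) \<le> 0" "Q (\<beta> T) (flux a T \<beta> T) \<le> 0"
    \<comment> \<open>(vi)\<close>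
    and a_ends: "\<forall>x. a 0 x \<noteq> 0 \<and> a T x \<noteq> 0"
  shows "\<exists>x. is_solution \<Phi> a f T x \<and> W1p p T x \<and>
      P (x 0) (flux a T x 0) = 0 \<and> Q (x T) (flux a T x T) = 0 \<and>
      (\<forall>t\<in>{0..T}. \<alpha> t \<le> x t \<and> x t \<le> \<beta> t) \<and>
      (\<forall>M N L. M > 0 \<and> (\<forall>t\<in>{0..T}. \<bar>\<alpha> t\<bar> \<le> M \<and> \<bar>\<beta> t\<bar> \<le> M) \<and>
         N > 0 \<and> N > max H (2 * M / T) * Sup ((\<lambda>(t, y). a t y) ` ({0..T} \<times> {- M .. M})) \<and>
         \<Phi> N > 0 \<and> \<Phi> (-N) < 0 \<and> L > 0 \<and>
         min (integral {\<Phi> N..\<Phi> L} (\<lambda>s. 1 / \<psi> s))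
             (integral {- \<Phi> (- N) .. - \<Phi> (- L)} (\<lambda>s. 1 / \<psi> s))
           > L1_norm T l + Lq_norm q T \<mu> * (2 * M) powr qexp q
       \<longrightarrow> (\<forall>t\<in>{0..T}. \<bar>x t\<bar> \<le> M \<and> \<bar>flux a T x t\<bar> \<le> L))"
proof -
  let ?I = "{0..T}"
  let ?L = "lebesgue_on {0..T}"
  let ?a0 = "\<lambda>M. Sup ((\<lambda>(t, y). a t y) ` ({0..T} \<times> {- M .. M}))"
  obtain \<phi> where \<phi>: "continuous_on UNIV \<phi>" "\<And>s. \<phi> (\<Phi> s) = s" "\<And>s. \<Phi> (\<phi> s) = s"
    using Phi_homeo unfolding homeomorphism_def by auto
  have \<phi>_less: "\<phi> s < r \<longleftrightarrow> s < \<Phi> r" "r < \<phi> s \<longleftrightarrow> \<Phi> r < s" for s r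
    using strict_mono_less[OF Phi_mono, of "\<phi> s" r] strict_mono_less[OF Phi_mono, of r "\<phi> s"] \<phi>(3) by auto
  have \<phi>_le: "\<phi> s \<le> r \<longleftrightarrow> s \<le> \<Phi> r" "r \<le> \<phi> s \<longleftrightarrow> \<Phi> r \<le> s" for s r
    using \<phi>_less by (auto simp: not_less[symmetric])
  obtain \<alpha>' ua wa Aa Za where \<alpha>: "weak_deriv T \<alpha> \<alpha>'" "weak_deriv T ua wa" "continuous_on ?I Aa" "negligible Za"
    "\<And>t. ua t = \<Phi> (Aa t)"
    "\<And>t. t \<in> ?I - Za \<Longrightarrow> Aa t = a t (\<alpha> t) * \<alpha>' t"
    "\<And>t. t \<in> ?I - Za \<Longrightarrow> wa t \<ge> f t (\<alpha> t) (\<alpha>' t)"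
    "\<And>t. t \<in> ?I \<Longrightarrow> flux a T \<alpha> t = Aa t"
    using sol_rel_flux[OF alpha_lower[unfolded lower_solution_def] T_pos \<phi>] by metis
  obtain \<beta>' ub wb Ab Zb where \<beta>: "weak_deriv T \<beta> \<beta>'" "weak_deriv T ub wb" "continuous_on ?I Ab" "negligible Zb"
    "\<And>t. ub t = \<Phi> (Ab t)"
    "\<And>t. t \<in> ?I - Zb \<Longrightarrow> Ab t = a t (\<beta> t) * \<beta>' t"
    "\<And>t. t \<in> ?I - Zb \<Longrightarrow> wb t \<le> f t (\<beta> t) (\<beta>' t)"
    "\<And>t. t \<in> ?I \<Longrightarrow> flux a T \<beta> t = Ab t"
    using sol_rel_flux[OF beta_upper[unfolded upper_solution_def] T_pos \<phi>] by metis
  have \<alpha>c: "continuous_on ?I \<alpha>" and \<beta>c: "continuous_on ?I \<beta>"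
    using weak_derivD(4)[OF \<alpha>(1)] weak_derivD(4)[OF \<beta>(1)] .
  have \<alpha>\<beta>: "\<alpha> t \<le> \<beta> t" if "t \<in> ?I" for t
    using alpha_le_beta that by blast
  have T0: "0 \<in> ?I" "T \<in> ?I"
    using T_pos by auto
  have l_abs: "l absolutely_integrable_on ?I"
    using l_L1 by (simp add: Lp_def absolutely_integrable_measurable comp_def)
  obtain Zh where Zh: "negligible Zh" "\<And>t. t \<in> ?I - Zh \<Longrightarrow> 0 < h t"
    using h_pos_ae by (auto simp: AE_lebesgue_on_iff)
  obtain Zf where Zf: "negligible Zf" "\<And>t. t \<in> ?I - Zf \<Longrightarrow> continuous_on UNIV (\<lambda>(x, y). f t x y)"
    using f_carath by (auto simp: AE_lebesgue_on_iff caratheodory_def)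
  obtain Zg where Zg: "negligible Zg" "\<And>t x y. t \<in> ?I - Zg \<Longrightarrow> \<alpha> t \<le> x \<Longrightarrow> x \<le> \<beta> t \<Longrightarrow> H \<le> \<bar>y\<bar> \<Longrightarrow>
        \<bar>f t x y\<bar> \<le> \<psi> \<bar>\<Phi> (a t x * y)\<bar> * (l t + \<mu> t * \<bar>y\<bar> powr qexp q)"
    using f_growth by (auto simp: AE_lebesgue_on_iff)
  obtain m\<alpha> where m\<alpha>: "0 \<le> m\<alpha>" "\<And>t. t \<in> ?I \<Longrightarrow> \<bar>\<alpha> t\<bar> \<le> m\<alpha>"
    using continuous_on_Icc_abs_bounded[OF \<alpha>c] by metis
  obtain m\<beta> where m\<beta>: "0 \<le> m\<beta>" "\<And>t. t \<in> ?I \<Longrightarrow> \<bar>\<beta> t\<bar> \<le> m\<beta>"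
    using continuous_on_Icc_abs_bounded[OF \<beta>c] by metis
  obtain mA where mA: "0 \<le> mA" "\<And>t. t \<in> ?I \<Longrightarrow> \<bar>Aa t\<bar> \<le> mA"
    using continuous_on_Icc_abs_bounded[OF \<alpha>(3)] by metis
  obtain mB where mB: "0 \<le> mB" "\<And>t. t \<in> ?I \<Longrightarrow> \<bar>Ab t\<bar> \<le> mB"
    using continuous_on_Icc_abs_bounded[OF \<beta>(3)] by metis

  \<comment> \<open>Choice of the constants\<close>
  define M where "M = m\<alpha> + m\<beta> + 1"
  have M: "0 < M" "\<And>t. t \<in> ?I \<Longrightarrow> \<bar>\<alpha> t\<bar> \<le> M" "\<And>t. t \<in> ?I \<Longrightarrow> \<bar>\<beta> t\<bar> \<le> M"
    using m\<alpha> m\<beta> unfolding M_def by (force)+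
  \<comment> \<open>The middle term gives the slope condition. The last one puts the zero
    \<open>\<phi> 0\<close> of \<open>\<Phi>\<close> between \<open>- N\<close> and
    \<open>N\<close>, whence the signs of \<open>\<Phi> N\<close> and \<open>\<Phi> (- N)\<close>.
    The 1 makes everything strict.\<close>
  define N where "N = 1 + \<bar>max H (2 * M / T) * ?a0 M\<bar> + \<bar>\<phi> 0\<bar>"
  have N: "0 < N" "max H (2 * M / T) * ?a0 M < N" "0 < \<Phi> N" "\<Phi> (- N) < 0"
  proof -
    show "0 < N" "max H (2 * M / T) * ?a0 M < N"
      unfolding N_def by linarith+
    have "\<phi> 0 < N" "- N < \<phi> 0"
      unfolding N_def by linarith+
    then show "0 < \<Phi> N" "\<Phi> (- N) < 0"
      by (simp_all add: \<phi>_less)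
  qed
  define C where "C = L1_norm T l + Lq_norm q T \<mu> * (2 * M) powr qexp q"
  have \<psi>0: "0 \<le> 1 / \<psi> s" if "0 < s" for s
    using psi_pos that by (simp add: less_imp_le)
  have \<psi>loc: "(\<lambda>s. 1 / \<psi> s) integrable_on {c..d}" if "0 < c" for c d
    using inv_psi_loc that by blast
  obtain D1 where D1: "\<And>d. D1 \<le> d \<Longrightarrow> C < integral {\<Phi> N..d} (\<lambda>s. 1 / \<psi> s)"
    using integral_exceeds[OF \<psi>0 \<psi>loc inv_psi_div N(3)] by metis
  have "0 < - \<Phi> (- N)" using N(4) by simp
  then obtain D2 where D2: "\<And>d. D2 \<le> d \<Longrightarrow> C < integral {- \<Phi> (- N)..d} (\<lambda>s. 1 / \<psi> s)"
    using integral_exceeds[OF \<psi>0 \<psi>loc inv_psi_div] by metis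
  \<comment> \<open>\<open>D1\<close> and \<open>D2\<close> are thresholds for
    \<open>\<Phi> L\<close> and \<open>- \<Phi> (- L)\<close>; pulled back by \<open>\<phi>\<close>
    they become lower bounds for one number \<open>L\<close>.\<close>
  define L where "L = max 1 (max (\<phi> D1) (- \<phi> (- D2)))"
  have L0: "0 < L" by (simp add: L_def)
  have big: "min (integral {\<Phi> N..\<Phi> L} (\<lambda>s. 1 / \<psi> s)) (integral {- \<Phi> (- N)..- \<Phi> (- L)} (\<lambda>s. 1 / \<psi> s))
      > L1_norm T l + Lq_norm q T \<mu> * (2 * M) powr qexp q"
  proof -
    have "\<phi> D1 \<le> L" "- L \<le> \<phi> (- D2)"
      unfolding L_def by linarith+
    then have "D1 \<le> \<Phi> L" "D2 \<le> - \<Phi> (- L)"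
      by (simp_all add: \<phi>_le)
    then show ?thesis
      using D1 D2 by (simp add: C_def)
  qed
  \<comment> \<open>Above \<open>L\<close>, so that the flux bound deactivates the clamp; above the
    barrier fluxes, so that clamping preserves the order relative to them; at least
    \<open>N\<close>, so that a flux stuck at \<open>c\<close> is steep enough.\<close>
  define c where "c = L + N + mA + mB"
  have c: "0 < c" "L < c" "N \<le> c" "\<And>t. t \<in> ?I \<Longrightarrow> \<bar>Aa t\<bar> < c" "\<And>t. t \<in> ?I \<Longrightarrow> \<bar>Ab t\<bar> < c"
    using L0 N(1) mA mB by (force simp: c_def)+
  define \<gamma> where "\<gamma> t = 5 * c / h t" for t
  have h_meas: "h \<in> borel_measurable ?L"
    using h_cont by (intro continuous_imp_measurable_on_sets_lebesgue) auto
  have \<gamma>: "Lp p T \<gamma>" "AE t in ?L. 0 \<le> \<gamma> t"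
  proof -
    show "Lp p T \<gamma>"
      unfolding \<gamma>_def using p_gt1 c(1) h_meas
      by (intro Lp_dominated[OF _ inv_h_Lp, where C = "5 * c"] borel_measurable_divide)
         (auto simp: abs_mult intro!: AE_I2)
    show "AE t in ?L. 0 \<le> \<gamma> t"
      using h_pos_ae by (rule eventually_mono) (use c(1) in \<open>simp add: \<gamma>_def\<close>)
  qed
  obtain hR where hR: "Lp p T hR" "\<And>y. Lp p T y \<Longrightarrow> (AE t in ?L. \<bar>y t\<bar> \<le> \<gamma> t) \<Longrightarrow>
        (AE t in ?L. \<forall>x. \<bar>x\<bar> \<le> M \<longrightarrow> \<bar>f t x (y t)\<bar> \<le> hR t)"
    using cond_ii[rule_format, OF M(1) conjI[OF \<gamma>]] by blast
  obtain Zk where Zk: "negligible Zk"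
    "\<And>t x y. t \<in> ?I - Zk \<Longrightarrow> \<bar>x\<bar> \<le> M \<Longrightarrow> \<bar>y\<bar> \<le> \<gamma> t \<Longrightarrow> \<bar>f t x y\<bar> \<le> hR t"
    using uniform_L1_bound[OF p_gt1 f_carath \<gamma> hR] by (auto simp: AE_lebesgue_on_iff)
  define Z where "Z = Za \<union> Zb \<union> Zh \<union> Zf \<union> Zg \<union> Zk"
  have Z: "negligible Z"
    unfolding Z_def by (intro negligible_Un \<alpha>(4) \<beta>(4) Zh Zf Zg Zk)
  have hZ: "0 < h t" "h t \<le> a t x" "0 < a t x" if "t \<in> ?I - Z" for t x
    using Zh(2)[of t] a_ge_h[rule_format, of t x] that by (auto simp: Z_def)
  define k where "k t = (if t \<in> Z then 0 else hR t)" for t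
  have k0: "0 \<le> k t" if "t \<in> ?I" for t
  proof (cases "t \<in> Z")
    case False
    then have "\<bar>f t 0 0\<bar> \<le> hR t"
      using that M(1) hZ(1)[of t] c(1) by (intro Zk(2)) (auto simp: Z_def \<gamma>_def)
    then show ?thesis using False by (simp add: k_def)
  qed (simp add: k_def)
  have k_int: "k integrable_on ?I"
    by (rule integrable_spike[OF integrable_on_lebesgue_on[OF Lp_integrable[OF p_gt1 hR(1)]] Z])
       (auto simp: k_def)
  have h_inv: "(\<lambda>t. 1 / h t) integrable_on ?I"
    by (rule integrable_on_lebesgue_on[OF Lp_integrable[OF p_gt1 inv_h_Lp]]) simp
  txt \<open>If \<open>\<bar>u 0\<bar> = U\<close>, the clamped flux stays at \<open>\<plusminus> c\<close> on all of \<open>[0, T]\<close> and \<open>x T\<close> overshoots \<open>[- M, M]\<close>.\<close>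
  define U where "U = \<bar>\<Phi> c\<bar> + \<bar>\<Phi> (- c)\<bar> + integral ?I k + 1"
  have kI0: "0 \<le> integral ?I k"
    by (intro Henstock_Kurzweil_Integration.integral_nonneg k_int k0)
  have U0: "0 < U"
    unfolding U_def using kI0 by linarith
  have f_meas: "(\<lambda>t. f t x y) \<in> borel_measurable ?L" for x y
    using f_carath by (simp add: caratheodory_def)
  have k_bound: "\<bar>f t x y\<bar> \<le> k t" if "t \<in> ?I - Z" "\<bar>x\<bar> \<le> M" "\<bar>y\<bar> \<le> 5 * c / h t" for t x y
    using Zk(2)[of t x y] that by (auto simp: Z_def k_def \<gamma>_def)
  have f_contZ: "continuous_on UNIV (\<lambda>(x, y). f t x y)" if "t \<in> ?I - Z" for t
    using Zf(2)[of t] that by (simp add: Z_def)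
  obtain x u where xc: "continuous_on ?I x" and uc: "continuous_on ?I u"
    and x_int: "\<And>t. t \<in> ?I \<Longrightarrow> ((\<lambda>s. clamp_to (- c) c (\<phi> (u s)) / a s (clamp_to (\<alpha> s) (\<beta> s) (x s)))
        has_integral (x t - x 0)) {0..t}"
    and u_int: "\<And>t. t \<in> ?I \<Longrightarrow> ((\<lambda>s. f s (clamp_to (\<alpha> s) (\<beta> s) (x s))
          (trunc_flux (\<alpha> s) (\<beta> s) (Aa s) (Ab s) (x s) (clamp_to (- c) c (\<phi> (u s))) / a s (clamp_to (\<alpha> s) (\<beta> s) (x s))))
        has_integral (u t - u 0)) {0..t}"
    and u0: "\<bar>u 0\<bar> \<le> U"
    and x0: "x 0 = clamp_to (\<alpha> 0) (\<beta> 0) (x 0 + P (x 0) (\<phi> (u 0)))"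
    and u0_eq: "u 0 = clamp_to (- U) U (u 0 - (x T - clamp_to (\<alpha> T) (\<beta> T) (x T + Q (x T) (\<phi> (u T)))))"
  proof (rule truncated_bvp[OF T_pos a_cont Z hZ(1,2) h_inv f_meas f_contZ \<phi>(1) \<alpha>c \<beta>c \<alpha>\<beta> M(2,3) \<alpha>(3) \<beta>(3)
        less_imp_le[OF c(4)] less_imp_le[OF c(5)] k_int k_bound P_cont Q_cont less_imp_le[OF U0]], assumption+, goal_cases)
    case (1 x u)
    show ?case
      by (rule that) fact+
  qed

  \<comment> \<open>Regularity of the truncated solution\<close>
  define d where "d t = clamp_to (\<alpha> t) (\<beta> t) (x t)" for t
  define v where "v t = clamp_to (- c) c (\<phi> (u t))" for t
  define y where "y t = trunc_flux (\<alpha> t) (\<beta> t) (Aa t) (Ab t) (x t) (v t) / a t (d t)" for t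
  have vc: "continuous_on ?I v"
    unfolding v_def by (intro continuous_intros continuous_on_compose2[OF \<phi>(1) uc]) auto
  have v_le: "\<bar>v t\<bar> \<le> c" for t
    unfolding v_def using c(1) by (intro abs_clamp_to_le') auto
  have d_btw: "\<alpha> t \<le> d t" "d t \<le> \<beta> t" "\<bar>d t\<bar> \<le> M" if "t \<in> ?I" for t
    using clamp_to_bounds[OF \<alpha>\<beta>[OF that], of "x t"] M(2,3)[OF that] by (auto simp: d_def abs_le_iff)
  \<comment> \<open>With value 0 on \<open>Z\<close> the majorants
    \<open>c * \<bar>1 / h t\<bar>\<close> and \<open>k t\<close> hold at every time, which gives
    absolute integrability.\<close>
  define x' where "x' t = (if t \<in> Z then 0 else v t / a t (d t))" for t
  define w where "w t = (if t \<in> Z then 0 else f t (d t) (y t))" for t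
  have x'_int: "(x' has_integral (x t - x 0)) {0..t}" if "t \<in> ?I" for t
    by (rule has_integral_spike[OF Z _ x_int[OF that]]) (simp add: x'_def v_def d_def)
  have w_int: "(w has_integral (u t - u 0)) {0..t}" if "t \<in> ?I" for t
    by (rule has_integral_spike[OF Z _ u_int[OF that]]) (simp add: w_def y_def v_def d_def)
  have x'_bound: "norm (x' t) \<le> c * \<bar>1 / h t\<bar>" if t: "t \<in> ?I" for t
  proof (cases "t \<in> Z")
    case False
    with t have tZ: "t \<in> ?I - Z" by simp
    have "\<bar>v t\<bar> / a t (d t) \<le> c / h t"
      using v_le[of t] hZ(1)[OF tZ] hZ(2,3)[OF tZ, of "d t"] by (intro frac_le) auto
    then show ?thesis
      using False hZ(1)[OF tZ] hZ(2,3)[OF tZ, of "d t"] by (simp add: x'_def)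
  qed (use c(1) in \<open>simp add: x'_def\<close>)
  have w_bound: "norm (w t) \<le> k t" if t: "t \<in> ?I" for t
  proof (cases "t \<in> Z")
    case False
    with t have tZ: "t \<in> ?I - Z" by simp
    have tf: "\<bar>trunc_flux (\<alpha> t) (\<beta> t) (Aa t) (Ab t) (x t) (v t)\<bar> \<le> 5 * c"
      using c(4,5)[OF t] v_le[of t] by (intro abs_trunc_flux_le) auto
    have "\<bar>y t\<bar> \<le> 5 * c / h t"
      unfolding y_def abs_divide using tf hZ(1)[OF tZ] hZ(2,3)[OF tZ, of "d t"] by (intro frac_le) auto
    then show ?thesis
      using k_bound[OF tZ d_btw(3)[OF t]] False by (simp add: w_def)
  qed (simp add: w_def k_def)
  have wd_x: "weak_deriv T x x'"
    unfolding weak_deriv_def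
  proof (intro conjI ballI)
    have "(\<lambda>t. \<bar>1 / h t\<bar>) integrable_on ?I"
      by (intro integrable_on_lebesgue_on integrable_abs Lp_integrable[OF p_gt1 inv_h_Lp]) simp
    then have "(\<lambda>t. c * \<bar>1 / h t\<bar>) integrable_on ?I"
      by (rule integrable_on_mult_right)
    then show "x' absolutely_integrable_on ?I"
      using x'_bound has_integral_integrable[OF x'_int[OF T0(2)]] by (intro absolutely_integrable_integrable_bound)
    show "x t = x 0 + integral {0..t} x'" if "t \<in> ?I" for t
      using integral_unique[OF x'_int[OF that]] by simp
  qed
  have wd_u: "weak_deriv T u w"
    unfolding weak_deriv_def
  proof (intro conjI ballI)
    show "w absolutely_integrable_on ?I"
      using w_bound has_integral_integrable[OF w_int[OF T0(2)]] k_int by (intro absolutely_integrable_integrable_bound)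
    show "u t = u 0 + integral {0..t} w" if "t \<in> ?I" for t
      using integral_unique[OF w_int[OF that]] by simp
  qed
  have u_near: "\<bar>u t - u 0\<bar> \<le> integral ?I k" if t: "t \<in> ?I" for t
  proof -
    have sub: "{0..t} \<subseteq> ?I" using t by auto
    have "norm (integral {0..t} w) \<le> integral {0..t} k"
      using w_bound sub has_integral_integrable[OF w_int[OF t]]
      by (intro integral_norm_bound_integral integrable_on_subinterval[OF k_int sub]) auto
    also have "\<dots> \<le> integral ?I k"
      using sub k0 by (intro integral_subset_le integrable_on_subinterval[OF k_int sub] k_int) auto
    finally show ?thesis
      using integral_unique[OF w_int[OF t]] by simp
  qed

  \<comment> \<open>The terminal condition holds without defect\<close>
  have a0_pos: "0 < ?a0 M"
  proof -
    have "0 < a 0 0"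
      \<comment> \<open>From \<open>h \<ge> 0\<close> alone \<open>a 0 0\<close> is only
        nonnegative; that \<open>a\<close> does not vanish at the ends makes it positive.\<close>
      using a_ends a_ge_h[rule_format, OF T0(1), of 0] h_nonneg[rule_format, OF T0(1)] by (metis less_le order_trans)
    also have "\<dots> \<le> ?a0 M"
      using M(1) by (intro le_Sup_image_Times[OF a_cont T0(1)]) simp
    finally show ?thesis .
  qed
  have steep: "2 * M < c / ?a0 M * T"
  proof -
    have "2 * M / T * ?a0 M \<le> max H (2 * M / T) * ?a0 M"
      using a0_pos by (intro mult_right_mono) auto
    then have "2 * M / T * ?a0 M < c"
      using N(2) c(3) by linarith
    then have "2 * M / T < c / ?a0 M"
      using a0_pos by (simp only: pos_less_divide_eq)
    then show ?thesis
      using T_pos by (simp only: pos_divide_less_eq)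
  qed
  have slope: "c / ?a0 M \<le> c / a t (d t)" if "t \<in> ?I - Z" for t
    using hZ(1)[OF that] hZ(2,3)[OF that, of "d t"] le_Sup_image_Times[OF a_cont, of t "d t" M] d_btw(3)[of t] that c(1)
    by (intro divide_left_mono) auto
  define xT where "xT = clamp_to (\<alpha> T) (\<beta> T) (x T + Q (x T) (\<phi> (u T)))"
  have xT: "\<alpha> T \<le> xT" "xT \<le> \<beta> T"
    using clamp_to_bounds[OF \<alpha>\<beta>[OF T0(2)]] by (auto simp: xT_def)
  have x0_btw: "\<alpha> 0 \<le> x 0" "x 0 \<le> \<beta> 0"
    using clamp_to_bounds[OF \<alpha>\<beta>[OF T0(1)], of "x 0 + P (x 0) (\<phi> (u 0))"] x0 by auto
  have M_ends: "\<bar>\<alpha> 0\<bar> \<le> M" "\<bar>\<beta> 0\<bar> \<le> M" "\<bar>\<alpha> T\<bar> \<le> M" "\<bar>\<beta> T\<bar> \<le> M"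
    using M(2,3) T0 by auto
  have "u 0 \<noteq> U"
  proof
    assume u0U: "u 0 = U"
    have "v t = c" if "t \<in> ?I" for t
    proof -
      have "\<Phi> c \<le> u t"
        using u_near[OF that] u0U unfolding U_def by linarith
      then have "c \<le> \<phi> (u t)" by (simp add: \<phi>_le)
      then show ?thesis
        using c(1) by (simp add: v_def clamp_to_def)
    qed
    then have "c / ?a0 M * (T - 0) \<le> x T - x 0"
      using T_pos slope by (intro increment_ge_AE[OF x'_int _ _ _ Z]) (auto simp: x'_def)
    \<comment> \<open>Starting at or above \<open>- M\<close>, \<open>x\<close> ends above
      \<open>M\<close> and hence above \<open>xT\<close>. The second fixed point equation would then
      lower \<open>u 0\<close> below \<open>U\<close>.\<close>
    then have "0 < x T - xT"
      using steep xT x0_btw M_ends by (simp add: abs_le_iff)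
    then have "clamp_to (- U) U (u 0 - (x T - xT)) < U"
      using u0U U0 by (simp add: clamp_to_def)
    then show False
      using u0_eq u0U by (simp add: xT_def)
  qed
  moreover have "u 0 \<noteq> - U"
  proof
    assume u0U: "u 0 = - U"
    have "v t = - c" if "t \<in> ?I" for t
    proof -
      have "u t \<le> \<Phi> (- c)"
        using u_near[OF that] u0U unfolding U_def by linarith
      then have "\<phi> (u t) \<le> - c" by (simp add: \<phi>_le)
      then show ?thesis
        using c(1) by (simp add: v_def clamp_to_def)
    qed
    then have "x T - x 0 \<le> - (c / ?a0 M) * (T - 0)"
      using T_pos slope by (intro increment_le_AE[OF x'_int _ _ _ Z]) (auto simp: x'_def)
    then have "x T - xT < 0"
      using steep xT x0_btw M_ends by (simp add: abs_le_iff)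
    then have "- U < clamp_to (- U) U (u 0 - (x T - xT))"
      using u0U U0 by (simp add: clamp_to_def)
    then show False
      using u0_eq u0U by (simp add: xT_def)
  qed
  \<comment> \<open>Strictly inside \<open>[- U, U]\<close> the clamp in \<open>u0_eq\<close> acts
    as the identity, so the subtracted defect is zero.\<close>
  ultimately have "x T = xT"
    using u0_eq u0 unfolding xT_def[symmetric] by (auto simp: clamp_to_def max_def min_def split: if_splits)
  then have xT_eq: "x T = clamp_to (\<alpha> T) (\<beta> T) (x T + Q (x T) (\<phi> (u T)))"
    by (simp add: xT_def)

  \<comment> \<open>Localisation between the barriers\<close>
  have x_ge: "\<alpha> t \<le> x t" if t: "t \<in> ?I" for t
  proof -
    have "0 \<le> x t - \<alpha> t"
    proof (rule barrier_nonneg[where y = "\<lambda>t. x t - \<alpha> t" and z = "\<lambda>t. u t - ua t" and r = "\<lambda>t. x' t - \<alpha>' t"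
          and \<rho> = "\<lambda>t. w t - wa t" and e = "\<lambda>t. v t - Aa t" and Z = Z and T = T])
      show "((\<lambda>t. x' t - \<alpha>' t) has_integral x t - \<alpha> t - (x 0 - \<alpha> 0)) {0..t}" if "t \<in> ?I" for t
        using has_integral_diff[OF x'_int[OF that] weak_derivD(3)[OF \<alpha>(1) that]] by (simp add: algebra_simps)
      show "((\<lambda>t. w t - wa t) has_integral u t - ua t - (u 0 - ua 0)) {0..t}" if "t \<in> ?I" for t
        using has_integral_diff[OF w_int[OF that] weak_derivD(3)[OF \<alpha>(2) that]] by (simp add: algebra_simps)
      show "continuous_on ?I (\<lambda>t. x t - \<alpha> t)" "continuous_on ?I (\<lambda>t. u t - ua t)" "continuous_on ?I (\<lambda>t. v t - Aa t)"
        by (intro continuous_intros xc uc vc \<alpha>c \<alpha>(3) weak_derivD(4)[OF \<alpha>(2)])+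
      show "0 \<le> x 0 - \<alpha> 0" "0 \<le> x T - \<alpha> T"
        using x0_btw xT \<open>x T = xT\<close> by auto
    next
      fix s assume s: "s \<in> ?I - Z" "x s - \<alpha> s < 0"
      have sI: "s \<in> ?I" "s \<notin> Z" using s by auto
      have ds: "d s = \<alpha> s"
        using s(2) \<alpha>\<beta>[OF sI(1)] by (simp add: d_def clamp_to_def)
      have \<alpha>'s: "\<alpha>' s = Aa s / a s (\<alpha> s)"
        using \<alpha>(6)[of s] s(1) hZ(3)[OF s(1), of "\<alpha> s"] by (simp add: Z_def)
      \<comment> \<open>Below \<open>\<alpha>\<close> the state is clamped to
        \<open>\<alpha>\<close>, so both slopes have the denominator \<open>a s (\<alpha> s)\<close>
        and comparing them means comparing fluxes. The clamp respects this comparison because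
        \<open>\<bar>Aa s\<bar> < c\<close>.\<close>
      have r: "x' s - \<alpha>' s = (v s - Aa s) / a s (\<alpha> s)"
        using sI(2) by (simp add: x'_def ds \<alpha>'s diff_divide_distrib)
      show "0 < x' s - \<alpha>' s" if "0 < u s - ua s"
      proof -
        have "Aa s < \<phi> (u s)"
          using that \<alpha>(5)[of s] by (simp add: \<phi>_less)
        then have "Aa s < v s"
          using c(4)[OF sI(1)] by (auto simp: v_def clamp_to_def)
        then show ?thesis
          unfolding r using hZ(3)[OF s(1), of "\<alpha> s"] by simp
      qed
      show "x' s - \<alpha>' s \<le> 0" if "u s - ua s \<le> 0"
      proof -
        have "\<phi> (u s) \<le> Aa s"
          using that \<alpha>(5)[of s] by (simp add: \<phi>_le)
        then have "v s \<le> Aa s"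
          using c(4)[OF sI(1)] by (auto simp: v_def clamp_to_def)
        then show ?thesis
          unfolding r using hZ(3)[OF s(1), of "\<alpha> s"] by (simp add: divide_le_0_iff)
      qed
      show "w s - wa s \<le> 0" if "\<bar>v s - Aa s\<bar> \<le> - (x s - \<alpha> s)"
      proof -
        have "trunc_flux (\<alpha> s) (\<beta> s) (Aa s) (Ab s) (x s) (v s) = Aa s"
          using that s(2) \<alpha>\<beta>[OF sI(1)] by (intro trunc_flux_below) auto
        then have "w s = f s (\<alpha> s) (\<alpha>' s)"
          using sI(2) by (simp add: w_def y_def ds \<alpha>'s)
        then show ?thesis
          using \<alpha>(7)[of s] s(1) by (simp add: Z_def)
      qed
    next
      fix s assume s: "s \<in> ?I" "u s - ua s = 0"
      then have "u s = \<Phi> (Aa s)"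
        using \<alpha>(5)[of s] by simp
      then have "\<phi> (u s) = Aa s"
        by (simp add: \<phi>(2))
      then show "v s - Aa s = 0"
        using c(4)[OF s(1)] by (auto simp: v_def clamp_to_def)
    qed (use Z t in auto)
    then show ?thesis by simp
  qed
  have x_le: "x t \<le> \<beta> t" if t: "t \<in> ?I" for t
  proof -
    \<comment> \<open>The differences are reversed, except for \<open>v - Ab\<close>, which enters
      only through its absolute value and its zeros.\<close>
    have "0 \<le> \<beta> t - x t"
    proof (rule barrier_nonneg[where y = "\<lambda>t. \<beta> t - x t" and z = "\<lambda>t. ub t - u t" and r = "\<lambda>t. \<beta>' t - x' t"
          and \<rho> = "\<lambda>t. wb t - w t" and e = "\<lambda>t. v t - Ab t" and Z = Z and T = T])
      show "((\<lambda>t. \<beta>' t - x' t) has_integral \<beta> t - x t - (\<beta> 0 - x 0)) {0..t}" if "t \<in> ?I" for t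
        using has_integral_diff[OF weak_derivD(3)[OF \<beta>(1) that] x'_int[OF that]] by (simp add: algebra_simps)
      show "((\<lambda>t. wb t - w t) has_integral ub t - u t - (ub 0 - u 0)) {0..t}" if "t \<in> ?I" for t
        using has_integral_diff[OF weak_derivD(3)[OF \<beta>(2) that] w_int[OF that]] by (simp add: algebra_simps)
      show "continuous_on ?I (\<lambda>t. \<beta> t - x t)" "continuous_on ?I (\<lambda>t. ub t - u t)" "continuous_on ?I (\<lambda>t. v t - Ab t)"
        by (intro continuous_intros xc uc vc \<beta>c \<beta>(3) weak_derivD(4)[OF \<beta>(2)])+
      show "0 \<le> \<beta> 0 - x 0" "0 \<le> \<beta> T - x T"
        using x0_btw xT \<open>x T = xT\<close> by auto
    next
      fix s assume s: "s \<in> ?I - Z" "\<beta> s - x s < 0"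
      have sI: "s \<in> ?I" "s \<notin> Z" using s by auto
      have ds: "d s = \<beta> s"
        using s(2) \<alpha>\<beta>[OF sI(1)] by (simp add: d_def clamp_to_def)
      have \<beta>'s: "\<beta>' s = Ab s / a s (\<beta> s)"
        using \<beta>(6)[of s] s(1) hZ(3)[OF s(1), of "\<beta> s"] by (simp add: Z_def)
      have r: "\<beta>' s - x' s = (Ab s - v s) / a s (\<beta> s)"
        using sI(2) by (simp add: x'_def ds \<beta>'s diff_divide_distrib)
      show "0 < \<beta>' s - x' s" if "0 < ub s - u s"
      proof -
        have "\<phi> (u s) < Ab s"
          using that \<beta>(5)[of s] by (simp add: \<phi>_less)
        then have "v s < Ab s"
          using c(5)[OF sI(1)] by (auto simp: v_def clamp_to_def)
        then show ?thesis
          unfolding r using hZ(3)[OF s(1), of "\<beta> s"] by simp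
      qed
      show "\<beta>' s - x' s \<le> 0" if "ub s - u s \<le> 0"
      proof -
        have "Ab s \<le> \<phi> (u s)"
          using that \<beta>(5)[of s] by (simp add: \<phi>_le)
        then have "Ab s \<le> v s"
          using c(5)[OF sI(1)] by (auto simp: v_def clamp_to_def)
        then show ?thesis
          unfolding r using hZ(3)[OF s(1), of "\<beta> s"] by (simp add: divide_le_0_iff)
      qed
      show "wb s - w s \<le> 0" if "\<bar>v s - Ab s\<bar> \<le> - (\<beta> s - x s)"
      proof -
        have "trunc_flux (\<alpha> s) (\<beta> s) (Aa s) (Ab s) (x s) (v s) = Ab s"
          using that s(2) \<alpha>\<beta>[OF sI(1)] by (intro trunc_flux_above) auto
        then have "w s = f s (\<beta> s) (\<beta>' s)"
          using sI(2) by (simp add: w_def y_def ds \<beta>'s)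
        then show ?thesis
          using \<beta>(7)[of s] s(1) by (simp add: Z_def)
      qed
    next
      fix s assume s: "s \<in> ?I" "ub s - u s = 0"
      then have "u s = \<Phi> (Ab s)"
        using \<beta>(5)[of s] by simp
      then have "\<phi> (u s) = Ab s"
        by (simp add: \<phi>(2))
      then show "v s - Ab s = 0"
        using c(5)[OF s(1)] by (auto simp: v_def clamp_to_def)
    qed (use Z t in auto)
    then show ?thesis by simp
  qed
  have d_eq: "d t = x t" if "t \<in> ?I" for t
    unfolding d_def using x_ge[OF that] x_le[OF that] by (rule clamp_to_id)
  have w_eq: "w t = f t (x t) (x' t)" if "t \<in> ?I - Z" for t
  proof -
    have "trunc_flux (\<alpha> t) (\<beta> t) (Aa t) (Ab t) (x t) (v t) = v t"
      using that x_ge x_le by (intro trunc_flux_inside) auto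
    then show ?thesis
      using that d_eq[of t] by (simp add: w_def y_def x'_def)
  qed

  \<comment> \<open>Flux bound and removal of the truncation\<close>
  define A where "A t = \<phi> (u t)" for t
  have u_eq: "u t = \<Phi> (A t)" for t
    by (simp add: A_def \<phi>(3))
  have A_cont: "continuous_on ?I A"
    unfolding A_def by (intro continuous_on_compose2[OF \<phi>(1) uc]) auto
  have btw: "\<alpha> t \<le> x t \<and> x t \<le> \<beta> t" if "t \<in> ?I" for t
    using x_ge[OF that] x_le[OF that] by blast
  have growthZ: "\<bar>f t x y\<bar> \<le> \<psi> \<bar>\<Phi> (a t x * y)\<bar> * (l t + \<mu> t * \<bar>y\<bar> powr qexp q)"
    if "t \<in> ?I - Z" "\<alpha> t \<le> x" "x \<le> \<beta> t" "H \<le> \<bar>y\<bar>" for t x y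
    using Zg(2)[of t x y] that by (simp add: Z_def)
  have flux_bound: "\<bar>A t\<bar> \<le> L'" if
    "\<And>t. t \<in> ?I - Z \<Longrightarrow> x' t = clamp_to (- c') c' (A t) / a t (x t)"
    "\<And>t. t \<in> ?I \<Longrightarrow> \<bar>\<alpha> t\<bar> \<le> M' \<and> \<bar>\<beta> t\<bar> \<le> M'"
    "0 < N'" "N' > max H (2 * M' / T) * ?a0 M'" "0 < \<Phi> N'" "\<Phi> (- N') < 0" "0 < L'" "L' \<le> c'"
    "min (integral {\<Phi> N'..\<Phi> L'} (\<lambda>s. 1 / \<psi> s)) (integral {- \<Phi> (- N')..- \<Phi> (- L')} (\<lambda>s. 1 / \<psi> s))
        > L1_norm T l + Lq_norm q T \<mu> * (2 * M') powr qexp q"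
    "t \<in> ?I" for M' N' L' c' t
    by (rule solution_flux_bound[OF T_pos Phi_mono a_cont Z hZ(3) H_pos growthZ psi_pos[rule_format] \<psi>loc
          q_gt1 mu_Lq mu_nonneg l_abs l_nonneg wd_x wd_u u_eq that(1) w_eq btw that(2-10)])
  have A_L: "\<bar>A t\<bar> \<le> L" if "t \<in> ?I" for t
  proof (rule flux_bound[OF _ _ N L0 less_imp_le[OF c(2)] big that])
    show "x' t = clamp_to (- c) c (A t) / a t (x t)" if "t \<in> ?I - Z" for t
      using that d_eq[of t] by (simp add: x'_def v_def A_def)
    show "\<bar>\<alpha> t\<bar> \<le> M \<and> \<bar>\<beta> t\<bar> \<le> M" if "t \<in> ?I" for t
      using M(2,3)[OF that] by blast
  qed
  \<comment> \<open>The bound \<open>L\<close> is strictly below the clamp level, so the clamped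
    flux is the flux and \<open>x\<close> solves the original equation.\<close>
  have v_eq: "v t = A t" if "t \<in> ?I" for t
    unfolding v_def A_def[symmetric] using A_L[OF that] c(2) by (intro clamp_to_id) auto
  have x'_eq: "x' t = A t / a t (x t)" if "t \<in> ?I - Z" for t
    using that d_eq[of t] v_eq[of t] by (simp add: x'_def)
  have A_eq: "A t = a t (x t) * x' t" if "t \<in> ?I - Z" for t
    using x'_eq[OF that] hZ(3)[OF that, of "x t"] by simp
  have A_AE: "AE t in ?L. A t = a t (x t) * x' t"
    using A_eq Z by (auto simp: AE_lebesgue_on_iff)
  have flux_x: "flux a T x t = A t" if "t \<in> ?I" for t
    by (rule flux_eq[where a = a, OF T_pos wd_x A_cont A_AE that])
  have sol: "is_solution \<Phi> a f T x"
    unfolding is_solution_def sol_rel_def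
  proof (intro exI conjI)
    show "weak_deriv T x x'" "weak_deriv T u w"
      by (rule wd_x, rule wd_u)
    show "AE t in ?L. u t = \<Phi> (a t (x t) * x' t)"
      using A_AE by (rule eventually_mono) (simp add: u_eq)
    show "AE t in ?L. w t = f t (x t) (x' t)"
      using w_eq Z by (auto simp: AE_lebesgue_on_iff)
  qed
  have "Lp p T x'"
  proof (rule Lp_dominated[OF _ inv_h_Lp])
    show "x' \<in> borel_measurable ?L"
      by (rule absolutely_integrable_imp_borel_measurable[OF weak_derivD(1)[OF wd_x]]) simp
    show "AE t in ?L. \<bar>x' t\<bar> \<le> c * \<bar>1 / h t\<bar>"
      by (rule AE_I2) (use x'_bound in \<open>simp add: space_restrict_space\<close>)
  qed (use p_gt1 c(1) in auto)
  with wd_x have W: "W1p p T x"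
    unfolding W1p_def by blast

  \<comment> \<open>Recovery of the boundary conditions\<close>
  have a_end_pos: "0 < a t y" if "t = 0 \<or> t = T" for t y
    using that a_ends a_ge_h[rule_format, of t y] h_nonneg[rule_format, of t] T0 by (metis less_le order_trans)
  \<comment> \<open>Almost everywhere the slopes are quotients of continuous functions whose
    denominators are positive at 0 and \<open>T\<close>. These quotients are the representatives
    required by the endpoint slope lemmas.\<close>
  have quot_cont: "continuous (at t within ?I) (\<lambda>t. B t / a t (g t))"
    if "t = 0 \<or> t = T" "continuous_on ?I B" "continuous_on ?I g" for t B g
  proof -
    have "continuous_on ?I (\<lambda>t. (t, g t))"
      by (intro continuous_intros that)
    from continuous_on_compose2[OF a_cont this]
    have "continuous_on ?I (\<lambda>t. a t (g t))"
      by (simp add: image_subset_iff)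
    then show ?thesis
      using that T0 a_end_pos[OF that(1), of "g t"]
      by (intro continuous_at_within_divide) (auto simp: continuous_on_eq_continuous_within)
  qed
  have slope_\<alpha>: "x' t - \<alpha>' t = A t / a t (x t) - Aa t / a t (\<alpha> t)" if "t \<in> ?I - Z" for t
    using x'_eq[OF that] \<alpha>(6)[of t] that hZ(3)[OF that, of "\<alpha> t"] by (simp add: Z_def)
  have slope_\<beta>: "\<beta>' t - x' t = Ab t / a t (\<beta> t) - A t / a t (x t)" if "t \<in> ?I - Z" for t
    using x'_eq[OF that] \<beta>(6)[of t] that hZ(3)[OF that, of "\<beta> t"] by (simp add: Z_def)
  have int_\<alpha>: "((\<lambda>t. x' t - \<alpha>' t) has_integral (x t - \<alpha> t - (x 0 - \<alpha> 0))) {0..t}" if "t \<in> ?I" for t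
    using has_integral_diff[OF x'_int[OF that] weak_derivD(3)[OF \<alpha>(1) that]] by (simp add: algebra_simps)
  have int_\<beta>: "((\<lambda>t. \<beta>' t - x' t) has_integral (\<beta> t - x t - (\<beta> 0 - x 0))) {0..t}" if "t \<in> ?I" for t
    using has_integral_diff[OF weak_derivD(3)[OF \<beta>(1) that] x'_int[OF that]] by (simp add: algebra_simps)
  have P0: "P (x 0) (A 0) = 0"
  proof -
    \<comment> \<open>Otherwise \<open>x 0 = \<alpha> 0\<close>, and \<open>x - \<alpha>\<close> has
      a minimum at 0. Its initial slope is nonnegative; with the common denominator
      \<open>a 0 (\<alpha> 0)\<close> this orders the fluxes, and monotonicity of \<open>P\<close>
      with the condition on \<open>\<alpha>\<close> gives
      \<open>P (x 0) (A 0) \<ge> 0\<close>.\<close>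
    have "\<not> x 0 + P (x 0) (A 0) < \<alpha> 0"
    proof
      assume lt: "x 0 + P (x 0) (A 0) < \<alpha> 0"
      then have x0\<alpha>: "x 0 = \<alpha> 0"
        using x0 \<alpha>\<beta>[OF T0(1)] by (simp add: clamp_to_def A_def)
      have "0 \<le> A 0 / a 0 (x 0) - Aa 0 / a 0 (\<alpha> 0)"
        by (rule initial_slope_nonneg[OF T_pos int_\<alpha> Z slope_\<alpha>])
           (use x_ge x0\<alpha> quot_cont[OF _ A_cont xc] quot_cont[OF _ \<alpha>(3) \<alpha>c] in \<open>auto intro!: continuous_diff\<close>)
      then have "Aa 0 \<le> A 0"
        using a_end_pos[of 0 "\<alpha> 0"] by (simp add: x0\<alpha> divide_le_cancel)
      then have "P (\<alpha> 0) (Aa 0) \<le> P (\<alpha> 0) (A 0)"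
        using P_mono by (simp add: mono_def)
      then show False
        using lt x0\<alpha> bc_alpha(1) \<alpha>(8)[OF T0(1)] by simp
    qed
    moreover have "\<not> \<beta> 0 < x 0 + P (x 0) (A 0)"
    proof
      assume lt: "\<beta> 0 < x 0 + P (x 0) (A 0)"
      then have x0\<beta>: "x 0 = \<beta> 0"
        using x0 \<alpha>\<beta>[OF T0(1)] by (simp add: clamp_to_def A_def)
      have "0 \<le> Ab 0 / a 0 (\<beta> 0) - A 0 / a 0 (x 0)"
        by (rule initial_slope_nonneg[OF T_pos int_\<beta> Z slope_\<beta>])
           (use x_le x0\<beta> quot_cont[OF _ A_cont xc] quot_cont[OF _ \<beta>(3) \<beta>c] in \<open>auto intro!: continuous_diff\<close>)
      then have "A 0 \<le> Ab 0"
        using a_end_pos[of 0 "\<beta> 0"] by (simp add: x0\<beta> divide_le_cancel)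
      then have "P (\<beta> 0) (A 0) \<le> P (\<beta> 0) (Ab 0)"
        using P_mono by (simp add: mono_def)
      then show False
        using lt x0\<beta> bc_beta(1) \<beta>(8)[OF T0(1)] by simp
    qed
    ultimately show ?thesis
      using x0 by (simp add: clamp_to_id A_def not_less)
  qed
  have Q0: "Q (x T) (A T) = 0"
  proof -
    \<comment> \<open>At \<open>T\<close> the sign of the one-sided slope is reversed and so is the
      order of the fluxes; \<open>Q\<close> is decreasing in the flux, which restores the inequality
      used at 0.\<close>
    have "\<not> x T + Q (x T) (A T) < \<alpha> T"
    proof
      assume lt: "x T + Q (x T) (A T) < \<alpha> T"
      then have xT\<alpha>: "x T = \<alpha> T"
        using xT_eq \<alpha>\<beta>[OF T0(2)] by (simp add: clamp_to_def A_def)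
      have "A T / a T (x T) - Aa T / a T (\<alpha> T) \<le> 0"
        by (rule terminal_slope_nonpos[OF T_pos int_\<alpha> Z slope_\<alpha>])
           (use x_ge xT\<alpha> quot_cont[OF _ A_cont xc] quot_cont[OF _ \<alpha>(3) \<alpha>c] in \<open>auto intro!: continuous_diff\<close>)
      then have "A T \<le> Aa T"
        using a_end_pos[of T "\<alpha> T"] by (simp add: xT\<alpha> divide_le_cancel)
      then have "Q (\<alpha> T) (Aa T) \<le> Q (\<alpha> T) (A T)"
        using Q_antimono by (simp add: antimono_def)
      then show False
        using lt xT\<alpha> bc_alpha(2) \<alpha>(8)[OF T0(2)] by simp
    qed
    moreover have "\<not> \<beta> T < x T + Q (x T) (A T)"
    proof
      assume lt: "\<beta> T < x T + Q (x T) (A T)"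
      then have xT\<beta>: "x T = \<beta> T"
        using xT_eq \<alpha>\<beta>[OF T0(2)] by (simp add: clamp_to_def A_def)
      have "Ab T / a T (\<beta> T) - A T / a T (x T) \<le> 0"
        by (rule terminal_slope_nonpos[OF T_pos int_\<beta> Z slope_\<beta>])
           (use x_le xT\<beta> quot_cont[OF _ A_cont xc] quot_cont[OF _ \<beta>(3) \<beta>c] in \<open>auto intro!: continuous_diff\<close>)
      then have "Ab T \<le> A T"
        using a_end_pos[of T "\<beta> T"] by (simp add: xT\<beta> divide_le_cancel)
      then have "Q (\<beta> T) (A T) \<le> Q (\<beta> T) (Ab T)"
        using Q_antimono by (simp add: antimono_def)
      then show False
        using lt xT\<beta> bc_beta(2) \<beta>(8)[OF T0(2)] by simp
    qed
    ultimately show ?thesis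
      using xT_eq by (simp add: clamp_to_id A_def not_less)
  qed
  show ?thesis
  proof (intro exI[of _ x] conjI sol W allI impI ballI)
    show "P (x 0) (flux a T x 0) = 0" "Q (x T) (flux a T x T) = 0"
      using P0 Q0 flux_x T0 by simp_all
    show "\<alpha> t \<le> x t" "x t \<le> \<beta> t" if "t \<in> ?I" for t
      using btw[OF that] by auto
  next
    fix M' N' L' t
    assume *: "0 < M' \<and> (\<forall>t\<in>?I. \<bar>\<alpha> t\<bar> \<le> M' \<and> \<bar>\<beta> t\<bar> \<le> M') \<and> 0 < N' \<and>
         max H (2 * M' / T) * ?a0 M' < N' \<and> 0 < \<Phi> N' \<and> \<Phi> (- N') < 0 \<and> 0 < L' \<and>
         L1_norm T l + Lq_norm q T \<mu> * (2 * M') powr qexp q <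
         min (integral {\<Phi> N'..\<Phi> L'} (\<lambda>s. 1 / \<psi> s)) (integral {- \<Phi> (- N')..- \<Phi> (- L')} (\<lambda>s. 1 / \<psi> s))"
      and t: "t \<in> ?I"
    show "\<bar>x t\<bar> \<le> M'"
      using btw[OF t] * t by (force simp: abs_le_iff)
    have "\<bar>A t\<bar> \<le> L'"
    \<comment> \<open>The level must be at least \<open>L'\<close>, and at least \<open>L\<close> so
      that the clamp leaves the known flux unchanged; the maximum satisfies both.\<close>
    proof (rule flux_bound[where c' = "max L L'" and M' = M' and N' = N'])
      show "x' t = clamp_to (- max L L') (max L L') (A t) / a t (x t)" if "t \<in> ?I - Z" for t
        using x'_eq[OF that] A_L[of t] that by (subst clamp_to_id) auto
    qed (use * t in auto)
    then show "\<bar>flux a T x t\<bar> \<le> L'"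
      using flux_x[OF t] by simp
  qed
qed

end
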